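(* Let $R \to A$ be a map of Noetherian rings and let $I$ be an ideal of $A$ such that $A/I$ is a finite $R$-module. Let $M$ be a finitely generated $A$-module. Then the following functions on $\operatorname{Spec} R$ are upper semicontinuous: (1) $\mathfrak p \mapsto \dim_{k(\mathfrak p)} M(\mathfrak p)/I^nM(\mathfrak p)$, for any $n$; (2) $\mathfrak p \mapsto \left(\dim_{k(\mathfrak p)} M(\mathfrak p)/IM(\mathfrak p),\ \dim_{k(\mathfrak p)} M(\mathfrak p)/I^2M(\mathfrak p),\ \ldots\right)$, with values in sequences of integers ordered lexicographically.
   Context: For a prime $\mathfrak p\in\operatorname{Spec} R$, $k(\mathfrak p)$ is the residue field of $R_{\mathfrak p}$, $A(\mathfrak p) := A\otimes_R k(\mathfrak p)$, and $M(\mathfrak p) := M\otimes_R k(\mathfrak p)$, a finite $A(\mathfrak p)$-module. A function $f\colon X\to\Lambda$ from a topological space $X$ to a partially ordered set $(\Lambda,\prec)$ is called upper semicontinuous if for each $\lambda\in\Lambda$ the set $\{x\in X \mid f(x)\prec\lambda\}$ (strict inequality) is open. *)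

theory Defs
  imports
    "HOL-Analysis.Abstract_Topology"
    "HOL-Library.Fun_Lexorder"
    "HOL-Algebra.Algebra"
    "Jordan_Normal_Form.Missing_VectorSpace"
begin

definition zariski :: "('r, 'x) ring_scheme \<Rightarrow> 'r set topology" where
  "zariski R = topology (\<lambda>U. \<exists>J. ideal J R \<and> U = {p. primeideal p R \<and> \<not> J \<subseteq> p})"

lemma (in cring) istopology_zariski:
  "istopology (\<lambda>U. \<exists>J. ideal J R \<and> U = {p. primeideal p R \<and> \<not> J \<subseteq> p})"
  unfolding istopology_def
proof (intro conjI allI impI)
  fix S T
  assume "\<exists>J. ideal J R \<and> S = {p. primeideal p R \<and> \<not> J \<subseteq> p}"
    and "\<exists>J. ideal J R \<and> T = {p. primeideal p R \<and> \<not> J \<subseteq> p}"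
  then obtain J K where J: "ideal J R" "S = {p. primeideal p R \<and> \<not> J \<subseteq> p}"
    and K: "ideal K R" "T = {p. primeideal p R \<and> \<not> K \<subseteq> p}" by blast
  have "J \<subseteq> p \<or> K \<subseteq> p" if p: "primeideal p R" and sub: "J \<inter> K \<subseteq> p" for p
  proof (rule ccontr)
    assume "\<not> (J \<subseteq> p \<or> K \<subseteq> p)"
    then obtain a b where ab: "a \<in> J" "a \<notin> p" "b \<in> K" "b \<notin> p" by blast
    then have c: "a \<in> carrier R" "b \<in> carrier R"
      using J K by (auto dest: ideal.Icarr)
    have "a \<otimes> b \<in> J \<inter> K"
      using ab c J K by (auto intro: ideal.I_l_closed ideal.I_r_closed)
    then show False using sub ab c primeideal.I_prime[OF p] by blast
  qed
  then have "S \<inter> T = {p. primeideal p R \<and> \<not> J \<inter> K \<subseteq> p}"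
    unfolding J(2) K(2) by blast
  then show "\<exists>J. ideal J R \<and> S \<inter> T = {p. primeideal p R \<and> \<not> J \<subseteq> p}"
    using i_intersect[OF J(1) K(1)] by blast
next
  fix \<U>
  assume "\<forall>U\<in>\<U>. \<exists>J. ideal J R \<and> U = {p. primeideal p R \<and> \<not> J \<subseteq> p}"
  then obtain J where J: "\<forall>U\<in>\<U>. ideal (J U) R \<and> U = {p. primeideal p R \<and> \<not> J U \<subseteq> p}"
    by (rule bchoice[THEN exE])
  have sub: "(\<Union>U\<in>\<U>. J U) \<subseteq> carrier R"
    using J by (meson UN_least ideal.Icarr subsetI)
  have mem: "p \<in> U \<longleftrightarrow> primeideal p R \<and> \<not> J U \<subseteq> p" if "U \<in> \<U>" for U p
    using bspec[OF J that, THEN conjunct2] by (metis (no_types, lifting) mem_Collect_eq)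
  have "p \<in> \<Union>\<U> \<longleftrightarrow> primeideal p R \<and> \<not> Idl (\<Union>U\<in>\<U>. J U) \<subseteq> p" for p
  proof (cases "primeideal p R")
    case True
    have "Idl (\<Union>U\<in>\<U>. J U) \<subseteq> p \<longleftrightarrow> (\<Union>U\<in>\<U>. J U) \<subseteq> p"
      using genideal_self[OF sub] genideal_minimal[OF primeideal.axioms(1)[OF True]]
      by (meson subset_trans)
    then show ?thesis using True by (simp add: mem UN_subset_iff)
  next
    case False
    then show ?thesis by (simp add: mem)
  qed
  then have "\<Union>\<U> = {p. primeideal p R \<and> \<not> Idl (\<Union>U\<in>\<U>. J U) \<subseteq> p}" by auto
  then show "\<exists>J. ideal J R \<and> \<Union>\<U> = {p. primeideal p R \<and> \<not> J \<subseteq> p}"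
    using genideal_ideal[OF sub] by (intro exI conjI)
qed

lemma (in cring) openin_zariski:
  "openin (zariski R) U \<longleftrightarrow> (\<exists>J. ideal J R \<and> U = {p. primeideal p R \<and> \<not> J \<subseteq> p})"
  unfolding zariski_def by (simp add: topology_inverse'[OF istopology_zariski])

lemma (in cring) topspace_zariski: "topspace (zariski R) = {p. primeideal p R}"
proof
  show "topspace (zariski R) \<subseteq> {p. primeideal p R}"
    using openin_topspace[of "zariski R"] unfolding openin_zariski by blast
  have "{p. primeideal p R} = {p. primeideal p R \<and> \<not> carrier R \<subseteq> p}"
  proof (intro Collect_cong iffI conjI notI)
    fix p assume p: "primeideal p R" and "carrier R \<subseteq> p"
    then have "carrier R = p"
      using ideal.Icarr[OF primeideal.axioms(1)[OF p]] by (intro equalityI subsetI) auto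
    then show False using primeideal.I_notcarr[OF p] by simp
  qed simp_all
  then have "openin (zariski R) {p. primeideal p R}"
    unfolding openin_zariski using oneideal by (intro exI[of _ "carrier R"] conjI)
  then show "{p. primeideal p R} \<subseteq> topspace (zariski R)"
    by (rule openin_subset)
qed

text \<open>The second argument is the strict order of the value type.\<close>

definition upper_semicontinuous :: "'a topology \<Rightarrow> ('b \<Rightarrow> 'b \<Rightarrow> bool) \<Rightarrow> ('a \<Rightarrow> 'b) \<Rightarrow> bool" where
  "upper_semicontinuous T prec f \<longleftrightarrow> (\<forall>l. openin T {x \<in> topspace T. prec (f x) l})"


text \<open>The fraction \<open>a / s\<close> is represented by its equivalence class in \<open>R \<times> S\<close>.\<close>

definition fraction :: "('r, 'x) ring_scheme \<Rightarrow> 'r set \<Rightarrow> 'r \<Rightarrow> 'r \<Rightarrow> ('r \<times> 'r) set" where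
  "fraction R S a s = {(b, t). b \<in> carrier R \<and> t \<in> S \<and>
     (\<exists>u\<in>S. u \<otimes>\<^bsub>R\<^esub> (t \<otimes>\<^bsub>R\<^esub> a) = u \<otimes>\<^bsub>R\<^esub> (s \<otimes>\<^bsub>R\<^esub> b))}"

definition localization :: "('r, 'x) ring_scheme \<Rightarrow> 'r set \<Rightarrow> ('r \<times> 'r) set ring" where
  "localization R S =
    \<lparr>carrier = {fraction R S a s | a s. a \<in> carrier R \<and> s \<in> S},
     monoid.mult = (\<lambda>C D. \<Union>(a, s)\<in>C. \<Union>(b, t)\<in>D. fraction R S (a \<otimes>\<^bsub>R\<^esub> b) (s \<otimes>\<^bsub>R\<^esub> t)),
     one = fraction R S \<one>\<^bsub>R\<^esub> \<one>\<^bsub>R\<^esub>,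
     ring.zero = fraction R S \<zero>\<^bsub>R\<^esub> \<one>\<^bsub>R\<^esub>,
     add = (\<lambda>C D. \<Union>(a, s)\<in>C. \<Union>(b, t)\<in>D.
              fraction R S (t \<otimes>\<^bsub>R\<^esub> a \<oplus>\<^bsub>R\<^esub> s \<otimes>\<^bsub>R\<^esub> b) (s \<otimes>\<^bsub>R\<^esub> t))\<rparr>"

definition local_ring_at :: "('r, 'x) ring_scheme \<Rightarrow> 'r set \<Rightarrow> ('r \<times> 'r) set ring" where
  "local_ring_at R p = localization R (carrier R - p)"

definition max_ideal_at :: "('r, 'x) ring_scheme \<Rightarrow> 'r set \<Rightarrow> ('r \<times> 'r) set set" where
  "max_ideal_at R p = {fraction R (carrier R - p) a s | a s. a \<in> p \<and> s \<in> carrier R - p}"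

definition residue_field :: "('r, 'x) ring_scheme \<Rightarrow> 'r set \<Rightarrow> ('r \<times> 'r) set set ring" where
  "residue_field R p = local_ring_at R p Quot max_ideal_at R p"

definition residue_map :: "('r, 'x) ring_scheme \<Rightarrow> 'r set \<Rightarrow> 'r \<Rightarrow> ('r \<times> 'r) set set" where
  "residue_map R p r =
     max_ideal_at R p +>\<^bsub>local_ring_at R p\<^esub> fraction R (carrier R - p) r \<one>\<^bsub>R\<^esub>"


text \<open>A module record extends a ring record; its fields \<open>mult\<close> and \<open>one\<close> play no role for a
  module and are filled with zeros below.\<close>

definition ring_as_module :: "('a, 'x) ring_scheme \<Rightarrow> ('a, 'a) module" where
  "ring_as_module A = \<lparr>carrier = carrier A, monoid.mult = (\<lambda>_ _. \<zero>\<^bsub>A\<^esub>), one = \<zero>\<^bsub>A\<^esub>,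
     ring.zero = \<zero>\<^bsub>A\<^esub>, add = add A, smult = monoid.mult A\<rparr>"

definition restrict_scalars :: "('r \<Rightarrow> 'a) \<Rightarrow> ('a, 'm, 'x) module_scheme \<Rightarrow> ('r, 'm) module" where
  "restrict_scalars \<phi> M = \<lparr>carrier = carrier M, monoid.mult = (\<lambda>_ _. \<zero>\<^bsub>M\<^esub>), one = \<zero>\<^bsub>M\<^esub>,
     ring.zero = \<zero>\<^bsub>M\<^esub>, add = add M, smult = (\<lambda>r. smult M (\<phi> r))\<rparr>"

definition finite_module :: "('r, 'x) ring_scheme \<Rightarrow> ('r, 'm, 'y) module_scheme \<Rightarrow> bool" where
  "finite_module R M \<longleftrightarrow> module R M \<and>
     (\<exists>S. finite S \<and> S \<subseteq> carrier M \<and> LinearCombinations.module.span R M S = carrier M)"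

definition quotient_module ::
    "('r, 'm, 'x) module_scheme \<Rightarrow> 'm set \<Rightarrow> ('r, 'm set) module" where
  "quotient_module M N = \<lparr>carrier = a_rcosets\<^bsub>M\<^esub> N, monoid.mult = (\<lambda>_ _. N), one = N,
     ring.zero = N, add = set_add M, smult = (\<lambda>r C. \<Union>x\<in>C. N +>\<^bsub>M\<^esub> (r \<odot>\<^bsub>M\<^esub> x))\<rparr>"

definition ideal_smult :: "'a set \<Rightarrow> ('a, 'm, 'x) module_scheme \<Rightarrow> 'm set" where
  "ideal_smult I M = generate (add_monoid M) {a \<odot>\<^bsub>M\<^esub> x | a x. a \<in> I \<and> x \<in> carrier M}"


definition tensor_relators :: "('r, 'x) ring_scheme \<Rightarrow> ('r, 'm, 'y) module_scheme \<Rightarrow>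
    ('r, 'n, 'z) module_scheme \<Rightarrow> ('m \<times> 'n \<Rightarrow>\<^sub>0 int) set" where
  "tensor_relators R M N =
     {frag_of (x \<oplus>\<^bsub>M\<^esub> y, z) - frag_of (x, z) - frag_of (y, z) | x y z.
        x \<in> carrier M \<and> y \<in> carrier M \<and> z \<in> carrier N} \<union>
     {frag_of (x, z \<oplus>\<^bsub>N\<^esub> w) - frag_of (x, z) - frag_of (x, w) | x z w.
        x \<in> carrier M \<and> z \<in> carrier N \<and> w \<in> carrier N} \<union>
     {frag_of (r \<odot>\<^bsub>M\<^esub> x, z) - frag_of (x, r \<odot>\<^bsub>N\<^esub> z) | r x z.
        r \<in> carrier R \<and> x \<in> carrier M \<and> z \<in> carrier N}"

definition tensor_kernel :: "('r, 'x) ring_scheme \<Rightarrow> ('r, 'm, 'y) module_scheme \<Rightarrow>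
    ('r, 'n, 'z) module_scheme \<Rightarrow> ('m \<times> 'n \<Rightarrow>\<^sub>0 int) set" where
  "tensor_kernel R M N =
     generate (free_Abelian_group (carrier M \<times> carrier N)) (tensor_relators R M N)"

text \<open>The tensor product of the \<open>R\<close>-modules \<open>M\<close> and \<open>N\<close>, as a module over any ring whose
  elements \<open>c\<close> act by \<open>x \<otimes> z \<mapsto> x' \<otimes> z'\<close>, where \<open>(x', z') = act c (x, z)\<close>. In both uses below
  \<open>act c\<close> multiplies one of the two factors, by an operation commuting with that of \<open>R\<close>.\<close>

definition tensor_module :: "('r, 'x) ring_scheme \<Rightarrow> ('r, 'm, 'y) module_scheme \<Rightarrow>
    ('r, 'n, 'z) module_scheme \<Rightarrow> ('c \<Rightarrow> 'm \<times> 'n \<Rightarrow> 'm \<times> 'n) \<Rightarrow>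
    ('c, ('m \<times> 'n \<Rightarrow>\<^sub>0 int) set) module" where
  "tensor_module R M N act =
    (let F = free_Abelian_group (carrier M \<times> carrier N); K = tensor_kernel R M N in
     \<lparr>carrier = carrier (F Mod K), monoid.mult = (\<lambda>_ _. \<one>\<^bsub>F Mod K\<^esub>), one = \<one>\<^bsub>F Mod K\<^esub>,
      ring.zero = \<one>\<^bsub>F Mod K\<^esub>, add = monoid.mult (F Mod K),
      smult = (\<lambda>c C. \<Union>u\<in>C. K #>\<^bsub>F\<^esub> frag_extend (\<lambda>q. frag_of (act c q)) u)\<rparr>)"


text \<open>For a ring homomorphism \<open>\<phi>\<close> from \<open>R\<close> to \<open>A\<close>, an \<open>A\<close>-module \<open>M\<close> and a prime \<open>p\<close> of \<open>R\<close>,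
  the tensor product \<open>M(p)\<close> of \<open>M\<close> and \<open>k(p)\<close> over \<open>R\<close> is a \<open>k(p)\<close>-module through the second
  factor and an \<open>A\<close>-module through the first. The latter structure is the one obtained from the
  \<open>A(p)\<close>-module structure along \<open>a \<mapsto> a \<otimes> 1\<close>, and it determines \<open>J M(p)\<close> for ideals \<open>J\<close> of \<open>A\<close>.\<close>

definition residue_module :: "('r, 'x) ring_scheme \<Rightarrow> 'r set \<Rightarrow> ('r, ('r \<times> 'r) set set) module" where
  "residue_module R p =
     restrict_scalars (residue_map R p) (ring_as_module (residue_field R p))"

definition fibre :: "('r, 'x) ring_scheme \<Rightarrow> ('r \<Rightarrow> 'a) \<Rightarrow> ('a, 'm, 'y) module_scheme \<Rightarrow> 'r set \<Rightarrow>
    (('r \<times> 'r) set set, ('m \<times> ('r \<times> 'r) set set \<Rightarrow>\<^sub>0 int) set) module" where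
  "fibre R \<phi> M p = tensor_module R (restrict_scalars \<phi> M) (residue_module R p)
     (\<lambda>c (x, z). (x, c \<otimes>\<^bsub>residue_field R p\<^esub> z))"

definition fibre_over :: "('r, 'x) ring_scheme \<Rightarrow> ('r \<Rightarrow> 'a) \<Rightarrow> ('a, 'm, 'y) module_scheme \<Rightarrow>
    'r set \<Rightarrow> ('a, ('m \<times> ('r \<times> 'r) set set \<Rightarrow>\<^sub>0 int) set) module" where
  "fibre_over R \<phi> M p = tensor_module R (restrict_scalars \<phi> M) (residue_module R p)
     (\<lambda>a (x, z). (a \<odot>\<^bsub>M\<^esub> x, z))"

text \<open>\<^const>\<open>vectorspace.dim\<close> is the least size of a finite spanning set and carries no information
  for an infinite-dimensional space. If \<open>A / I\<close> is a finite \<open>R\<close>-module, \<open>A\<close> is Noetherian and \<open>M\<close> is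
  finitely generated, then the dimension below is finite for \<open>J = I\<^sup>n\<close>.\<close>

definition fibre_dim :: "('r, 'x) ring_scheme \<Rightarrow> ('r \<Rightarrow> 'a) \<Rightarrow> ('a, 'm, 'y) module_scheme \<Rightarrow>
    'a set \<Rightarrow> 'r set \<Rightarrow> nat" where
  "fibre_dim R \<phi> M J p = vectorspace.dim (residue_field R p)
     (quotient_module (fibre R \<phi> M p) (ideal_smult J (fibre_over R \<phi> M p)))"

end

theory Submission
  imports Defs
begin

text \<open>
The fibre dimension counts generators, and generators of a finite module over a local ring spread to
a neighbourhood. Fix \<open>n\<close> and put \<open>J = I\<^sup>n\<close>. Since \<open>A\<close>
is Noetherian and \<open>A/I\<close> is finite over \<open>R\<close>, the \<open>R\<close>-module
\<open>M/JM\<close> is finite (\<open>finite_modulo_ideal_power\<close>), and \<open>M(p)/J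
M(p)\<close> is its fibre at \<open>p\<close>. Choose a set \<open>B\<close> of elements of
\<open>M\<close>, as small as possible, that generates \<open>M/JM\<close> modulo \<open>p\<close>
and up to denominators outside \<open>p\<close>. Nakayama's lemma yields one denominator
\<open>f\<close> outside \<open>p\<close> such that \<open>fM\<close> lies in \<open>RB + JM\<close>
(\<open>nakayama_elimination\<close>, \<open>local_basis\<close>). At every prime \<open>q\<close>
that does not contain \<open>f\<close> the images of \<open>B\<close> therefore span \<open>M(q)/J
M(q)\<close>, so the dimension there is at most \<open>card B\<close> (\<open>fibre_dim_le\<close>).

At \<open>p\<close> itself the dimension equals \<open>card B\<close>. To see this without an
explicit description of the kernel of the map from \<open>M\<close> to \<open>M(p)/J M(p)\<close>,
each \<open>b\<close> in \<open>B\<close> is given a coordinate functional: by minimality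
\<open>b\<close> does not lie in the saturation of the submodule generated by the other elements,
\<open>pM\<close> and \<open>JM\<close>, so the coefficient of \<open>b\<close>, a fraction with
denominator outside \<open>p\<close>, is a well-defined element of the residue field
(\<open>coordinate_functional\<close>). By the universal property of the tensor product these
functionals descend to \<open>M(p)/J M(p)\<close>, and a family of vectors with a dual family of
functionals is independent (\<open>card_le_fibre_dim\<close>). Hence the basic open set of
\<open>f\<close> is a neighbourhood of \<open>p\<close> on which the dimension does not exceed its
value at \<open>p\<close>, which is the first statement.

The second statement is formal: a sequence of upper semicontinuous integer functions is upper
semicontinuous for the lexicographic order, because a strict inequality at the first place of
difference survives when earlier entries can only drop
(\<open>upper_semicontinuous_less_fun\<close>).
\<close>

section \<open>Localizations and residue fields\<close>

locale multiplicative_set = cring R for R (structure) +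
  fixes S :: "'a set"
  assumes S_sub: "S \<subseteq> carrier R"
    and S_one [simp, intro]: "\<one> \<in> S"
    and S_mult [simp, intro]: "s \<in> S \<Longrightarrow> t \<in> S \<Longrightarrow> s \<otimes> t \<in> S"
begin

lemma S_carrier [simp]: "s \<in> S \<Longrightarrow> s \<in> carrier R"
  using S_sub by blast

lemma mem_fraction:
  "(b, t) \<in> fraction R S a s \<longleftrightarrow>
     b \<in> carrier R \<and> t \<in> S \<and> (\<exists>u\<in>S. u \<otimes> (t \<otimes> a) = u \<otimes> (s \<otimes> b))"
  by (simp add: fraction_def)

lemma fraction_self:
  assumes "a \<in> carrier R" "s \<in> S"
  shows "(a, s) \<in> fraction R S a s"
  using assms by (auto simp: mem_fraction)

text \<open>Cross-multiplication is transitive only up to a factor: the middle denominator \<open>t\<close> has to be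
  absorbed into the witness, which is why the relation allows one.\<close>

lemma fraction_cross_trans:
  assumes c: "a \<in> carrier R" "b \<in> carrier R" "c \<in> carrier R" "s \<in> S" "t \<in> S" "w \<in> S"
    and u: "u \<in> S" "u \<otimes> (t \<otimes> a) = u \<otimes> (s \<otimes> b)"
    and v: "v \<in> S" "v \<otimes> (w \<otimes> b) = v \<otimes> (t \<otimes> c)"
  shows "\<exists>z\<in>S. z \<otimes> (w \<otimes> a) = z \<otimes> (s \<otimes> c)"
proof
  have "(u \<otimes> v \<otimes> t) \<otimes> (w \<otimes> a) = v \<otimes> w \<otimes> (u \<otimes> (t \<otimes> a))"
    using c u(1) v(1) by (simp add: m_ac)
  also have "\<dots> = u \<otimes> s \<otimes> (v \<otimes> (w \<otimes> b))"
    unfolding u(2) using c u(1) v(1) by (simp add: m_ac)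
  also have "\<dots> = (u \<otimes> v \<otimes> t) \<otimes> (s \<otimes> c)"
    unfolding v(2) using c u(1) v(1) by (simp add: m_ac)
  finally show "(u \<otimes> v \<otimes> t) \<otimes> (w \<otimes> a) = (u \<otimes> v \<otimes> t) \<otimes> (s \<otimes> c)" .
qed (use c u v in simp)

lemma fraction_eq_iff:
  assumes c: "a \<in> carrier R" "b \<in> carrier R" "s \<in> S" "t \<in> S"
  shows "fraction R S a s = fraction R S b t \<longleftrightarrow> (\<exists>u\<in>S. u \<otimes> (t \<otimes> a) = u \<otimes> (s \<otimes> b))"
proof
  assume "fraction R S a s = fraction R S b t"
  then have "(b, t) \<in> fraction R S a s" using fraction_self c by blast
  then show "\<exists>u\<in>S. u \<otimes> (t \<otimes> a) = u \<otimes> (s \<otimes> b)" by (simp add: mem_fraction)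
next
  assume "\<exists>u\<in>S. u \<otimes> (t \<otimes> a) = u \<otimes> (s \<otimes> b)"
  then obtain u where u: "u \<in> S" "u \<otimes> (t \<otimes> a) = u \<otimes> (s \<otimes> b)" by blast
  show "fraction R S a s = fraction R S b t"
  proof (intro equalityI subrelI)
    fix d w assume "(d, w) \<in> fraction R S a s"
    then obtain v where d: "d \<in> carrier R" "w \<in> S" "v \<in> S" "v \<otimes> (w \<otimes> a) = v \<otimes> (s \<otimes> d)"
      by (auto simp: mem_fraction)
    show "(d, w) \<in> fraction R S b t"
      using fraction_cross_trans[OF c(2,1) d(1) c(4,3) d(2) u(1) u(2)[symmetric] d(3,4)] d
      by (simp add: mem_fraction)
  next
    fix d w assume "(d, w) \<in> fraction R S b t"
    then obtain v where d: "d \<in> carrier R" "w \<in> S" "v \<in> S" "v \<otimes> (w \<otimes> b) = v \<otimes> (t \<otimes> d)"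
      by (auto simp: mem_fraction)
    show "(d, w) \<in> fraction R S a s"
      using fraction_cross_trans[OF c(1,2) d(1) c(3,4) d(2) u d(3,4)] d
      by (simp add: mem_fraction)
  qed
qed

lemma fraction_eqI:
  assumes "t \<otimes> a = s \<otimes> b" "a \<in> carrier R" "b \<in> carrier R" "s \<in> S" "t \<in> S"
  shows "fraction R S a s = fraction R S b t"
  using assms by (subst fraction_eq_iff) auto

lemma carrier_localization:
  "carrier (localization R S) = {fraction R S a s | a s. a \<in> carrier R \<and> s \<in> S}"
  by (simp add: localization_def)

lemma fraction_in_localization [simp, intro]:
  "a \<in> carrier R \<Longrightarrow> s \<in> S \<Longrightarrow> fraction R S a s \<in> carrier (localization R S)"
  by (auto simp: carrier_localization)

lemma localization_cases:
  assumes "x \<in> carrier (localization R S)"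
  obtains a s where "x = fraction R S a s" "a \<in> carrier R" "s \<in> S"
  using assms by (auto simp: carrier_localization)

lemma localization_one: "\<one>\<^bsub>localization R S\<^esub> = fraction R S \<one> \<one>"
  and localization_zero: "\<zero>\<^bsub>localization R S\<^esub> = fraction R S \<zero> \<one>"
  by (simp_all add: localization_def)

text \<open>Both operations are unions over all representatives; the union collapses to the fraction
  formed from any one choice because that fraction does not depend on the choice.\<close>

lemma fraction_union:
  assumes c: "a \<in> carrier R" "b \<in> carrier R" "s \<in> S" "t \<in> S"
    and indep: "\<And>a' s' b' t'. (a', s') \<in> fraction R S a s \<Longrightarrow> (b', t') \<in> fraction R S b t \<Longrightarrow>
      F a' s' b' t' = F a s b t"
  shows "(\<Union>(a, s)\<in>fraction R S a s. \<Union>(b, t)\<in>fraction R S b t. F a s b t) = F a s b t"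
proof -
  have "(\<Union>(b', t')\<in>fraction R S b t. F a' s' b' t') = F a s b t"
    if "(a', s') \<in> fraction R S a s" for a' s'
    using fraction_self[OF c(2,4)] indep[OF that]
    by (intro SUP_eq_const) (auto split: prod.splits)
  then show ?thesis
    using fraction_self[OF c(1,3)] by (intro SUP_eq_const) (auto split: prod.splits)
qed

lemma fraction_mult:
  assumes c: "a \<in> carrier R" "b \<in> carrier R" "s \<in> S" "t \<in> S"
  shows "fraction R S a s \<otimes>\<^bsub>localization R S\<^esub> fraction R S b t = fraction R S (a \<otimes> b) (s \<otimes> t)"
proof -
  have "fraction R S (a' \<otimes> b') (s' \<otimes> t') = fraction R S (a \<otimes> b) (s \<otimes> t)"
    if h: "(a', s') \<in> fraction R S a s" "(b', t') \<in> fraction R S b t" for a' s' b' t'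
  proof -
    from h(1) obtain u where u: "a' \<in> carrier R" "s' \<in> S" "u \<in> S" "u \<otimes> (s' \<otimes> a) = u \<otimes> (s \<otimes> a')"
      by (auto simp: mem_fraction)
    from h(2) obtain v where v: "b' \<in> carrier R" "t' \<in> S" "v \<in> S" "v \<otimes> (t' \<otimes> b) = v \<otimes> (t \<otimes> b')"
      by (auto simp: mem_fraction)
    have "(u \<otimes> v) \<otimes> ((s' \<otimes> t') \<otimes> (a \<otimes> b)) = (u \<otimes> (s' \<otimes> a)) \<otimes> (v \<otimes> (t' \<otimes> b))"
      using c u(1-3) v(1-3) by (simp add: m_ac)
    also have "\<dots> = (u \<otimes> v) \<otimes> ((s \<otimes> t) \<otimes> (a' \<otimes> b'))"
      unfolding u(4) v(4) using c u(1-3) v(1-3) by (simp add: m_ac)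
    finally have "fraction R S (a \<otimes> b) (s \<otimes> t) = fraction R S (a' \<otimes> b') (s' \<otimes> t')"
      using c u v by (subst fraction_eq_iff) (auto intro!: bexI[of _ "u \<otimes> v"])
    then show ?thesis ..
  qed
  then show ?thesis
    unfolding localization_def monoid.simps ring.simps
    by (intro fraction_union[where F = "\<lambda>a s b t. fraction R S (a \<otimes> b) (s \<otimes> t)"] c)
qed

lemma fraction_add:
  assumes c: "a \<in> carrier R" "b \<in> carrier R" "s \<in> S" "t \<in> S"
  shows "fraction R S a s \<oplus>\<^bsub>localization R S\<^esub> fraction R S b t =
    fraction R S (t \<otimes> a \<oplus> s \<otimes> b) (s \<otimes> t)"
proof -
  have "fraction R S (t' \<otimes> a' \<oplus> s' \<otimes> b') (s' \<otimes> t') = fraction R S (t \<otimes> a \<oplus> s \<otimes> b) (s \<otimes> t)"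
    if h: "(a', s') \<in> fraction R S a s" "(b', t') \<in> fraction R S b t" for a' s' b' t'
  proof -
    from h(1) obtain u where u: "a' \<in> carrier R" "s' \<in> S" "u \<in> S" "u \<otimes> (s' \<otimes> a) = u \<otimes> (s \<otimes> a')"
      by (auto simp: mem_fraction)
    from h(2) obtain v where v: "b' \<in> carrier R" "t' \<in> S" "v \<in> S" "v \<otimes> (t' \<otimes> b) = v \<otimes> (t \<otimes> b')"
      by (auto simp: mem_fraction)
    note uS = S_carrier[OF u(2)] S_carrier[OF u(3)] S_carrier[OF v(2)] S_carrier[OF v(3)]
      S_carrier[OF c(3)] S_carrier[OF c(4)]
    have "(u \<otimes> v) \<otimes> ((s' \<otimes> t') \<otimes> (t \<otimes> a \<oplus> s \<otimes> b)) =
      (v \<otimes> t' \<otimes> t) \<otimes> (u \<otimes> (s' \<otimes> a)) \<oplus> (u \<otimes> s' \<otimes> s) \<otimes> (v \<otimes> (t' \<otimes> b))"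
      using c(1,2) u(1) v(1) uS by algebra
    also have "\<dots> = (u \<otimes> v) \<otimes> ((s \<otimes> t) \<otimes> (t' \<otimes> a' \<oplus> s' \<otimes> b'))"
      unfolding u(4) v(4) using c(1,2) u(1) v(1) uS by algebra
    finally have "fraction R S (t \<otimes> a \<oplus> s \<otimes> b) (s \<otimes> t) = fraction R S (t' \<otimes> a' \<oplus> s' \<otimes> b') (s' \<otimes> t')"
      using c u v by (subst fraction_eq_iff) (auto intro!: bexI[of _ "u \<otimes> v"])
    then show ?thesis ..
  qed
  then show ?thesis
    unfolding localization_def monoid.simps ring.simps
    by (intro fraction_union[where F = "\<lambda>a s b t. fraction R S (t \<otimes> a \<oplus> s \<otimes> b) (s \<otimes> t)"] c)
qed

lemma localization_cring: "cring (localization R S)" (is "cring ?L")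
proof (rule cringI)
  show "abelian_group ?L"
  proof (rule abelian_groupI)
    fix x y z assume "x \<in> carrier ?L" "y \<in> carrier ?L" "z \<in> carrier ?L"
    then obtain a s b t c u where e: "x = fraction R S a s" "y = fraction R S b t" "z = fraction R S c u"
      and c: "a \<in> carrier R" "b \<in> carrier R" "c \<in> carrier R" "s \<in> S" "t \<in> S" "u \<in> S"
      by (metis localization_cases)
    note cS = S_carrier[OF c(4)] S_carrier[OF c(5)] S_carrier[OF c(6)]
    show "x \<oplus>\<^bsub>?L\<^esub> y \<oplus>\<^bsub>?L\<^esub> z = x \<oplus>\<^bsub>?L\<^esub> (y \<oplus>\<^bsub>?L\<^esub> z)"
    proof -
      have "u \<otimes> (t \<otimes> a \<oplus> s \<otimes> b) \<oplus> s \<otimes> t \<otimes> c = t \<otimes> u \<otimes> a \<oplus> s \<otimes> (u \<otimes> b \<oplus> t \<otimes> c)"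
        using c(1-3) cS by algebra
      then show ?thesis using c by (simp add: e fraction_add m_assoc)
    qed
  next
    fix x y assume "x \<in> carrier ?L" "y \<in> carrier ?L"
    then obtain a s b t where e: "x = fraction R S a s" "y = fraction R S b t"
      and c: "a \<in> carrier R" "b \<in> carrier R" "s \<in> S" "t \<in> S"
      by (metis localization_cases)
    show "x \<oplus>\<^bsub>?L\<^esub> y \<in> carrier ?L" using c by (auto simp: e fraction_add)
    show "x \<oplus>\<^bsub>?L\<^esub> y = y \<oplus>\<^bsub>?L\<^esub> x" using c by (simp add: e fraction_add a_comm m_comm[of s t])
  next
    show "\<zero>\<^bsub>?L\<^esub> \<in> carrier ?L" by (simp add: localization_zero)
  next
    fix x assume "x \<in> carrier ?L"
    then obtain a s where e: "x = fraction R S a s" and c: "a \<in> carrier R" "s \<in> S"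
      by (metis localization_cases)
    show "\<zero>\<^bsub>?L\<^esub> \<oplus>\<^bsub>?L\<^esub> x = x" using c by (simp add: localization_zero e fraction_add)
    have "fraction R S (\<ominus> a) s \<oplus>\<^bsub>?L\<^esub> x = fraction R S (s \<otimes> \<ominus> a \<oplus> s \<otimes> a) (s \<otimes> s)"
      using c by (simp add: e fraction_add)
    also have "\<dots> = \<zero>\<^bsub>?L\<^esub>"
      unfolding localization_zero using c by (intro fraction_eqI) (simp_all add: r_minus l_neg)
    finally show "\<exists>y\<in>carrier ?L. y \<oplus>\<^bsub>?L\<^esub> x = \<zero>\<^bsub>?L\<^esub>" using c by blast
  qed
  show "comm_monoid ?L"
  proof (rule comm_monoidI)
    fix x y z assume "x \<in> carrier ?L" "y \<in> carrier ?L" "z \<in> carrier ?L"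
    then obtain a s b t c u where e: "x = fraction R S a s" "y = fraction R S b t" "z = fraction R S c u"
      and c: "a \<in> carrier R" "b \<in> carrier R" "c \<in> carrier R" "s \<in> S" "t \<in> S" "u \<in> S"
      by (metis localization_cases)
    show "x \<otimes>\<^bsub>?L\<^esub> y \<otimes>\<^bsub>?L\<^esub> z = x \<otimes>\<^bsub>?L\<^esub> (y \<otimes>\<^bsub>?L\<^esub> z)"
      using c by (simp add: e fraction_mult m_assoc)
  next
    fix x y assume "x \<in> carrier ?L" "y \<in> carrier ?L"
    then obtain a s b t where e: "x = fraction R S a s" "y = fraction R S b t"
      and c: "a \<in> carrier R" "b \<in> carrier R" "s \<in> S" "t \<in> S"
      by (metis localization_cases)
    show "x \<otimes>\<^bsub>?L\<^esub> y \<in> carrier ?L" using c by (auto simp: e fraction_mult)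
    show "x \<otimes>\<^bsub>?L\<^esub> y = y \<otimes>\<^bsub>?L\<^esub> x"
      using c by (simp add: e fraction_mult m_comm[of s t] m_comm[of a b])
  next
    show "\<one>\<^bsub>?L\<^esub> \<in> carrier ?L" by (simp add: localization_one)
  next
    fix x assume "x \<in> carrier ?L"
    then show "\<one>\<^bsub>?L\<^esub> \<otimes>\<^bsub>?L\<^esub> x = x"
      by (auto elim!: localization_cases simp: localization_one fraction_mult)
  qed
  fix x y z assume "x \<in> carrier ?L" "y \<in> carrier ?L" "z \<in> carrier ?L"
  then obtain a s b t c u where e: "x = fraction R S a s" "y = fraction R S b t" "z = fraction R S c u"
    and c: "a \<in> carrier R" "b \<in> carrier R" "c \<in> carrier R" "s \<in> S" "t \<in> S" "u \<in> S"
    by (metis localization_cases)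
  note cS = S_carrier[OF c(4)] S_carrier[OF c(5)] S_carrier[OF c(6)]
  have "s \<otimes> u \<otimes> (t \<otimes> u) \<otimes> ((t \<otimes> a \<oplus> s \<otimes> b) \<otimes> c) =
      s \<otimes> t \<otimes> u \<otimes> (t \<otimes> u \<otimes> (a \<otimes> c) \<oplus> s \<otimes> u \<otimes> (b \<otimes> c))"
    using c(1-3) cS by algebra
  then have "fraction R S ((t \<otimes> a \<oplus> s \<otimes> b) \<otimes> c) (s \<otimes> t \<otimes> u) =
      fraction R S (t \<otimes> u \<otimes> (a \<otimes> c) \<oplus> s \<otimes> u \<otimes> (b \<otimes> c)) (s \<otimes> u \<otimes> (t \<otimes> u))"
    using c by (intro fraction_eqI) simp_all
  then show "(x \<oplus>\<^bsub>?L\<^esub> y) \<otimes>\<^bsub>?L\<^esub> z = x \<otimes>\<^bsub>?L\<^esub> z \<oplus>\<^bsub>?L\<^esub> y \<otimes>\<^bsub>?L\<^esub> z"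
    using c by (simp add: e fraction_mult fraction_add)
qed

lemma fraction_one_hom: "(\<lambda>r. fraction R S r \<one>) \<in> ring_hom R (localization R S)"
  by (rule ring_hom_memI) (simp_all add: fraction_mult fraction_add localization_one)

end

context primeideal
begin

sublocale loc: multiplicative_set R "carrier R - I"
proof
  show "\<one> \<in> carrier R - I" using I_notcarr one_imp_carrier by blast
  show "s \<otimes> t \<in> carrier R - I" if "s \<in> carrier R - I" "t \<in> carrier R - I" for s t
    using that I_prime by auto
qed auto

lemma fraction_in_max_ideal_iff:
  assumes "a \<in> carrier R" "s \<in> carrier R - I"
  shows "fraction R (carrier R - I) a s \<in> max_ideal_at R I \<longleftrightarrow> a \<in> I"
proof
  assume "fraction R (carrier R - I) a s \<in> max_ideal_at R I"
  then obtain b t where b: "b \<in> I" "t \<in> carrier R - I"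
    and eq: "fraction R (carrier R - I) a s = fraction R (carrier R - I) b t"
    by (auto simp: max_ideal_at_def)
  obtain u where u: "u \<in> carrier R - I" "u \<otimes> (t \<otimes> a) = u \<otimes> (s \<otimes> b)"
    using eq loc.fraction_eq_iff[OF assms(1) Icarr[OF b(1)] assms(2) b(2)] by (elim iffD1[THEN bexE])
  have "u \<otimes> (s \<otimes> b) \<in> I" using u(1) b assms by (simp add: I_l_closed)
  then have "(u \<otimes> t) \<otimes> a \<in> I"
    using u b assms by (simp add: m_assoc)
  moreover have "u \<otimes> t \<in> carrier R - I" using u b by (intro loc.S_mult)
  ultimately show "a \<in> I"
    using I_prime assms(1) by blast
qed (use assms in \<open>auto simp: max_ideal_at_def\<close>)

lemma max_ideal_at_ideal: "ideal (max_ideal_at R I) (local_ring_at R I)"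
proof -
  let ?L = "local_ring_at R I" and ?f = "fraction R (carrier R - I)"
  interpret L: cring ?L
    unfolding local_ring_at_def by (rule loc.localization_cring)
  have carr: "x \<in> carrier ?L \<Longrightarrow> \<exists>a s. x = ?f a s \<and> a \<in> carrier R \<and> s \<in> carrier R - I" for x
    unfolding local_ring_at_def by (auto elim: loc.localization_cases)
  show ?thesis
  proof (rule idealI)
    show "subgroup (max_ideal_at R I) (add_monoid ?L)"
    proof (rule L.add.subgroupI)
      show "max_ideal_at R I \<subseteq> carrier ?L"
        unfolding local_ring_at_def max_ideal_at_def using Icarr by auto
      show "max_ideal_at R I \<noteq> {}"
        using additive_subgroup.zero_closed[OF is_additive_subgroup] loc.S_one
        unfolding max_ideal_at_def by blast
    next
      fix x assume "x \<in> max_ideal_at R I"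
      then obtain a s where a: "x = ?f a s" "a \<in> I" "s \<in> carrier R - I"
        by (auto simp: max_ideal_at_def)
      have ac: "a \<in> carrier R" using a(2) Icarr by blast
      have "?f (\<ominus> a) s \<oplus>\<^bsub>?L\<^esub> x = ?f (s \<otimes> \<ominus> a \<oplus> s \<otimes> a) (s \<otimes> s)"
        unfolding local_ring_at_def a(1) using a(3) ac by (intro loc.fraction_add) auto
      also have "\<dots> = \<zero>\<^bsub>?L\<^esub>"
        unfolding local_ring_at_def loc.localization_zero using a(3) ac
        by (intro loc.fraction_eqI loc.S_mult loc.S_one) (simp_all add: r_minus l_neg)
      finally have "\<ominus>\<^bsub>?L\<^esub> x = ?f (\<ominus> a) s"
        unfolding local_ring_at_def using a(1,3) ac
        by (intro L.minus_equality[unfolded local_ring_at_def]) (auto simp: local_ring_at_def)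
      then show "\<ominus>\<^bsub>?L\<^esub> x \<in> max_ideal_at R I"
        using a by (auto simp: max_ideal_at_def)
    next
      fix x y assume "x \<in> max_ideal_at R I" "y \<in> max_ideal_at R I"
      then obtain a s b t where a: "x = ?f a s" "a \<in> I" "s \<in> carrier R - I"
        and b: "y = ?f b t" "b \<in> I" "t \<in> carrier R - I"
        by (auto simp: max_ideal_at_def)
      have "x \<oplus>\<^bsub>?L\<^esub> y = ?f (t \<otimes> a \<oplus> s \<otimes> b) (s \<otimes> t)"
        using a b Icarr unfolding local_ring_at_def by (simp add: loc.fraction_add)
      moreover have "t \<otimes> a \<oplus> s \<otimes> b \<in> I" using a b by (simp add: I_l_closed)
      moreover have "s \<otimes> t \<in> carrier R - I" using a b by (intro loc.S_mult)
      ultimately show "x \<oplus>\<^bsub>?L\<^esub> y \<in> max_ideal_at R I"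
        unfolding max_ideal_at_def by blast
    qed
    have *: "x \<otimes>\<^bsub>?L\<^esub> y \<in> max_ideal_at R I" if "x \<in> carrier ?L" "y \<in> max_ideal_at R I" for x y
    proof -
      from that(2) obtain b t where b: "y = ?f b t" "b \<in> I" "t \<in> carrier R - I"
        by (auto simp: max_ideal_at_def)
      from carr[OF that(1)] obtain a s where a: "x = ?f a s" "a \<in> carrier R" "s \<in> carrier R - I"
        by blast
      have "x \<otimes>\<^bsub>?L\<^esub> y = ?f (a \<otimes> b) (s \<otimes> t)"
        using a b Icarr unfolding local_ring_at_def by (simp add: loc.fraction_mult)
      moreover have "a \<otimes> b \<in> I" using a b by (simp add: I_l_closed)
      moreover have "s \<otimes> t \<in> carrier R - I" using a b by (intro loc.S_mult)
      ultimately show ?thesis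
        unfolding max_ideal_at_def by blast
    qed
    show "x \<otimes>\<^bsub>?L\<^esub> a \<in> max_ideal_at R I" if "a \<in> max_ideal_at R I" "x \<in> carrier ?L" for a x
      using *[OF that(2,1)] .
    show "a \<otimes>\<^bsub>?L\<^esub> x \<in> max_ideal_at R I" if "a \<in> max_ideal_at R I" "x \<in> carrier ?L" for a x
    proof -
      have "a \<in> carrier ?L"
        using that(1) Icarr unfolding local_ring_at_def max_ideal_at_def by auto
      then show ?thesis using *[OF that(2,1)] L.m_comm[OF _ that(2)] by simp
    qed
  qed (rule L.ring_axioms)
qed

text \<open>An element outside the ideal has numerator and denominator outside the prime, so the inverted
  fraction is its inverse, and every strictly larger ideal contains a unit.\<close>

lemma max_ideal_at_maximal: "maximalideal (max_ideal_at R I) (local_ring_at R I)"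
proof -
  let ?L = "local_ring_at R I" and ?f = "fraction R (carrier R - I)"
  interpret L: cring ?L
    unfolding local_ring_at_def by (rule loc.localization_cring)
  show ?thesis
  proof (rule maximalidealI[OF max_ideal_at_ideal])
    have "\<one> \<notin> I" using loc.S_one by blast
    then have "\<one>\<^bsub>?L\<^esub> \<notin> max_ideal_at R I"
      using fraction_in_max_ideal_iff[OF one_closed loc.S_one]
      unfolding local_ring_at_def loc.localization_one by simp
    then show "carrier ?L \<noteq> max_ideal_at R I" using L.one_closed by blast
  next
    fix J assume J: "ideal J ?L" "max_ideal_at R I \<subseteq> J" "J \<subseteq> carrier ?L"
    show "J = max_ideal_at R I \<or> J = carrier ?L"
    proof (rule disjCI)
      assume "J \<noteq> carrier ?L"
      show "J = max_ideal_at R I"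
      proof (rule equalityI[OF subsetI J(2)], rule ccontr)
        fix x assume x: "x \<in> J" "x \<notin> max_ideal_at R I"
        then have "x \<in> carrier (localization R (carrier R - I))"
          using J(3) unfolding local_ring_at_def by blast
        then obtain a s where a: "x = ?f a s" "a \<in> carrier R" "s \<in> carrier R - I"
          by (rule loc.localization_cases)
        then have aI: "a \<in> carrier R - I" using x(2) fraction_in_max_ideal_iff by blast
        have "?f s a \<otimes>\<^bsub>?L\<^esub> x = ?f (s \<otimes> a) (a \<otimes> s)"
          unfolding local_ring_at_def a(1) using a(2,3) aI by (intro loc.fraction_mult) auto
        also have "\<dots> = \<one>\<^bsub>?L\<^esub>"
          unfolding local_ring_at_def loc.localization_one using a(2,3) aI
          by (intro loc.fraction_eqI loc.S_mult loc.S_one) (simp_all add: m_comm)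
        finally have "?f s a \<otimes>\<^bsub>?L\<^esub> x = \<one>\<^bsub>?L\<^esub>" .
        moreover have "?f s a \<in> carrier ?L"
          unfolding local_ring_at_def using a aI by blast
        ultimately have "\<one>\<^bsub>?L\<^esub> \<in> J" using ideal.I_l_closed[OF J(1) x(1)] by metis
        then show False using \<open>J \<noteq> carrier ?L\<close> ideal.one_imp_carrier[OF J(1)] by blast
      qed
    qed
  qed
qed

lemma residue_field_field: "field (residue_field R I)"
  unfolding residue_field_def
  by (rule maximalideal.quotient_is_field[OF max_ideal_at_maximal])
    (simp add: local_ring_at_def loc.localization_cring)

lemma residue_map_hom: "residue_map R I \<in> ring_hom R (residue_field R I)"
proof -
  have "residue_map R I = (\<lambda>x. max_ideal_at R I +>\<^bsub>local_ring_at R I\<^esub> x) \<circ>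
      (\<lambda>r. fraction R (carrier R - I) r \<one>)"
    by (simp add: residue_map_def fun_eq_iff)
  then show ?thesis
    unfolding residue_field_def
    using ring_hom_trans[OF loc.fraction_one_hom[folded local_ring_at_def]
      ideal.rcos_ring_hom[OF max_ideal_at_ideal]] by simp
qed

lemma residue_map_eq_zero_iff:
  assumes "r \<in> carrier R"
  shows "residue_map R I r = \<zero>\<^bsub>residue_field R I\<^esub> \<longleftrightarrow> r \<in> I"
proof -
  interpret m: ideal "max_ideal_at R I" "local_ring_at R I" by (rule max_ideal_at_ideal)
  have "fraction R (carrier R - I) r \<one> \<in> carrier (local_ring_at R I)"
    unfolding local_ring_at_def by (rule loc.fraction_in_localization[OF assms loc.S_one])
  then have "residue_map R I r = max_ideal_at R I \<longleftrightarrow>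
      fraction R (carrier R - I) r \<one> \<in> max_ideal_at R I"
    unfolding residue_map_def by (metis m.a_rcos_const m.a_rcos_self)
  then show ?thesis
    using fraction_in_max_ideal_iff[OF assms loc.S_one]
    by (simp add: residue_field_def FactRing_def)
qed

end

section \<open>Tensor products of modules\<close>

locale tensor_product = M: module R M + N: module R N
  for R (structure) and M :: "('a, 'm, 'y) module_scheme" and N :: "('a, 'n, 'z) module_scheme"
begin

abbreviation "F \<equiv> free_Abelian_group (carrier M \<times> carrier N)"
abbreviation "K \<equiv> tensor_kernel R M N"

definition cls :: "('m \<times> 'n \<Rightarrow>\<^sub>0 int) \<Rightarrow> ('m \<times> 'n \<Rightarrow>\<^sub>0 int) set" where
  "cls u = K #>\<^bsub>F\<^esub> u"

definition pure :: "'m \<Rightarrow> 'n \<Rightarrow> ('m \<times> 'n \<Rightarrow>\<^sub>0 int) set" where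
  "pure x z = cls (frag_of (x, z))"

lemma relators_in_F: "tensor_relators R M N \<subseteq> carrier F"
proof -
  have d: "u - v \<in> carrier F" if "u \<in> carrier F" "v \<in> carrier F" for u v
    using that keys_diff[of u v] by auto
  show ?thesis
    unfolding tensor_relators_def by (auto simp del: carrier_free_Abelian_group_iff intro!: d)
qed

lemma kernel_subgroup: "subgroup K F"
  unfolding tensor_kernel_def
  by (rule group.generate_is_subgroup[OF group_free_Abelian_group relators_in_F])

lemma kernel_normal: "K \<lhd> F"
  using kernel_subgroup comm_group.normal_iff_subgroup[OF abelian_free_Abelian_group] by blast

lemma kernel_keys: "u \<in> K \<Longrightarrow> Poly_Mapping.keys u \<subseteq> carrier M \<times> carrier N"
  using subgroup.mem_carrier[OF kernel_subgroup] by simp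

lemma kernel_zero: "0 \<in> K"
  using subgroup.one_closed[OF kernel_subgroup] by simp

lemma kernel_add: "u \<in> K \<Longrightarrow> v \<in> K \<Longrightarrow> u + v \<in> K"
  using subgroup.m_closed[OF kernel_subgroup, of u v] by simp

lemma kernel_minus: "u \<in> K \<Longrightarrow> - u \<in> K"
  using subgroup.m_inv_closed[OF kernel_subgroup, of u] kernel_keys[of u] by simp

lemma kernel_diff: "u \<in> K \<Longrightarrow> v \<in> K \<Longrightarrow> u - v \<in> K"
  using kernel_add[of u "- v"] kernel_minus[of v] by simp

lemma kernel_relator: "u \<in> tensor_relators R M N \<Longrightarrow> u \<in> K"
  unfolding tensor_kernel_def by (rule generate.incl)

lemma mem_cls: "v \<in> cls u \<longleftrightarrow> v - u \<in> K"
proof -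
  have "v \<in> cls u \<longleftrightarrow> (\<exists>k\<in>K. v = k + u)" by (auto simp: cls_def r_coset_def)
  also have "\<dots> \<longleftrightarrow> v - u \<in> K"
    by (metis add_diff_cancel_right' diff_add_cancel)
  finally show ?thesis .
qed

lemma cls_eq_iff: "cls u = cls v \<longleftrightarrow> u - v \<in> K"
proof
  assume "cls u = cls v"
  then show "u - v \<in> K" using kernel_zero by (metis cancel_comm_monoid_add_class.diff_cancel mem_cls)
next
  assume uv: "u - v \<in> K"
  have "w - u \<in> K \<longleftrightarrow> w - v \<in> K" for w
    using kernel_add[OF _ uv, of "w - u"] kernel_diff[OF _ uv, of "w - v"] by auto
  then show "cls u = cls v" by (auto simp: mem_cls)
qed

lemma carrier_tensor:
  "carrier (tensor_module R M N act) = cls ` {u. Poly_Mapping.keys u \<subseteq> carrier M \<times> carrier N}"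
  by (auto simp: tensor_module_def Let_def FactGroup_def RCOSETS_def cls_def)

lemma cls_closed [simp]:
  "Poly_Mapping.keys u \<subseteq> carrier M \<times> carrier N \<Longrightarrow> cls u \<in> carrier (tensor_module R M N act)"
  by (simp add: carrier_tensor)

lemma pure_closed [simp]:
  "x \<in> carrier M \<Longrightarrow> z \<in> carrier N \<Longrightarrow> pure x z \<in> carrier (tensor_module R M N act)"
  by (simp add: pure_def)

lemma zero_tensor: "\<zero>\<^bsub>tensor_module R M N act\<^esub> = cls 0"
proof -
  have "cls 0 = K" by (auto simp: mem_cls)
  then show ?thesis by (simp add: tensor_module_def Let_def FactGroup_def)
qed

lemma add_tensor:
  assumes "Poly_Mapping.keys u \<subseteq> carrier M \<times> carrier N" "Poly_Mapping.keys v \<subseteq> carrier M \<times> carrier N"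
  shows "cls u \<oplus>\<^bsub>tensor_module R M N act\<^esub> cls v = cls (u + v)"
  using normal.rcos_sum[OF kernel_normal, of u v] assms
  by (simp add: tensor_module_def Let_def FactGroup_def cls_def)

lemma abelian_group_tensor: "abelian_group (tensor_module R M N act)" (is "abelian_group ?T")
proof (rule abelian_groupI)
  have keys: "Poly_Mapping.keys (u + v) \<subseteq> carrier M \<times> carrier N"
    if "Poly_Mapping.keys u \<subseteq> carrier M \<times> carrier N" "Poly_Mapping.keys v \<subseteq> carrier M \<times> carrier N"
    for u v :: "'m \<times> 'n \<Rightarrow>\<^sub>0 int"
    using that keys_add[of u v] by blast
  fix a b c assume a: "a \<in> carrier ?T" and b: "b \<in> carrier ?T" and c: "c \<in> carrier ?T"
  show "a \<oplus>\<^bsub>?T\<^esub> b \<in> carrier ?T"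
    using a b keys by (auto simp: carrier_tensor add_tensor)
  show "a \<oplus>\<^bsub>?T\<^esub> b \<oplus>\<^bsub>?T\<^esub> c = a \<oplus>\<^bsub>?T\<^esub> (b \<oplus>\<^bsub>?T\<^esub> c)"
    using a b c keys by (auto simp: carrier_tensor add_tensor add.assoc)
  show "a \<oplus>\<^bsub>?T\<^esub> b = b \<oplus>\<^bsub>?T\<^esub> a"
    using a b by (auto simp: carrier_tensor add_tensor add.commute)
  show "\<zero>\<^bsub>?T\<^esub> \<oplus>\<^bsub>?T\<^esub> a = a"
    using a by (auto simp: carrier_tensor zero_tensor add_tensor)
  from a obtain u where u: "a = cls u" "Poly_Mapping.keys u \<subseteq> carrier M \<times> carrier N"
    by (auto simp: carrier_tensor)
  then show "\<exists>b\<in>carrier ?T. b \<oplus>\<^bsub>?T\<^esub> a = \<zero>\<^bsub>?T\<^esub>"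
    by (intro bexI[of _ "cls (- u)"]) (simp_all add: add_tensor zero_tensor)
qed (simp add: zero_tensor)

lemma pure_add_left:
  assumes "x \<in> carrier M" "y \<in> carrier M" "z \<in> carrier N"
  shows "pure (x \<oplus>\<^bsub>M\<^esub> y) z = pure x z \<oplus>\<^bsub>tensor_module R M N act\<^esub> pure y z"
proof -
  have "frag_of (x \<oplus>\<^bsub>M\<^esub> y, z) - frag_of (x, z) - frag_of (y, z) \<in> K"
    using assms by (intro kernel_relator) (auto simp: tensor_relators_def)
  then show ?thesis
    using assms by (simp add: pure_def add_tensor cls_eq_iff diff_diff_eq)
qed

lemma pure_add_right:
  assumes "x \<in> carrier M" "z \<in> carrier N" "w \<in> carrier N"
  shows "pure x (z \<oplus>\<^bsub>N\<^esub> w) = pure x z \<oplus>\<^bsub>tensor_module R M N act\<^esub> pure x w"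
proof -
  have "frag_of (x, z \<oplus>\<^bsub>N\<^esub> w) - frag_of (x, z) - frag_of (x, w) \<in> K"
    using assms by (intro kernel_relator) (auto simp: tensor_relators_def)
  then show ?thesis
    using assms by (simp add: pure_def add_tensor cls_eq_iff diff_diff_eq)
qed

lemma pure_balanced:
  assumes "r \<in> carrier R" "x \<in> carrier M" "z \<in> carrier N"
  shows "pure (r \<odot>\<^bsub>M\<^esub> x) z = pure x (r \<odot>\<^bsub>N\<^esub> z)"
  unfolding pure_def cls_eq_iff
  using assms by (intro kernel_relator) (auto simp: tensor_relators_def)

text \<open>Subtraction can be left out of the induction rule because the negative of a pure tensor is
  again a pure tensor.\<close>

lemma tensor_induct [consumes 1, case_names zero pure add]:
  assumes U: "U \<in> carrier (tensor_module R M N act)"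
    and zero: "P \<zero>\<^bsub>tensor_module R M N act\<^esub>"
    and pure: "\<And>x z. x \<in> carrier M \<Longrightarrow> z \<in> carrier N \<Longrightarrow> P (pure x z)"
    and add: "\<And>U W. U \<in> carrier (tensor_module R M N act) \<Longrightarrow> W \<in> carrier (tensor_module R M N act) \<Longrightarrow>
      P U \<Longrightarrow> P W \<Longrightarrow> P (U \<oplus>\<^bsub>tensor_module R M N act\<^esub> W)"
  shows "P U"
proof -
  let ?S = "carrier M \<times> carrier N"
  have neg: "cls (- frag_of (x, z)) = pure (\<ominus>\<^bsub>M\<^esub> x) z" if "x \<in> carrier M" "z \<in> carrier N" for x z
  proof -
    have "pure (\<ominus>\<^bsub>M\<^esub> x) z \<oplus>\<^bsub>tensor_module R M N act\<^esub> pure x z = pure \<zero>\<^bsub>M\<^esub> z"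
      using that by (simp add: pure_add_left[symmetric] M.l_neg)
    moreover have "pure \<zero>\<^bsub>M\<^esub> z \<oplus>\<^bsub>tensor_module R M N act\<^esub> pure \<zero>\<^bsub>M\<^esub> z = pure \<zero>\<^bsub>M\<^esub> z"
      using that by (simp add: pure_add_left[symmetric])
    ultimately have e: "frag_of (\<ominus>\<^bsub>M\<^esub> x, z) + frag_of (x, z) - frag_of (\<zero>\<^bsub>M\<^esub>, z) \<in> K"
      "frag_of (\<zero>\<^bsub>M\<^esub>, z) \<in> K"
      using that by (simp_all add: pure_def add_tensor cls_eq_iff)
    then have "- (frag_of (\<ominus>\<^bsub>M\<^esub> x, z) + frag_of (x, z)) \<in> K"
      using kernel_minus[OF kernel_add[OF e]] by simp
    then show ?thesis
      unfolding pure_def cls_eq_iff by (simp add: algebra_simps)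
  qed
  have "P (cls u) \<and> P (cls (- u))" if "Poly_Mapping.keys u \<subseteq> ?S" for u
    using that
  proof (rule free_Abelian_group_induct, goal_cases)
    case 1
    then show ?case using assms(2) by (simp add: zero_tensor)
  next
    case (2 a b)
    then have "P (cls (a + - b))" "P (cls (b + - a))"
      using add[of "cls a" "cls (- b)"] add[of "cls b" "cls (- a)"]
      by (simp_all add: add_tensor)
    then show ?case by simp
  next
    case (3 q)
    then show ?case using pure neg by (cases q) (auto simp: pure_def)
  qed
  then show ?thesis using U by (auto simp: carrier_tensor)
qed

text \<open>An additive and balanced map in both variables kills all relators, so the extension to formal
  sums is constant on classes.\<close>

lemma tensor_universal:
  assumes "abelian_group G"
    and closed: "\<And>x z. x \<in> carrier M \<Longrightarrow> z \<in> carrier N \<Longrightarrow> g x z \<in> carrier G"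
    and add_left: "\<And>x y z. x \<in> carrier M \<Longrightarrow> y \<in> carrier M \<Longrightarrow> z \<in> carrier N \<Longrightarrow>
      g (x \<oplus>\<^bsub>M\<^esub> y) z = g x z \<oplus>\<^bsub>G\<^esub> g y z"
    and add_right: "\<And>x z w. x \<in> carrier M \<Longrightarrow> z \<in> carrier N \<Longrightarrow> w \<in> carrier N \<Longrightarrow>
      g x (z \<oplus>\<^bsub>N\<^esub> w) = g x z \<oplus>\<^bsub>G\<^esub> g x w"
    and balanced: "\<And>r x z. r \<in> carrier R \<Longrightarrow> x \<in> carrier M \<Longrightarrow> z \<in> carrier N \<Longrightarrow>
      g (r \<odot>\<^bsub>M\<^esub> x) z = g x (r \<odot>\<^bsub>N\<^esub> z)"
  obtains \<psi> where "\<psi> \<in> carrier (tensor_module R M N act) \<rightarrow> carrier G"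
    and "\<And>x z. x \<in> carrier M \<Longrightarrow> z \<in> carrier N \<Longrightarrow> \<psi> (pure x z) = g x z"
    and "\<And>U W. U \<in> carrier (tensor_module R M N act) \<Longrightarrow> W \<in> carrier (tensor_module R M N act) \<Longrightarrow>
      \<psi> (U \<oplus>\<^bsub>tensor_module R M N act\<^esub> W) = \<psi> U \<oplus>\<^bsub>G\<^esub> \<psi> W"
proof -
  interpret G: abelian_group G by fact
  have img: "case_prod g ` (carrier M \<times> carrier N) \<subseteq> carrier (add_monoid G)"
    using closed by auto
  obtain h where h: "h \<in> hom F (add_monoid G)"
    and hq: "\<And>q. q \<in> carrier M \<times> carrier N \<Longrightarrow> h (frag_of q) = case_prod g q"
    by (rule comm_group.free_Abelian_group_universal[OF G.a_comm_group img]) (rule that)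
  interpret h: group_hom F "add_monoid G" h
    using h G.a_group by (simp add: group_hom_def group_hom_axioms_def)
  have h_closed: "h u \<in> carrier G" if "u \<in> carrier F" for u
    using h.hom_closed that by simp
  have h_add: "h (u + v) = h u \<oplus>\<^bsub>G\<^esub> h v" if "u \<in> carrier F" "v \<in> carrier F" for u v
    using h.hom_mult[OF that] by simp
  have h_minus: "h (- u) = \<ominus>\<^bsub>G\<^esub> h u" if "u \<in> carrier F" for u
    using h.hom_inv[OF that] that by (simp add: a_inv_def)
  have h_diff: "h (u - v) = h u \<ominus>\<^bsub>G\<^esub> h v" if "u \<in> carrier F" "v \<in> carrier F" for u v
    using h_add[of u "- v"] h_minus[OF that(2)] that by (simp add: a_minus_def)
  have diff_F: "u - v \<in> carrier F" if "u \<in> carrier F" "v \<in> carrier F" for u v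
    using that keys_diff[of u v] by auto
  have cancel: "a \<oplus>\<^bsub>G\<^esub> b \<ominus>\<^bsub>G\<^esub> a \<ominus>\<^bsub>G\<^esub> b = \<zero>\<^bsub>G\<^esub>" if "a \<in> carrier G" "b \<in> carrier G" for a b
    using that by (simp add: G.minus_eq G.a_comm[of a b] G.a_assoc G.r_neg)
  have rel: "h u = \<zero>\<^bsub>G\<^esub>" if "u \<in> tensor_relators R M N" for u
    using that unfolding tensor_relators_def
  proof (elim UnE CollectE exE conjE, goal_cases)
    case (1 x y z)
    then have "h u = g x z \<oplus>\<^bsub>G\<^esub> g y z \<ominus>\<^bsub>G\<^esub> g x z \<ominus>\<^bsub>G\<^esub> g y z"
      by (simp add: h_diff[simplified] hq diff_F[simplified] add_left)
    with 1 show ?case by (simp add: closed cancel)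
  next
    case (2 x z w)
    then have "h u = g x z \<oplus>\<^bsub>G\<^esub> g x w \<ominus>\<^bsub>G\<^esub> g x z \<ominus>\<^bsub>G\<^esub> g x w"
      by (simp add: h_diff[simplified] hq diff_F[simplified] add_right)
    with 2 show ?case by (simp add: closed cancel)
  next
    case (3 r x z)
    then have "h u = g x (r \<odot>\<^bsub>N\<^esub> z) \<ominus>\<^bsub>G\<^esub> g x (r \<odot>\<^bsub>N\<^esub> z)"
      by (simp add: h_diff[simplified] hq balanced)
    with 3 show ?case by (simp add: closed G.minus_eq G.r_neg)
  qed
  have "tensor_relators R M N \<subseteq> kernel F (add_monoid G) h"
  proof
    fix u assume u: "u \<in> tensor_relators R M N"
    show "u \<in> kernel F (add_monoid G) h"
      using subsetD[OF relators_in_F u] rel[OF u] by (simp add: kernel_def)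
  qed
  then have "K \<subseteq> kernel F (add_monoid G) h"
    unfolding tensor_kernel_def
    by (intro group.generate_subgroup_incl[OF group_free_Abelian_group _ h.subgroup_kernel])
  then have hK: "h u = \<zero>\<^bsub>G\<^esub>" if "u \<in> K" for u
    using that by (auto simp: kernel_def)
  define \<psi> where "\<psi> U = the_elem (h ` U)" for U
  have \<psi>: "\<psi> (cls u) = h u" if u: "u \<in> carrier F" for u
  proof -
    have "h v = h u" if "v \<in> cls u" for v
    proof -
      have "v - u \<in> K" using that by (simp add: mem_cls)
      then have "h ((v - u) + u) = \<zero>\<^bsub>G\<^esub> \<oplus>\<^bsub>G\<^esub> h u"
        using h_add[of "v - u" u] u hK kernel_keys by simp
      then show ?thesis using h_closed[OF u] by simp
    qed
    moreover have "u \<in> cls u" by (simp add: mem_cls kernel_zero)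
    ultimately have "h ` cls u = {h u}" by blast
    then show ?thesis by (simp add: \<psi>_def)
  qed
  show thesis
  proof (rule that[of \<psi>])
    show "\<psi> \<in> carrier (tensor_module R M N act) \<rightarrow> carrier G"
      using h_closed \<psi> by (auto simp: carrier_tensor)
    show "\<psi> (pure x z) = g x z" if "x \<in> carrier M" "z \<in> carrier N" for x z
      using that by (simp add: pure_def \<psi> hq)
    fix U W
    assume "U \<in> carrier (tensor_module R M N act)" "W \<in> carrier (tensor_module R M N act)"
    then obtain u v where "U = cls u" "W = cls v" "u \<in> carrier F" "v \<in> carrier F"
      by (auto simp: carrier_tensor)
    moreover from this have "u + v \<in> carrier F" using keys_add[of u v] by auto
    ultimately show "\<psi> (U \<oplus>\<^bsub>tensor_module R M N act\<^esub> W) = \<psi> U \<oplus>\<^bsub>G\<^esub> \<psi> W"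
      using h_add by (simp add: add_tensor \<psi>)
  qed
qed

text \<open>A pair of linear endomorphisms of the factors sends relators to relators, so it acts on the
  tensor product, and it is enough to know how it acts on pure tensors.\<close>

lemma smult_tensor:
  assumes f: "f \<in> module_hom R M M" and g: "g \<in> module_hom R N N"
    and act: "act c = (\<lambda>(x, z). (f x, g z))"
  shows "x \<in> carrier M \<Longrightarrow> z \<in> carrier N \<Longrightarrow> c \<odot>\<^bsub>tensor_module R M N act\<^esub> pure x z = pure (f x) (g z)"
    and "U \<in> carrier (tensor_module R M N act) \<Longrightarrow>
      c \<odot>\<^bsub>tensor_module R M N act\<^esub> U \<in> carrier (tensor_module R M N act)"
    and "U \<in> carrier (tensor_module R M N act) \<Longrightarrow> W \<in> carrier (tensor_module R M N act) \<Longrightarrow>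
      c \<odot>\<^bsub>tensor_module R M N act\<^esub> (U \<oplus>\<^bsub>tensor_module R M N act\<^esub> W) =
      c \<odot>\<^bsub>tensor_module R M N act\<^esub> U \<oplus>\<^bsub>tensor_module R M N act\<^esub> c \<odot>\<^bsub>tensor_module R M N act\<^esub> W"
proof -
  let ?e = "frag_extend (\<lambda>q. frag_of (act c q))" and ?S = "carrier M \<times> carrier N"
  have fc: "f x \<in> carrier M" if "x \<in> carrier M" for x
    using f that by (auto simp: module_hom_def)
  have gc: "g z \<in> carrier N" if "z \<in> carrier N" for z
    using g that by (auto simp: module_hom_def)
  have rel: "?e u \<in> tensor_relators R M N" if "u \<in> tensor_relators R M N" for u
    using that unfolding tensor_relators_def
  proof (elim UnE CollectE exE conjE, goal_cases)
    case (1 x y z)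
    then have "?e u = frag_of (f x \<oplus>\<^bsub>M\<^esub> f y, g z) - frag_of (f x, g z) - frag_of (f y, g z)"
      using f by (simp add: frag_extend_diff act module_hom_def)
    with 1 show ?case using fc gc by blast
  next
    case (2 x z w)
    then have "?e u = frag_of (f x, g z \<oplus>\<^bsub>N\<^esub> g w) - frag_of (f x, g z) - frag_of (f x, g w)"
      using g by (simp add: frag_extend_diff act module_hom_def)
    with 2 show ?case using fc gc by blast
  next
    case (3 r x z)
    then have "?e u = frag_of (r \<odot>\<^bsub>M\<^esub> f x, g z) - frag_of (f x, r \<odot>\<^bsub>N\<^esub> g z)"
      using f g by (simp add: frag_extend_diff act module_hom_def)
    with 3 show ?case using fc gc by blast
  qed
  have ker: "?e u \<in> K" if "u \<in> K" for u
  proof -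
    have "?e u \<in> K" if "u \<in> generate F (tensor_relators R M N)" for u
      using that
    proof (induction rule: generate.induct)
      case one
      then show ?case by (simp add: kernel_zero)
    next
      case (incl h)
      then show ?case using rel kernel_relator by blast
    next
      case (inv h)
      have "h \<in> carrier F" using inv relators_in_F by blast
      then have "inv\<^bsub>F\<^esub> h = - h" by simp
      then show ?case using inv rel kernel_relator kernel_minus by (simp add: frag_extend_minus)
    next
      case (eng h1 h2)
      then show ?case using kernel_add by (simp add: frag_extend_add)
    qed
    then show ?thesis using that by (simp add: tensor_kernel_def)
  qed
  have smult: "c \<odot>\<^bsub>tensor_module R M N act\<^esub> cls u = cls (?e u)" for u
  proof -
    have "cls (?e v) = cls (?e u)" if "v \<in> cls u" for v
      using ker[of "v - u"] that by (simp add: mem_cls cls_eq_iff frag_extend_diff)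
    moreover have "u \<in> cls u" by (simp add: mem_cls kernel_zero)
    ultimately have "(\<Union>v\<in>cls u. cls (?e v)) = cls (?e u)"
      by (intro SUP_eq_const) blast+
    then show ?thesis by (simp add: tensor_module_def Let_def cls_def)
  qed
  have keys: "Poly_Mapping.keys (?e u) \<subseteq> ?S" if "Poly_Mapping.keys u \<subseteq> ?S" for u
  proof (rule order_trans[OF keys_frag_extend UN_least])
    fix q assume "q \<in> Poly_Mapping.keys u"
    then have "q \<in> ?S" using that by blast
    then show "Poly_Mapping.keys (frag_of (act c q)) \<subseteq> ?S" by (auto simp: act fc gc)
  qed
  show "c \<odot>\<^bsub>tensor_module R M N act\<^esub> pure x z = pure (f x) (g z)"
    if "x \<in> carrier M" "z \<in> carrier N"
    by (simp add: pure_def smult act)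
  show "c \<odot>\<^bsub>tensor_module R M N act\<^esub> U \<in> carrier (tensor_module R M N act)"
    if "U \<in> carrier (tensor_module R M N act)"
    using that keys by (auto simp: carrier_tensor smult)
  show "c \<odot>\<^bsub>tensor_module R M N act\<^esub> (U \<oplus>\<^bsub>tensor_module R M N act\<^esub> W) =
      c \<odot>\<^bsub>tensor_module R M N act\<^esub> U \<oplus>\<^bsub>tensor_module R M N act\<^esub> c \<odot>\<^bsub>tensor_module R M N act\<^esub> W"
    if U: "U \<in> carrier (tensor_module R M N act)" and W: "W \<in> carrier (tensor_module R M N act)"
    using U W keys by (auto simp: carrier_tensor smult add_tensor frag_extend_add)
qed

text \<open>The action is additive, so the module laws need to be checked on pure tensors only.\<close>

lemma module_tensor:
  assumes C: "cring C"
    and f: "\<And>c. c \<in> carrier C \<Longrightarrow> f c \<in> module_hom R M M"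
    and g: "\<And>c. c \<in> carrier C \<Longrightarrow> g c \<in> module_hom R N N"
    and act: "\<And>c. act c = (\<lambda>(x, z). (f c x, g c z))"
    and one: "\<And>x z. x \<in> carrier M \<Longrightarrow> z \<in> carrier N \<Longrightarrow> pure (f \<one>\<^bsub>C\<^esub> x) (g \<one>\<^bsub>C\<^esub> z) = pure x z"
    and mult: "\<And>c d x z. c \<in> carrier C \<Longrightarrow> d \<in> carrier C \<Longrightarrow> x \<in> carrier M \<Longrightarrow> z \<in> carrier N \<Longrightarrow>
      pure (f (c \<otimes>\<^bsub>C\<^esub> d) x) (g (c \<otimes>\<^bsub>C\<^esub> d) z) = pure (f c (f d x)) (g c (g d z))"
    and add: "\<And>c d x z. c \<in> carrier C \<Longrightarrow> d \<in> carrier C \<Longrightarrow> x \<in> carrier M \<Longrightarrow> z \<in> carrier N \<Longrightarrow>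
      pure (f (c \<oplus>\<^bsub>C\<^esub> d) x) (g (c \<oplus>\<^bsub>C\<^esub> d) z) =
        pure (f c x) (g c z) \<oplus>\<^bsub>tensor_module R M N act\<^esub> pure (f d x) (g d z)"
  shows "module C (tensor_module R M N act)" (is "module C ?T")
proof -
  interpret C: cring C by fact
  interpret T: abelian_group ?T by (rule abelian_group_tensor)
  have sm1: "c \<odot>\<^bsub>?T\<^esub> pure x z = pure (f c x) (g c z)"
    if "c \<in> carrier C" "x \<in> carrier M" "z \<in> carrier N" for c x z
    by (rule smult_tensor(1)[where act = act and c = c, OF f[OF that(1)] g[OF that(1)] act that(2,3)])
  have sm2: "c \<odot>\<^bsub>?T\<^esub> U \<in> carrier ?T" if "c \<in> carrier C" "U \<in> carrier ?T" for c U
    by (rule smult_tensor(2)[where act = act and c = c, OF f[OF that(1)] g[OF that(1)] act that(2)])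
  have sm3: "c \<odot>\<^bsub>?T\<^esub> (U \<oplus>\<^bsub>?T\<^esub> W) = c \<odot>\<^bsub>?T\<^esub> U \<oplus>\<^bsub>?T\<^esub> c \<odot>\<^bsub>?T\<^esub> W"
    if "c \<in> carrier C" "U \<in> carrier ?T" "W \<in> carrier ?T" for c U W
    by (rule smult_tensor(3)[where act = act and c = c, OF f[OF that(1)] g[OF that(1)] act that(2,3)])
  have fc: "f c x \<in> carrier M" if "c \<in> carrier C" "x \<in> carrier M" for c x
    using f[OF that(1)] that(2) by (auto simp: module_hom_def)
  have gc: "g c z \<in> carrier N" if "c \<in> carrier C" "z \<in> carrier N" for c z
    using g[OF that(1)] that(2) by (auto simp: module_hom_def)
  have s0: "c \<odot>\<^bsub>?T\<^esub> \<zero>\<^bsub>?T\<^esub> = \<zero>\<^bsub>?T\<^esub>" if "c \<in> carrier C" for c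
  proof -
    have "c \<odot>\<^bsub>?T\<^esub> \<zero>\<^bsub>?T\<^esub> \<oplus>\<^bsub>?T\<^esub> c \<odot>\<^bsub>?T\<^esub> \<zero>\<^bsub>?T\<^esub> = c \<odot>\<^bsub>?T\<^esub> \<zero>\<^bsub>?T\<^esub>"
      using sm3[OF that T.zero_closed T.zero_closed] by simp
    then show ?thesis using sm2[OF that T.zero_closed] by simp
  qed
  show ?thesis
  proof (rule moduleI[OF C abelian_group_tensor])
    fix c U assume "c \<in> carrier C" "U \<in> carrier ?T"
    then show "c \<odot>\<^bsub>?T\<^esub> U \<in> carrier ?T" by (rule sm2)
  next
    fix c U W assume "c \<in> carrier C" "U \<in> carrier ?T" "W \<in> carrier ?T"
    then show "c \<odot>\<^bsub>?T\<^esub> (U \<oplus>\<^bsub>?T\<^esub> W) = c \<odot>\<^bsub>?T\<^esub> U \<oplus>\<^bsub>?T\<^esub> c \<odot>\<^bsub>?T\<^esub> W" by (rule sm3)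
  next
    fix c d U assume cd: "c \<in> carrier C" "d \<in> carrier C" and U: "U \<in> carrier ?T"
    have cd': "c \<oplus>\<^bsub>C\<^esub> d \<in> carrier C" "c \<otimes>\<^bsub>C\<^esub> d \<in> carrier C" using cd by simp_all
    show "(c \<oplus>\<^bsub>C\<^esub> d) \<odot>\<^bsub>?T\<^esub> U = c \<odot>\<^bsub>?T\<^esub> U \<oplus>\<^bsub>?T\<^esub> d \<odot>\<^bsub>?T\<^esub> U"
      using U
    proof (induction rule: tensor_induct)
      case zero
      then show ?case using cd cd' by (simp add: s0)
    next
      case (pure x z)
      then show ?case using sm1 cd cd' add by simp
    next
      case (add U W)
      then show ?case using sm2 sm3 cd cd' by (simp add: T.a_ac)
    qed
    show "(c \<otimes>\<^bsub>C\<^esub> d) \<odot>\<^bsub>?T\<^esub> U = c \<odot>\<^bsub>?T\<^esub> (d \<odot>\<^bsub>?T\<^esub> U)"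
      using U
    proof (induction rule: tensor_induct)
      case zero
      then show ?case using cd cd' by (simp add: s0)
    next
      case (pure x z)
      then show ?case using sm1 cd cd' mult fc gc by simp
    next
      case (add U W)
      then show ?case using sm2 sm3 cd cd' by simp
    qed
  next
    fix U assume U: "U \<in> carrier ?T"
    show "\<one>\<^bsub>C\<^esub> \<odot>\<^bsub>?T\<^esub> U = U"
      using U
    proof (induction rule: tensor_induct)
      case zero
      then show ?case by (simp add: s0)
    next
      case (pure x z)
      then show ?case using sm1 one by simp
    next
      case (add U W)
      then show ?case using sm3 by simp
    qed
  qed
qed

end

section \<open>Finitely generated modules near a prime\<close>

text \<open>The sums \<open>c\<^sub>1 s\<^sub>1 + \<dots> + c\<^sub>m s\<^sub>m + y\<close> with coefficients in \<open>C\<close>, terms in \<open>S\<close> and \<open>y\<close> in \<open>Q\<close>: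
  for \<open>C = R\<close> this is \<open>RS + Q\<close>, and for an ideal \<open>C\<close> and a generating set \<open>S\<close> of \<open>M\<close> it is
  \<open>CM + Q\<close>. The relative form is what the elimination below manipulates.\<close>

inductive_set comb :: "('r, 'm, 'y) module_scheme \<Rightarrow> 'r set \<Rightarrow> 'm set \<Rightarrow> 'm set \<Rightarrow> 'm set"
  for M C S Q where
  base: "y \<in> Q \<Longrightarrow> y \<in> comb M C S Q"
| step: "r \<in> C \<Longrightarrow> s \<in> S \<Longrightarrow> y \<in> comb M C S Q \<Longrightarrow> r \<odot>\<^bsub>M\<^esub> s \<oplus>\<^bsub>M\<^esub> y \<in> comb M C S Q"

context module
begin

lemma submodI:
  assumes "N \<subseteq> carrier M" "\<zero>\<^bsub>M\<^esub> \<in> N" "\<And>x y. x \<in> N \<Longrightarrow> y \<in> N \<Longrightarrow> x \<oplus>\<^bsub>M\<^esub> y \<in> N"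
    "\<And>r x. r \<in> carrier R \<Longrightarrow> x \<in> N \<Longrightarrow> r \<odot>\<^bsub>M\<^esub> x \<in> N"
  shows "LinearCombinations.submodule R N M"
  using assms module_axioms by (simp add: LinearCombinations.submodule_def)

lemma submodD:
  assumes "LinearCombinations.submodule R N M"
  shows "x \<in> N \<Longrightarrow> x \<in> carrier M" "\<zero>\<^bsub>M\<^esub> \<in> N" "x \<in> N \<Longrightarrow> y \<in> N \<Longrightarrow> x \<oplus>\<^bsub>M\<^esub> y \<in> N"
    "r \<in> carrier R \<Longrightarrow> x \<in> N \<Longrightarrow> r \<odot>\<^bsub>M\<^esub> x \<in> N"
    "x \<in> N \<Longrightarrow> \<ominus>\<^bsub>M\<^esub> x \<in> N" "x \<in> N \<Longrightarrow> y \<in> N \<Longrightarrow> x \<ominus>\<^bsub>M\<^esub> y \<in> N"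
proof -
  note d = assms[unfolded LinearCombinations.submodule_def]
  show c: "x \<in> carrier M" if "x \<in> N" for x using d that by blast
  show "\<zero>\<^bsub>M\<^esub> \<in> N" using d by blast
  show add: "x \<oplus>\<^bsub>M\<^esub> y \<in> N" if "x \<in> N" "y \<in> N" for x y using d that by blast
  show sm: "r \<odot>\<^bsub>M\<^esub> x \<in> N" if "r \<in> carrier R" "x \<in> N" for r x using d that by blast
  show neg: "\<ominus>\<^bsub>M\<^esub> x \<in> N" if "x \<in> N" for x
    using sm[of "\<ominus> \<one>" x] c that by (simp add: smult_l_minus)
  show "x \<ominus>\<^bsub>M\<^esub> y \<in> N" if "x \<in> N" "y \<in> N" for x y
    using add[OF that(1) neg[OF that(2)]] by (simp add: a_minus_def)
qed

lemma comb_subset: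
  assumes "LinearCombinations.submodule R Z M" "Q \<subseteq> Z" "\<And>r s. r \<in> C \<Longrightarrow> s \<in> S \<Longrightarrow> r \<odot>\<^bsub>M\<^esub> s \<in> Z"
  shows "comb M C S Q \<subseteq> Z"
proof
  fix y assume "y \<in> comb M C S Q"
  then show "y \<in> Z"
    by induction (use assms submodD(3)[OF assms(1)] in auto)
qed

lemma comb_submodule:
  assumes C: "ideal C R" and S: "S \<subseteq> carrier M" and Q: "LinearCombinations.submodule R Q M"
  shows "LinearCombinations.submodule R (comb M C S Q) M"
proof -
  interpret C: ideal C R by fact
  have carr: "y \<in> carrier M" if "y \<in> comb M C S Q" for y
    using that by induction (use S C.Icarr submodD(1)[OF Q] in auto)
  show ?thesis
  proof (rule submodI)
    show "\<zero>\<^bsub>M\<^esub> \<in> comb M C S Q" by (intro comb.base submodD(2)[OF Q])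
    show "comb M C S Q \<subseteq> carrier M" using carr by blast
  next
    fix x y assume x: "x \<in> comb M C S Q" and y: "y \<in> comb M C S Q"
    from x show "x \<oplus>\<^bsub>M\<^esub> y \<in> comb M C S Q"
    proof induction
      case (base x)
      from y show ?case
      proof induction
        case (base y)
        then show ?case using \<open>x \<in> Q\<close> by (intro comb.base submodD(3)[OF Q])
      next
        case (step r s y)
        have "r \<odot>\<^bsub>M\<^esub> s \<in> carrier M" using step C.Icarr S by blast
        then have "x \<oplus>\<^bsub>M\<^esub> (r \<odot>\<^bsub>M\<^esub> s \<oplus>\<^bsub>M\<^esub> y) = r \<odot>\<^bsub>M\<^esub> s \<oplus>\<^bsub>M\<^esub> (x \<oplus>\<^bsub>M\<^esub> y)"
          using \<open>x \<in> Q\<close> submodD(1)[OF Q] carr[OF step(3)] by (simp add: M.a_lcomm)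
        then show ?case using comb.step step by metis
      qed
    next
      case (step r s z)
      have "r \<odot>\<^bsub>M\<^esub> s \<in> carrier M" using step C.Icarr S by blast
      then have "r \<odot>\<^bsub>M\<^esub> s \<oplus>\<^bsub>M\<^esub> z \<oplus>\<^bsub>M\<^esub> y = r \<odot>\<^bsub>M\<^esub> s \<oplus>\<^bsub>M\<^esub> (z \<oplus>\<^bsub>M\<^esub> y)"
        using carr[OF step(3)] carr[OF y] by (simp add: M.a_assoc)
      then show ?case using comb.step step by metis
    qed
  next
    fix r x assume r: "r \<in> carrier R" and x: "x \<in> comb M C S Q"
    from x show "r \<odot>\<^bsub>M\<^esub> x \<in> comb M C S Q"
    proof induction
      case (base y)
      then show ?case using r by (intro comb.base submodD(4)[OF Q])
    next
      case (step c s y)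
      have c: "c \<in> carrier R" "s \<in> carrier M" "r \<otimes> c \<in> C"
        using step C.Icarr S C.I_l_closed[OF step(1) r] by auto
      have "r \<odot>\<^bsub>M\<^esub> (c \<odot>\<^bsub>M\<^esub> s \<oplus>\<^bsub>M\<^esub> y) = (r \<otimes> c) \<odot>\<^bsub>M\<^esub> s \<oplus>\<^bsub>M\<^esub> r \<odot>\<^bsub>M\<^esub> y"
        using r c carr[OF step(3)] by (simp add: smult_r_distr smult_assoc1)
      then show ?case using comb.step[OF c(3) step(2,4)] by simp
    qed
  qed
qed

lemma comb_mono: "C \<subseteq> C' \<Longrightarrow> S \<subseteq> S' \<Longrightarrow> Q \<subseteq> Q' \<Longrightarrow> comb M C S Q \<subseteq> comb M C' S' Q'"
proof
  fix y assume sub: "C \<subseteq> C'" "S \<subseteq> S'" "Q \<subseteq> Q'" and "y \<in> comb M C S Q"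
  from this(4) show "y \<in> comb M C' S' Q'"
    by induction (use sub in \<open>auto intro: comb.intros\<close>)
qed

lemma comb_gen:
  assumes "LinearCombinations.submodule R Q M" "r \<in> C" "s \<in> S" "r \<odot>\<^bsub>M\<^esub> s \<in> carrier M"
  shows "r \<odot>\<^bsub>M\<^esub> s \<in> comb M C S Q"
  using comb.step[where M = M, OF assms(2,3) comb.base[OF submodD(2)[OF assms(1)]]] assms(4) by simp

lemma comb_insert:
  assumes C: "ideal C R" and S: "insert s S \<subseteq> carrier M" and Q: "LinearCombinations.submodule R Q M"
    and y: "y \<in> comb M C (insert s S) Q"
  obtains r z where "r \<in> C" "z \<in> comb M C S Q" "y = r \<odot>\<^bsub>M\<^esub> s \<oplus>\<^bsub>M\<^esub> z"
proof -
  interpret C: ideal C R by fact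
  have sub: "LinearCombinations.submodule R (comb M C S Q) M"
    using comb_submodule[OF C _ Q] S by simp
  note carr = submodD(1)[OF sub]
  have s: "s \<in> carrier M" using S by simp
  from y have "\<exists>r\<in>C. \<exists>z\<in>comb M C S Q. y = r \<odot>\<^bsub>M\<^esub> s \<oplus>\<^bsub>M\<^esub> z"
  proof induction
    case (base y)
    then have "y \<in> comb M C S Q" by (rule comb.base)
    then show ?case using C.zero_closed s carr by (intro bexI[of _ \<zero>] bexI[of _ y]) auto
  next
    case (step c t y)
    then obtain r z where r: "r \<in> C" "z \<in> comb M C S Q" "y = r \<odot>\<^bsub>M\<^esub> s \<oplus>\<^bsub>M\<^esub> z" by blast
    have rc: "r \<in> carrier R" "c \<in> carrier R" "z \<in> carrier M" "t \<in> carrier M"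
      using r step C.Icarr carr S by auto
    show ?case
    proof (cases "t = s")
      case True
      have "c \<odot>\<^bsub>M\<^esub> t \<oplus>\<^bsub>M\<^esub> y = (c \<oplus> r) \<odot>\<^bsub>M\<^esub> s \<oplus>\<^bsub>M\<^esub> z"
        using rc s r(3) True by (simp add: smult_l_distr M.a_assoc)
      then show ?thesis using r C.a_closed[OF step(1) r(1)] by blast
    next
      case False
      then have "t \<in> S" using step by blast
      then have "c \<odot>\<^bsub>M\<^esub> t \<oplus>\<^bsub>M\<^esub> z \<in> comb M C S Q" using step r by (intro comb.step)
      moreover have "c \<odot>\<^bsub>M\<^esub> t \<oplus>\<^bsub>M\<^esub> y = r \<odot>\<^bsub>M\<^esub> s \<oplus>\<^bsub>M\<^esub> (c \<odot>\<^bsub>M\<^esub> t \<oplus>\<^bsub>M\<^esub> z)"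
        using rc s r(3) by (simp add: M.a_lcomm)
      ultimately show ?thesis using r by blast
    qed
  qed
  then show thesis using that by blast
qed

lemma multiples_submodule:
  assumes Q: "LinearCombinations.submodule R Q M" and f: "f \<in> carrier R"
  shows "LinearCombinations.submodule R {x \<in> carrier M. f \<odot>\<^bsub>M\<^esub> x \<in> Q} M"
proof (rule submodI)
  fix r x assume "r \<in> carrier R" "x \<in> {x \<in> carrier M. f \<odot>\<^bsub>M\<^esub> x \<in> Q}"
  moreover from this have "f \<odot>\<^bsub>M\<^esub> (r \<odot>\<^bsub>M\<^esub> x) = r \<odot>\<^bsub>M\<^esub> (f \<odot>\<^bsub>M\<^esub> x)"
    using f by (simp add: smult_assoc1[symmetric] R.m_comm)
  ultimately show "r \<odot>\<^bsub>M\<^esub> x \<in> {x \<in> carrier M. f \<odot>\<^bsub>M\<^esub> x \<in> Q}"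
    using submodD(4)[OF Q] by simp
qed (use f submodD[OF Q] in \<open>auto simp: smult_r_distr\<close>)

text \<open>Nakayama's lemma over the local ring at \<open>p\<close>, with denominators cleared. The relation for one
  generator \<open>s\<close> reads \<open>(u - c) s = y\<close> with \<open>u\<close> outside \<open>p\<close> and \<open>c\<close> in \<open>p\<close>, so \<open>u - c\<close> is outside \<open>p\<close>
  and \<open>s\<close> can be eliminated from the relations of the other generators.\<close>

lemma nakayama_elimination:
  assumes p: "primeideal p R" and Q: "LinearCombinations.submodule R Q M"
    and S: "finite S" "S \<subseteq> carrier M"
    and rel: "\<forall>s\<in>S. \<exists>u\<in>carrier R - p. u \<odot>\<^bsub>M\<^esub> s \<in> comb M p S Q"
  shows "\<exists>f\<in>carrier R - p. \<forall>s\<in>S. f \<odot>\<^bsub>M\<^esub> s \<in> Q"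
  using S rel
proof (induction S rule: finite_induct)
  case empty
  have "\<one> \<in> carrier R - p"
    using primeideal.I_notcarr[OF p] ideal.one_imp_carrier[OF primeideal.axioms(1)[OF p]] by blast
  then show ?case by blast
next
  case (insert s S)
  interpret p: primeideal p R by fact
  have sS: "s \<in> carrier M" "S \<subseteq> carrier M" using insert.prems by auto
  note sub = comb_submodule[OF p.ideal_axioms sS(2) Q]
  obtain u c y where u: "u \<in> carrier R - p" "c \<in> p" "y \<in> comb M p S Q"
    and us: "u \<odot>\<^bsub>M\<^esub> s = c \<odot>\<^bsub>M\<^esub> s \<oplus>\<^bsub>M\<^esub> y"
    using insert.prems comb_insert[OF p.ideal_axioms insert.prems(1) Q] by (metis insertI1)
  define v where "v = u \<ominus> c"
  have cR: "c \<in> carrier R" "u \<in> carrier R" and yM: "y \<in> carrier M"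
    using u p.Icarr submodD(1)[OF sub] by auto
  have v: "v \<in> carrier R - p"
  proof -
    have "u \<in> p" if "v \<in> p"
    proof -
      have "v \<oplus> c = u" unfolding v_def using cR by (simp add: a_minus_def R.a_assoc R.l_neg)
      then show ?thesis using p.a_closed[OF that u(2)] by simp
    qed
    then show ?thesis using u cR by (auto simp: v_def)
  qed
  have vs: "v \<odot>\<^bsub>M\<^esub> s = y"
  proof -
    have "v \<odot>\<^bsub>M\<^esub> s = c \<odot>\<^bsub>M\<^esub> s \<oplus>\<^bsub>M\<^esub> y \<oplus>\<^bsub>M\<^esub> \<ominus>\<^bsub>M\<^esub> (c \<odot>\<^bsub>M\<^esub> s)"
      unfolding v_def a_minus_def using cR sS us by (simp add: smult_l_distr smult_l_minus)
    also have "\<dots> = y"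
      using cR sS yM by (simp add: M.a_comm[of "c \<odot>\<^bsub>M\<^esub> s" y] M.a_assoc M.r_neg)
    finally show ?thesis .
  qed
  have "\<exists>w\<in>carrier R - p. w \<odot>\<^bsub>M\<^esub> t \<in> comb M p S Q" if t: "t \<in> S" for t
  proof -
    obtain w d z where w: "w \<in> carrier R - p" "d \<in> p" "z \<in> comb M p S Q"
      and wt: "w \<odot>\<^bsub>M\<^esub> t = d \<odot>\<^bsub>M\<^esub> s \<oplus>\<^bsub>M\<^esub> z"
      using insert.prems comb_insert[OF p.ideal_axioms insert.prems(1) Q] t by (metis insertI2)
    have c: "w \<in> carrier R" "d \<in> carrier R" "v \<in> carrier R" "z \<in> carrier M" "t \<in> carrier M"
      using w p.Icarr v submodD(1)[OF sub] t sS by auto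
    have "(v \<otimes> w) \<odot>\<^bsub>M\<^esub> t = v \<odot>\<^bsub>M\<^esub> (d \<odot>\<^bsub>M\<^esub> s \<oplus>\<^bsub>M\<^esub> z)"
      using c by (simp add: smult_assoc1 wt)
    also have "\<dots> = d \<odot>\<^bsub>M\<^esub> (v \<odot>\<^bsub>M\<^esub> s) \<oplus>\<^bsub>M\<^esub> v \<odot>\<^bsub>M\<^esub> z"
      using c sS by (simp add: smult_r_distr smult_assoc1[symmetric] R.m_comm)
    finally have "(v \<otimes> w) \<odot>\<^bsub>M\<^esub> t \<in> comb M p S Q"
      using c u w vs by (simp add: submodD(3,4)[OF sub])
    moreover have "v \<otimes> w \<in> carrier R - p" using v w by (intro p.loc.S_mult)
    ultimately show ?thesis by blast
  qed
  then obtain f where f: "f \<in> carrier R - p" "\<forall>t\<in>S. f \<odot>\<^bsub>M\<^esub> t \<in> Q"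
    using insert.IH[OF sS(2)] by blast
  have fR: "f \<in> carrier R" "v \<in> carrier R" using f v by auto
  have "comb M p S Q \<subseteq> {x \<in> carrier M. f \<odot>\<^bsub>M\<^esub> x \<in> Q}"
  proof (rule comb_subset[OF multiples_submodule[OF Q fR(1)]])
    show "Q \<subseteq> {x \<in> carrier M. f \<odot>\<^bsub>M\<^esub> x \<in> Q}" using submodD(1,4)[OF Q] fR by auto
    fix r t assume r: "r \<in> p" "t \<in> S"
    then have "t \<in> {x \<in> carrier M. f \<odot>\<^bsub>M\<^esub> x \<in> Q}" using f sS by auto
    then show "r \<odot>\<^bsub>M\<^esub> t \<in> {x \<in> carrier M. f \<odot>\<^bsub>M\<^esub> x \<in> Q}"
      using submodD(4)[OF multiples_submodule[OF Q fR(1)] p.Icarr[OF r(1)]] by blast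
  qed
  then have fy: "f \<odot>\<^bsub>M\<^esub> y \<in> Q" using u by blast
  have "(f \<otimes> v) \<odot>\<^bsub>M\<^esub> t \<in> Q" if "t \<in> insert s S" for t
  proof (cases "t = s")
    case True
    then show ?thesis using fy fR sS by (simp add: smult_assoc1 vs)
  next
    case False
    then have "t \<in> S" "t \<in> carrier M" using that sS by auto
    then show ?thesis
      using f(2) fR by (simp add: R.m_comm[of f v] smult_assoc1 submodD(4)[OF Q])
  qed
  moreover have "f \<otimes> v \<in> carrier R - p" using f v by (intro p.loc.S_mult)
  ultimately show ?case by blast
qed

text \<open>The functional takes \<open>x\<close> to \<open>r/u\<close> where \<open>u x\<close> and \<open>r b\<close> agree modulo \<open>Q\<close>. The value does not
  depend on the choice of \<open>u\<close> and \<open>r\<close>: since \<open>Q\<close> is saturated and does not contain \<open>b\<close>, a multiple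
  \<open>r b\<close> can lie in \<open>Q\<close> only for \<open>r\<close> in \<open>p\<close>.\<close>

lemma coordinate_functional:
  fixes p
  defines "k \<equiv> residue_field R p" and "\<rho> \<equiv> residue_map R p"
  assumes p: "primeideal p R" and Q: "LinearCombinations.submodule R Q M"
    and sat: "\<And>u x. u \<in> carrier R - p \<Longrightarrow> x \<in> carrier M \<Longrightarrow> u \<odot>\<^bsub>M\<^esub> x \<in> Q \<Longrightarrow> x \<in> Q"
    and b: "b \<in> carrier M" "b \<notin> Q"
    and span: "\<And>x. x \<in> carrier M \<Longrightarrow> \<exists>u\<in>carrier R - p. \<exists>r\<in>carrier R. u \<odot>\<^bsub>M\<^esub> x \<ominus>\<^bsub>M\<^esub> r \<odot>\<^bsub>M\<^esub> b \<in> Q"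
  obtains \<phi> where "\<And>x. x \<in> carrier M \<Longrightarrow> \<phi> x \<in> carrier k"
    and "\<And>x y. x \<in> carrier M \<Longrightarrow> y \<in> carrier M \<Longrightarrow> \<phi> (x \<oplus>\<^bsub>M\<^esub> y) = \<phi> x \<oplus>\<^bsub>k\<^esub> \<phi> y"
    and "\<And>r x. r \<in> carrier R \<Longrightarrow> x \<in> carrier M \<Longrightarrow> \<phi> (r \<odot>\<^bsub>M\<^esub> x) = \<rho> r \<otimes>\<^bsub>k\<^esub> \<phi> x"
    and "\<phi> b = \<one>\<^bsub>k\<^esub>" and "\<And>x. x \<in> Q \<Longrightarrow> \<phi> x = \<zero>\<^bsub>k\<^esub>"
proof -
  interpret p: primeideal p R by fact
  interpret k: field k unfolding k_def by (rule p.residue_field_field)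
  interpret \<rho>: ring_hom_cring R k \<rho>
    using p.residue_map_hom R.is_cring k.is_cring
    unfolding k_def \<rho>_def by (intro ring_hom_cring.intro ring_hom_cring_axioms.intro)
  have \<rho>0: "\<rho> r = \<zero>\<^bsub>k\<^esub> \<longleftrightarrow> r \<in> p" if "r \<in> carrier R" for r
    using p.residue_map_eq_zero_iff[OF that] unfolding k_def \<rho>_def .
  have in_p: "r \<in> p" if "r \<in> carrier R" "r \<odot>\<^bsub>M\<^esub> b \<in> Q" for r
    using sat[of r b] b that by blast
  define P where "P x c \<longleftrightarrow> c \<in> carrier k \<and> (\<exists>u\<in>carrier R - p. \<exists>r\<in>carrier R.
    u \<odot>\<^bsub>M\<^esub> x \<ominus>\<^bsub>M\<^esub> r \<odot>\<^bsub>M\<^esub> b \<in> Q \<and> \<rho> u \<otimes>\<^bsub>k\<^esub> c = \<rho> r)" for x c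
  have P_I: "P x c" if "u \<in> carrier R - p" "r \<in> carrier R" "u \<odot>\<^bsub>M\<^esub> x \<ominus>\<^bsub>M\<^esub> r \<odot>\<^bsub>M\<^esub> b \<in> Q"
    "\<rho> u \<otimes>\<^bsub>k\<^esub> c = \<rho> r" "c \<in> carrier k" for u r x c
    using that unfolding P_def by blast
  have ex: "\<exists>c. P x c" if x: "x \<in> carrier M" for x
  proof -
    obtain u r where u: "u \<in> carrier R - p" "r \<in> carrier R" "u \<odot>\<^bsub>M\<^esub> x \<ominus>\<^bsub>M\<^esub> r \<odot>\<^bsub>M\<^esub> b \<in> Q"
      using span[OF x] by blast
    then have un: "\<rho> u \<in> Units k" using \<rho>0 k.field_Units by auto
    have "\<rho> u \<otimes>\<^bsub>k\<^esub> (inv\<^bsub>k\<^esub> \<rho> u \<otimes>\<^bsub>k\<^esub> \<rho> r) = \<rho> r"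
      using un u by (simp add: k.m_assoc[symmetric])
    then have "P x (inv\<^bsub>k\<^esub> \<rho> u \<otimes>\<^bsub>k\<^esub> \<rho> r)"
      using u un by (intro P_I[of u r]) auto
    then show ?thesis ..
  qed
  have uniq: "c = d" if x: "x \<in> carrier M" and c: "P x c" and d: "P x d" for x c d
  proof -
    obtain u r where u: "u \<in> carrier R - p" "r \<in> carrier R" "u \<odot>\<^bsub>M\<^esub> x \<ominus>\<^bsub>M\<^esub> r \<odot>\<^bsub>M\<^esub> b \<in> Q"
      "\<rho> u \<otimes>\<^bsub>k\<^esub> c = \<rho> r" and ck: "c \<in> carrier k" using c unfolding P_def by blast
    obtain v s where v: "v \<in> carrier R - p" "s \<in> carrier R" "v \<odot>\<^bsub>M\<^esub> x \<ominus>\<^bsub>M\<^esub> s \<odot>\<^bsub>M\<^esub> b \<in> Q"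
      "\<rho> v \<otimes>\<^bsub>k\<^esub> d = \<rho> s" and dk: "d \<in> carrier k" using d unfolding P_def by blast
    have R: "u \<in> carrier R" "v \<in> carrier R" using u v by auto
    \<comment> \<open>Cross-multiplying the two relations eliminates \<open>x\<close> and leaves a multiple of \<open>b\<close> in \<open>Q\<close>.\<close>
    have "u \<odot>\<^bsub>M\<^esub> (v \<odot>\<^bsub>M\<^esub> x \<ominus>\<^bsub>M\<^esub> s \<odot>\<^bsub>M\<^esub> b) \<ominus>\<^bsub>M\<^esub> v \<odot>\<^bsub>M\<^esub> (u \<odot>\<^bsub>M\<^esub> x \<ominus>\<^bsub>M\<^esub> r \<odot>\<^bsub>M\<^esub> b) \<in> Q"
      by (rule submodD(6)[OF Q submodD(4)[OF Q R(1) v(3)] submodD(4)[OF Q R(2) u(3)]])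
    also have "u \<odot>\<^bsub>M\<^esub> (v \<odot>\<^bsub>M\<^esub> x \<ominus>\<^bsub>M\<^esub> s \<odot>\<^bsub>M\<^esub> b) \<ominus>\<^bsub>M\<^esub> v \<odot>\<^bsub>M\<^esub> (u \<odot>\<^bsub>M\<^esub> x \<ominus>\<^bsub>M\<^esub> r \<odot>\<^bsub>M\<^esub> b)
        = (v \<otimes> r \<ominus> u \<otimes> s) \<odot>\<^bsub>M\<^esub> b"
    proof -
      have 1: "u \<odot>\<^bsub>M\<^esub> (v \<odot>\<^bsub>M\<^esub> x \<ominus>\<^bsub>M\<^esub> s \<odot>\<^bsub>M\<^esub> b) = (u \<otimes> v) \<odot>\<^bsub>M\<^esub> x \<ominus>\<^bsub>M\<^esub> (u \<otimes> s) \<odot>\<^bsub>M\<^esub> b"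
        using R u(2) v(2) x b by (simp add: a_minus_def smult_r_distr smult_r_minus smult_assoc1)
      have 2: "v \<odot>\<^bsub>M\<^esub> (u \<odot>\<^bsub>M\<^esub> x \<ominus>\<^bsub>M\<^esub> r \<odot>\<^bsub>M\<^esub> b) = (u \<otimes> v) \<odot>\<^bsub>M\<^esub> x \<ominus>\<^bsub>M\<^esub> (v \<otimes> r) \<odot>\<^bsub>M\<^esub> b"
        using R u(2) v(2) x b
        by (simp add: a_minus_def smult_r_distr smult_r_minus smult_assoc1[symmetric] R.m_comm)
      have g: "(a \<ominus>\<^bsub>M\<^esub> e) \<ominus>\<^bsub>M\<^esub> (a \<ominus>\<^bsub>M\<^esub> f) = f \<ominus>\<^bsub>M\<^esub> e"
        if "a \<in> carrier M" "e \<in> carrier M" "f \<in> carrier M" for a e f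
        using that by (simp add: a_minus_def M.minus_add M.a_ac M.r_neg2 M.r_neg1)
      show ?thesis
        unfolding 1 2 using R u(2) v(2) x b
        by (simp add: g) (simp add: a_minus_def smult_l_distr smult_l_minus)
    qed
    finally have "v \<otimes> r \<ominus> u \<otimes> s \<in> p" using R u v by (intro in_p) auto
    then have "\<rho> (v \<otimes> r \<ominus> u \<otimes> s) = \<zero>\<^bsub>k\<^esub>"
      using R u(2) v(2) by (subst \<rho>0) auto
    moreover have "\<rho> (v \<otimes> r \<ominus> u \<otimes> s) = \<rho> v \<otimes>\<^bsub>k\<^esub> \<rho> r \<ominus>\<^bsub>k\<^esub> \<rho> u \<otimes>\<^bsub>k\<^esub> \<rho> s"
      using R u(2) v(2) by (simp add: a_minus_def)
    ultimately have "\<rho> v \<otimes>\<^bsub>k\<^esub> \<rho> r = \<rho> u \<otimes>\<^bsub>k\<^esub> \<rho> s"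
      using R u(2) v(2) k.r_right_minus_eq by simp
    then have "(\<rho> v \<otimes>\<^bsub>k\<^esub> \<rho> u) \<otimes>\<^bsub>k\<^esub> c = (\<rho> v \<otimes>\<^bsub>k\<^esub> \<rho> u) \<otimes>\<^bsub>k\<^esub> d"
      unfolding u(4)[symmetric] v(4)[symmetric] using R ck dk by (simp add: k.m_ac)
    moreover have "\<rho> v \<otimes>\<^bsub>k\<^esub> \<rho> u \<noteq> \<zero>\<^bsub>k\<^esub>"
      using \<rho>0 R u v k.integral_iff by auto
    ultimately show ?thesis using R ck dk by (simp add: k.m_lcancel)
  qed
  define \<phi> where "\<phi> x = (THE c. P x c)" for x
  have \<phi>: "P x (\<phi> x)" if "x \<in> carrier M" for x
    unfolding \<phi>_def using ex[OF that] uniq[OF that] by (metis theI')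
  have \<phi>_eq: "\<phi> x = c" if "x \<in> carrier M" "P x c" for x c
    using \<phi> uniq that by blast
  show thesis
  proof (rule that[of \<phi>])
    show "\<phi> x \<in> carrier k" if "x \<in> carrier M" for x using \<phi>[OF that] by (simp add: P_def)
  next
    fix x y assume x: "x \<in> carrier M" and y: "y \<in> carrier M"
    obtain u r where u: "u \<in> carrier R - p" "r \<in> carrier R" "u \<odot>\<^bsub>M\<^esub> x \<ominus>\<^bsub>M\<^esub> r \<odot>\<^bsub>M\<^esub> b \<in> Q"
      "\<rho> u \<otimes>\<^bsub>k\<^esub> \<phi> x = \<rho> r" and ck: "\<phi> x \<in> carrier k" using \<phi>[OF x] unfolding P_def by blast
    obtain v s where v: "v \<in> carrier R - p" "s \<in> carrier R" "v \<odot>\<^bsub>M\<^esub> y \<ominus>\<^bsub>M\<^esub> s \<odot>\<^bsub>M\<^esub> b \<in> Q"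
      "\<rho> v \<otimes>\<^bsub>k\<^esub> \<phi> y = \<rho> s" and dk: "\<phi> y \<in> carrier k" using \<phi>[OF y] unfolding P_def by blast
    have R: "u \<in> carrier R" "v \<in> carrier R" using u v by auto
    have "v \<odot>\<^bsub>M\<^esub> (u \<odot>\<^bsub>M\<^esub> x \<ominus>\<^bsub>M\<^esub> r \<odot>\<^bsub>M\<^esub> b) \<oplus>\<^bsub>M\<^esub> u \<odot>\<^bsub>M\<^esub> (v \<odot>\<^bsub>M\<^esub> y \<ominus>\<^bsub>M\<^esub> s \<odot>\<^bsub>M\<^esub> b) \<in> Q"
      by (rule submodD(3)[OF Q submodD(4)[OF Q R(2) u(3)] submodD(4)[OF Q R(1) v(3)]])
    also have "v \<odot>\<^bsub>M\<^esub> (u \<odot>\<^bsub>M\<^esub> x \<ominus>\<^bsub>M\<^esub> r \<odot>\<^bsub>M\<^esub> b) \<oplus>\<^bsub>M\<^esub> u \<odot>\<^bsub>M\<^esub> (v \<odot>\<^bsub>M\<^esub> y \<ominus>\<^bsub>M\<^esub> s \<odot>\<^bsub>M\<^esub> b) =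
        (u \<otimes> v) \<odot>\<^bsub>M\<^esub> (x \<oplus>\<^bsub>M\<^esub> y) \<ominus>\<^bsub>M\<^esub> (v \<otimes> r \<oplus> u \<otimes> s) \<odot>\<^bsub>M\<^esub> b"
    proof -
      have 1: "v \<odot>\<^bsub>M\<^esub> (u \<odot>\<^bsub>M\<^esub> x \<ominus>\<^bsub>M\<^esub> r \<odot>\<^bsub>M\<^esub> b) = (u \<otimes> v) \<odot>\<^bsub>M\<^esub> x \<oplus>\<^bsub>M\<^esub> \<ominus>\<^bsub>M\<^esub> ((v \<otimes> r) \<odot>\<^bsub>M\<^esub> b)"
        using R u(2) x b
        by (simp add: a_minus_def smult_r_distr smult_r_minus smult_assoc1[symmetric] R.m_comm)
      have 2: "u \<odot>\<^bsub>M\<^esub> (v \<odot>\<^bsub>M\<^esub> y \<ominus>\<^bsub>M\<^esub> s \<odot>\<^bsub>M\<^esub> b) = (u \<otimes> v) \<odot>\<^bsub>M\<^esub> y \<oplus>\<^bsub>M\<^esub> \<ominus>\<^bsub>M\<^esub> ((u \<otimes> s) \<odot>\<^bsub>M\<^esub> b)"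
        using R v(2) y b by (simp add: a_minus_def smult_r_distr smult_r_minus smult_assoc1)
      show ?thesis
        unfolding 1 2 using R u(2) v(2) x y b
        by (simp add: a_minus_def smult_r_distr smult_l_distr M.minus_add M.a_ac)
    qed
    finally have "(u \<otimes> v) \<odot>\<^bsub>M\<^esub> (x \<oplus>\<^bsub>M\<^esub> y) \<ominus>\<^bsub>M\<^esub> (v \<otimes> r \<oplus> u \<otimes> s) \<odot>\<^bsub>M\<^esub> b \<in> Q" .
    moreover have "\<rho> (u \<otimes> v) \<otimes>\<^bsub>k\<^esub> (\<phi> x \<oplus>\<^bsub>k\<^esub> \<phi> y) = \<rho> (v \<otimes> r \<oplus> u \<otimes> s)"
    proof -
      have "\<rho> (u \<otimes> v) \<otimes>\<^bsub>k\<^esub> (\<phi> x \<oplus>\<^bsub>k\<^esub> \<phi> y) =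
          \<rho> v \<otimes>\<^bsub>k\<^esub> (\<rho> u \<otimes>\<^bsub>k\<^esub> \<phi> x) \<oplus>\<^bsub>k\<^esub> \<rho> u \<otimes>\<^bsub>k\<^esub> (\<rho> v \<otimes>\<^bsub>k\<^esub> \<phi> y)"
        using R ck dk by (simp add: k.r_distr k.m_ac)
      then show ?thesis unfolding u(4) v(4) using R u(2) v(2) by simp
    qed
    moreover have "u \<otimes> v \<in> carrier R - p" using u v by (intro p.loc.S_mult)
    ultimately have "P (x \<oplus>\<^bsub>M\<^esub> y) (\<phi> x \<oplus>\<^bsub>k\<^esub> \<phi> y)"
      using R u(2) v(2) ck dk by (intro P_I[of "u \<otimes> v" "v \<otimes> r \<oplus> u \<otimes> s"]) simp_all
    then show "\<phi> (x \<oplus>\<^bsub>M\<^esub> y) = \<phi> x \<oplus>\<^bsub>k\<^esub> \<phi> y" using x y by (intro \<phi>_eq) auto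
  next
    fix t x assume t: "t \<in> carrier R" and x: "x \<in> carrier M"
    obtain u r where u: "u \<in> carrier R - p" "r \<in> carrier R" "u \<odot>\<^bsub>M\<^esub> x \<ominus>\<^bsub>M\<^esub> r \<odot>\<^bsub>M\<^esub> b \<in> Q"
      "\<rho> u \<otimes>\<^bsub>k\<^esub> \<phi> x = \<rho> r" and ck: "\<phi> x \<in> carrier k" using \<phi>[OF x] unfolding P_def by blast
    have R: "u \<in> carrier R" using u by auto
    have "t \<odot>\<^bsub>M\<^esub> (u \<odot>\<^bsub>M\<^esub> x \<ominus>\<^bsub>M\<^esub> r \<odot>\<^bsub>M\<^esub> b) \<in> Q" using t u by (intro submodD(4)[OF Q])
    also have "t \<odot>\<^bsub>M\<^esub> (u \<odot>\<^bsub>M\<^esub> x \<ominus>\<^bsub>M\<^esub> r \<odot>\<^bsub>M\<^esub> b) = u \<odot>\<^bsub>M\<^esub> (t \<odot>\<^bsub>M\<^esub> x) \<ominus>\<^bsub>M\<^esub> (t \<otimes> r) \<odot>\<^bsub>M\<^esub> b"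
      using t x b R u(2)
      by (simp add: a_minus_def smult_r_distr smult_r_minus smult_assoc1[symmetric] R.m_comm)
    finally have "u \<odot>\<^bsub>M\<^esub> (t \<odot>\<^bsub>M\<^esub> x) \<ominus>\<^bsub>M\<^esub> (t \<otimes> r) \<odot>\<^bsub>M\<^esub> b \<in> Q" .
    moreover have "\<rho> u \<otimes>\<^bsub>k\<^esub> (\<rho> t \<otimes>\<^bsub>k\<^esub> \<phi> x) = \<rho> (t \<otimes> r)"
    proof -
      have "\<rho> u \<otimes>\<^bsub>k\<^esub> (\<rho> t \<otimes>\<^bsub>k\<^esub> \<phi> x) = \<rho> t \<otimes>\<^bsub>k\<^esub> (\<rho> u \<otimes>\<^bsub>k\<^esub> \<phi> x)"
        using R ck t by (simp add: k.m_ac)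
      then show ?thesis unfolding u(4) using t u(2) by simp
    qed
    ultimately have "P (t \<odot>\<^bsub>M\<^esub> x) (\<rho> t \<otimes>\<^bsub>k\<^esub> \<phi> x)"
      using u(1,2) t ck by (intro P_I[of u "t \<otimes> r"]) simp_all
    then show "\<phi> (t \<odot>\<^bsub>M\<^esub> x) = \<rho> t \<otimes>\<^bsub>k\<^esub> \<phi> x" using t x by (intro \<phi>_eq) auto
  next
    have "P b \<one>\<^bsub>k\<^esub>"
      using b p.loc.S_one submodD(2)[OF Q]
      by (intro P_I[of \<one> \<one>]) (simp_all add: a_minus_def M.r_neg)
    then show "\<phi> b = \<one>\<^bsub>k\<^esub>" using b by (intro \<phi>_eq)
  next
    fix x assume x: "x \<in> Q"
    have "P x \<zero>\<^bsub>k\<^esub>"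
      using x b p.loc.S_one submodD(1)[OF Q]
      by (intro P_I[of \<one> \<zero>]) (simp_all add: submodD(2,6)[OF Q])
    then show "\<phi> x = \<zero>\<^bsub>k\<^esub>" using x submodD(1)[OF Q] by (intro \<phi>_eq)
  qed
qed

end

context module
begin

text \<open>A set \<open>B\<close> of least size that generates \<open>M\<close> up to denominators outside \<open>p\<close>, modulo \<open>pM + L\<close>,
  is a basis of the fibre of \<open>M/L\<close> at \<open>p\<close> in disguise. Nakayama's lemma removes \<open>pM\<close> and leaves a single
  denominator \<open>f\<close>, so \<open>B\<close> generates at all primes not containing \<open>f\<close>. Minimality provides
  coordinate functionals: for \<open>b\<close> in \<open>B\<close> the saturation of what \<open>B - {b}\<close> generates cannot contain
  \<open>b\<close>.\<close>

lemma local_basis: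
  fixes p
  defines "k \<equiv> residue_field R p" and "\<rho> \<equiv> residue_map R p"
  assumes p: "primeideal p R" and L: "LinearCombinations.submodule R L M"
    and S: "finite S" "S \<subseteq> carrier M" "\<And>x. x \<in> carrier M \<Longrightarrow> x \<in> comb M (carrier R) S L"
  obtains B f \<phi> where "finite B" "B \<subseteq> carrier M" "f \<in> carrier R - p"
    and "\<And>x. x \<in> carrier M \<Longrightarrow> f \<odot>\<^bsub>M\<^esub> x \<in> comb M (carrier R) B L"
    and "\<And>b x. b \<in> B \<Longrightarrow> x \<in> carrier M \<Longrightarrow> \<phi> b x \<in> carrier k"
    and "\<And>b x y. b \<in> B \<Longrightarrow> x \<in> carrier M \<Longrightarrow> y \<in> carrier M \<Longrightarrow>
      \<phi> b (x \<oplus>\<^bsub>M\<^esub> y) = \<phi> b x \<oplus>\<^bsub>k\<^esub> \<phi> b y"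
    and "\<And>b r x. b \<in> B \<Longrightarrow> r \<in> carrier R \<Longrightarrow> x \<in> carrier M \<Longrightarrow>
      \<phi> b (r \<odot>\<^bsub>M\<^esub> x) = \<rho> r \<otimes>\<^bsub>k\<^esub> \<phi> b x"
    and "\<And>b. b \<in> B \<Longrightarrow> \<phi> b b = \<one>\<^bsub>k\<^esub>"
    and "\<And>b c. b \<in> B \<Longrightarrow> c \<in> B \<Longrightarrow> c \<noteq> b \<Longrightarrow> \<phi> b c = \<zero>\<^bsub>k\<^esub>"
    and "\<And>b x. b \<in> B \<Longrightarrow> x \<in> L \<Longrightarrow> \<phi> b x = \<zero>\<^bsub>k\<^esub>"
proof -
  interpret p: primeideal p R by fact
  define D where "D B = comb M (carrier R) B L" for B
  define E where "E B = comb M p (carrier M) (D B)" for B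
  have D: "LinearCombinations.submodule R (D B) M" if "B \<subseteq> carrier M" for B
    unfolding D_def by (rule comb_submodule[OF R.oneideal that L])
  have E: "LinearCombinations.submodule R (E B) M" if "B \<subseteq> carrier M" for B
    unfolding E_def by (rule comb_submodule[OF p.ideal_axioms subset_refl D[OF that]])
  have DE: "D B \<subseteq> E B" for B
    unfolding E_def by (auto intro: comb.base)
  have LD: "L \<subseteq> D B" for B
    unfolding D_def by (auto intro: comb.base)
  have pE: "r \<odot>\<^bsub>M\<^esub> x \<in> E B" if "B \<subseteq> carrier M" "r \<in> p" "x \<in> carrier M" for B r x
    unfolding E_def using that p.Icarr by (intro comb_gen[OF D]) auto
  have BD: "r \<odot>\<^bsub>M\<^esub> b \<in> D B" if "B \<subseteq> carrier M" "b \<in> B" "r \<in> carrier R" for B b r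
    unfolding D_def using that by (intro comb_gen[OF L]) auto
  have one_p: "\<one> \<in> carrier R - p" by (rule p.loc.S_one)
  define gens where "gens B \<longleftrightarrow> finite B \<and> B \<subseteq> carrier M \<and>
    (\<forall>x\<in>carrier M. \<exists>u\<in>carrier R - p. u \<odot>\<^bsub>M\<^esub> x \<in> E B)" for B
  have "gens S"
    unfolding gens_def
  proof (intro conjI S ballI bexI[OF _ one_p])
    fix x assume x: "x \<in> carrier M"
    have "x \<in> E S" using DE[of S] S(3)[OF x] unfolding D_def by blast
    then show "\<one> \<odot>\<^bsub>M\<^esub> x \<in> E S" using x by simp
  qed
  then obtain B where B: "gens B" and least: "\<And>B'. gens B' \<Longrightarrow> card B \<le> card B'"
    using ex_has_least_nat[of gens S card] by blast
  have Bfin: "finite B" and BM: "B \<subseteq> carrier M"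
    and Bgen: "\<And>x. x \<in> carrier M \<Longrightarrow> \<exists>u\<in>carrier R - p. u \<odot>\<^bsub>M\<^esub> x \<in> E B"
    using B unfolding gens_def by blast+
  have "\<exists>f\<in>carrier R - p. \<forall>s\<in>S. f \<odot>\<^bsub>M\<^esub> s \<in> D B"
  proof (rule nakayama_elimination[OF p D[OF BM] S(1,2)], rule ballI)
    fix s assume s: "s \<in> S"
    have sub: "LinearCombinations.submodule R (comb M p S (D B)) M"
      by (rule comb_submodule[OF p.ideal_axioms S(2) D[OF BM]])
    have "E B \<subseteq> comb M p S (D B)"
      unfolding E_def
    proof (rule comb_subset[OF sub])
      show "D B \<subseteq> comb M p S (D B)" by (auto intro: comb.base)
      fix r x assume r: "r \<in> p" and x: "x \<in> carrier M"
      have rR: "r \<in> carrier R" using r p.Icarr by blast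
      have "comb M (carrier R) S L \<subseteq> {x \<in> carrier M. r \<odot>\<^bsub>M\<^esub> x \<in> comb M p S (D B)}"
      proof (rule comb_subset[OF multiples_submodule[OF sub rR]])
        show "L \<subseteq> {x \<in> carrier M. r \<odot>\<^bsub>M\<^esub> x \<in> comb M p S (D B)}"
        proof
          fix x assume x: "x \<in> L"
          have "r \<odot>\<^bsub>M\<^esub> x \<in> comb M p S (D B)"
            by (rule comb.base[OF subsetD[OF LD submodD(4)[OF L rR x]]])
          then show "x \<in> {x \<in> carrier M. r \<odot>\<^bsub>M\<^esub> x \<in> comb M p S (D B)}"
            using submodD(1)[OF L x] by simp
        qed
      next
        fix c t assume c: "c \<in> carrier R" and t: "t \<in> S"
        have tM: "t \<in> carrier M" using t S by blast
        have "(r \<otimes> c) \<odot>\<^bsub>M\<^esub> t \<in> comb M p S (D B)"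
          using r c t tM rR by (intro comb_gen[OF D[OF BM]] p.I_r_closed) auto
        then show "c \<odot>\<^bsub>M\<^esub> t \<in> {x \<in> carrier M. r \<odot>\<^bsub>M\<^esub> x \<in> comb M p S (D B)}"
          using c tM rR by (simp add: smult_assoc1)
      qed
      then show "r \<odot>\<^bsub>M\<^esub> x \<in> comb M p S (D B)" using S(3)[OF x] by blast
    qed
    then show "\<exists>u\<in>carrier R - p. u \<odot>\<^bsub>M\<^esub> s \<in> comb M p S (D B)"
      using Bgen[of s] s S by blast
  qed
  then obtain f where f: "f \<in> carrier R - p" "\<forall>s\<in>S. f \<odot>\<^bsub>M\<^esub> s \<in> D B" by blast
  have fR: "f \<in> carrier R" using f by blast
  have fx: "f \<odot>\<^bsub>M\<^esub> x \<in> D B" if x: "x \<in> carrier M" for x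
  proof -
    have "comb M (carrier R) S L \<subseteq> {x \<in> carrier M. f \<odot>\<^bsub>M\<^esub> x \<in> D B}"
    proof (rule comb_subset[OF multiples_submodule[OF D[OF BM] fR]])
      show "L \<subseteq> {x \<in> carrier M. f \<odot>\<^bsub>M\<^esub> x \<in> D B}"
        using LD[of B] submodD(1,4)[OF L] fR by auto
      fix c t assume c: "c \<in> carrier R" and t: "t \<in> S"
      then have "t \<in> {x \<in> carrier M. f \<odot>\<^bsub>M\<^esub> x \<in> D B}" using f S by blast
      then show "c \<odot>\<^bsub>M\<^esub> t \<in> {x \<in> carrier M. f \<odot>\<^bsub>M\<^esub> x \<in> D B}"
        by (rule submodD(4)[OF multiples_submodule[OF D[OF BM] fR] c])
    qed
    then show ?thesis using S(3)[OF x] by blast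
  qed
  define dual where "dual b \<phi> \<longleftrightarrow> (\<forall>x\<in>carrier M. \<phi> x \<in> carrier k) \<and>
      (\<forall>x\<in>carrier M. \<forall>y\<in>carrier M. \<phi> (x \<oplus>\<^bsub>M\<^esub> y) = \<phi> x \<oplus>\<^bsub>k\<^esub> \<phi> y) \<and>
      (\<forall>r\<in>carrier R. \<forall>x\<in>carrier M. \<phi> (r \<odot>\<^bsub>M\<^esub> x) = \<rho> r \<otimes>\<^bsub>k\<^esub> \<phi> x) \<and>
      \<phi> b = \<one>\<^bsub>k\<^esub> \<and> (\<forall>c\<in>B. c \<noteq> b \<longrightarrow> \<phi> c = \<zero>\<^bsub>k\<^esub>) \<and> (\<forall>x\<in>L. \<phi> x = \<zero>\<^bsub>k\<^esub>)" for b \<phi>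
  have "\<exists>\<phi>. dual b \<phi>" if b: "b \<in> B" for b
  proof -
    let ?B = "B - {b}"
    have bM: "b \<in> carrier M" and BbM: "?B \<subseteq> carrier M" using b BM by auto
    note Eb = E[OF BbM]
    \<comment> \<open>The saturation of what the other elements generate; the functional of \<open>b\<close> has to kill it.\<close>
    define Q where "Q = {x \<in> carrier M. \<exists>u\<in>carrier R - p. u \<odot>\<^bsub>M\<^esub> x \<in> E ?B}"
    have Q: "LinearCombinations.submodule R Q M"
    proof (rule submodI)
      show "Q \<subseteq> carrier M" by (auto simp: Q_def)
      show "\<zero>\<^bsub>M\<^esub> \<in> Q" unfolding Q_def using submodD(2)[OF Eb] one_p by auto
    next
      fix x y assume "x \<in> Q" "y \<in> Q"
      then obtain u v where u: "u \<in> carrier R - p" "u \<odot>\<^bsub>M\<^esub> x \<in> E ?B" and v: "v \<in> carrier R - p" "v \<odot>\<^bsub>M\<^esub> y \<in> E ?B"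
        and xy: "x \<in> carrier M" "y \<in> carrier M" unfolding Q_def by blast
      have uv: "u \<in> carrier R" "v \<in> carrier R" using u v by auto
      have "(u \<otimes> v) \<odot>\<^bsub>M\<^esub> (x \<oplus>\<^bsub>M\<^esub> y) = v \<odot>\<^bsub>M\<^esub> (u \<odot>\<^bsub>M\<^esub> x) \<oplus>\<^bsub>M\<^esub> u \<odot>\<^bsub>M\<^esub> (v \<odot>\<^bsub>M\<^esub> y)"
        using uv xy by (simp add: smult_r_distr smult_assoc1[symmetric] R.m_comm)
      then have "(u \<otimes> v) \<odot>\<^bsub>M\<^esub> (x \<oplus>\<^bsub>M\<^esub> y) \<in> E ?B"
        using uv u v by (simp add: submodD(3,4)[OF Eb])
      moreover have "u \<otimes> v \<in> carrier R - p" using u v by (intro p.loc.S_mult)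
      ultimately show "x \<oplus>\<^bsub>M\<^esub> y \<in> Q" unfolding Q_def using xy by blast
    next
      fix r x assume r: "r \<in> carrier R" and "x \<in> Q"
      then obtain u where u: "u \<in> carrier R - p" "u \<odot>\<^bsub>M\<^esub> x \<in> E ?B" and x: "x \<in> carrier M"
        unfolding Q_def by blast
      have "u \<odot>\<^bsub>M\<^esub> (r \<odot>\<^bsub>M\<^esub> x) = r \<odot>\<^bsub>M\<^esub> (u \<odot>\<^bsub>M\<^esub> x)"
        using r u x by (simp add: smult_assoc1[symmetric] R.m_comm)
      then have "u \<odot>\<^bsub>M\<^esub> (r \<odot>\<^bsub>M\<^esub> x) \<in> E ?B" using submodD(4)[OF Eb r u(2)] by simp
      then show "r \<odot>\<^bsub>M\<^esub> x \<in> Q" unfolding Q_def using u(1) r x by blast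
    qed
    have EQ: "E ?B \<subseteq> Q"
    proof
      fix x assume x: "x \<in> E ?B"
      then have "\<one> \<odot>\<^bsub>M\<^esub> x \<in> E ?B" using submodD(1)[OF Eb] by simp
      then show "x \<in> Q" unfolding Q_def using one_p submodD(1)[OF Eb x] by blast
    qed
    have sat: "x \<in> Q" if u: "u \<in> carrier R - p" and x: "x \<in> carrier M" and ux: "u \<odot>\<^bsub>M\<^esub> x \<in> Q" for u x
    proof -
      obtain v where v: "v \<in> carrier R - p" "v \<odot>\<^bsub>M\<^esub> (u \<odot>\<^bsub>M\<^esub> x) \<in> E ?B"
        using ux unfolding Q_def by blast
      then have "(v \<otimes> u) \<odot>\<^bsub>M\<^esub> x \<in> E ?B" using u x by (simp add: smult_assoc1)
      moreover have "v \<otimes> u \<in> carrier R - p" using u v by (intro p.loc.S_mult)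
      ultimately show ?thesis unfolding Q_def using x by blast
    qed
    have LQ: "L \<subseteq> Q" using LD DE EQ by blast
    have BQ: "r \<odot>\<^bsub>M\<^esub> c \<in> Q" if "c \<in> B" "c \<noteq> b" "r \<in> carrier R" for c r
      using BD[OF BbM, of c r] that DE EQ by blast
    have pQ: "r \<odot>\<^bsub>M\<^esub> x \<in> Q" if "r \<in> p" "x \<in> carrier M" for r x
      using pE[OF BbM that] EQ by blast
    have "b \<notin> Q"
    proof
      assume bQ: "b \<in> Q"
      have "D B \<subseteq> Q"
        unfolding D_def
      proof (rule comb_subset[OF Q LQ])
        fix r c assume "r \<in> carrier R" "c \<in> B"
        then show "r \<odot>\<^bsub>M\<^esub> c \<in> Q" using BQ submodD(4)[OF Q _ bQ] by (cases "c = b") auto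
      qed
      then have "E B \<subseteq> Q" unfolding E_def by (rule comb_subset[OF Q _ pQ])
      then have "x \<in> Q" if "x \<in> carrier M" for x using Bgen[OF that] sat that by blast
      then have "gens ?B" unfolding gens_def using Bfin BbM by (auto simp: Q_def)
      then have "card B \<le> card ?B" by (rule least)
      then show False using Bfin b by (metis card_Diff1_less leD)
    qed
    \<comment> \<open>The submodule \<open>Q + Rb\<close>, which contains everything that \<open>B\<close> generates.\<close>
    define Z where "Z = {x \<in> carrier M. \<exists>r\<in>carrier R. x \<ominus>\<^bsub>M\<^esub> r \<odot>\<^bsub>M\<^esub> b \<in> Q}"
    have QZ: "Q \<subseteq> Z"
    proof
      fix x assume x: "x \<in> Q"
      then have "x \<ominus>\<^bsub>M\<^esub> \<zero> \<odot>\<^bsub>M\<^esub> b \<in> Q" using bM submodD(2,6)[OF Q] by simp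
      then show "x \<in> Z" unfolding Z_def using submodD(1)[OF Q x] by blast
    qed
    have Z: "LinearCombinations.submodule R Z M"
    proof (rule submodI)
      show "Z \<subseteq> carrier M" by (auto simp: Z_def)
      show "\<zero>\<^bsub>M\<^esub> \<in> Z" using QZ submodD(2)[OF Q] by blast
    next
      fix x y assume "x \<in> Z" "y \<in> Z"
      then obtain r s where r: "r \<in> carrier R" "x \<ominus>\<^bsub>M\<^esub> r \<odot>\<^bsub>M\<^esub> b \<in> Q" and s: "s \<in> carrier R" "y \<ominus>\<^bsub>M\<^esub> s \<odot>\<^bsub>M\<^esub> b \<in> Q"
        and xy: "x \<in> carrier M" "y \<in> carrier M" unfolding Z_def by blast
      have "x \<oplus>\<^bsub>M\<^esub> y \<ominus>\<^bsub>M\<^esub> (r \<oplus> s) \<odot>\<^bsub>M\<^esub> b = (x \<ominus>\<^bsub>M\<^esub> r \<odot>\<^bsub>M\<^esub> b) \<oplus>\<^bsub>M\<^esub> (y \<ominus>\<^bsub>M\<^esub> s \<odot>\<^bsub>M\<^esub> b)"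
        using xy r(1) s(1) bM by (simp add: a_minus_def smult_l_distr M.minus_add M.a_ac)
      also have "\<dots> \<in> Q" by (rule submodD(3)[OF Q r(2) s(2)])
      finally show "x \<oplus>\<^bsub>M\<^esub> y \<in> Z" unfolding Z_def using xy r(1) s(1) by blast
    next
      fix t x assume t: "t \<in> carrier R" and "x \<in> Z"
      then obtain r where r: "r \<in> carrier R" "x \<ominus>\<^bsub>M\<^esub> r \<odot>\<^bsub>M\<^esub> b \<in> Q" and x: "x \<in> carrier M"
        unfolding Z_def by blast
      have "t \<odot>\<^bsub>M\<^esub> x \<ominus>\<^bsub>M\<^esub> (t \<otimes> r) \<odot>\<^bsub>M\<^esub> b = t \<odot>\<^bsub>M\<^esub> (x \<ominus>\<^bsub>M\<^esub> r \<odot>\<^bsub>M\<^esub> b)"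
        using t x r(1) bM by (simp add: a_minus_def smult_r_distr smult_r_minus smult_assoc1)
      also have "\<dots> \<in> Q" by (rule submodD(4)[OF Q t r(2)])
      finally show "t \<odot>\<^bsub>M\<^esub> x \<in> Z" unfolding Z_def using x t r(1) by blast
    qed
    have "D B \<subseteq> Z"
      unfolding D_def
    proof (rule comb_subset[OF Z subset_trans[OF LQ QZ]])
      fix r c assume r: "r \<in> carrier R" and c: "c \<in> B"
      show "r \<odot>\<^bsub>M\<^esub> c \<in> Z"
      proof (cases "c = b")
        case True
        have "r \<odot>\<^bsub>M\<^esub> b \<ominus>\<^bsub>M\<^esub> r \<odot>\<^bsub>M\<^esub> b \<in> Q"
          using r bM submodD(2)[OF Q] by (simp add: a_minus_def M.r_neg)
        then show ?thesis unfolding Z_def True using r bM by blast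
      next
        case False
        then show ?thesis using BQ[OF c False r] QZ by blast
      qed
    qed
    then have EZ: "E B \<subseteq> Z" unfolding E_def using pQ QZ by (intro comb_subset[OF Z]) auto
    have span: "\<exists>u\<in>carrier R - p. \<exists>r\<in>carrier R. u \<odot>\<^bsub>M\<^esub> x \<ominus>\<^bsub>M\<^esub> r \<odot>\<^bsub>M\<^esub> b \<in> Q" if "x \<in> carrier M" for x
      using Bgen[OF that] EZ unfolding Z_def by blast
    obtain \<phi> where \<phi>: "\<And>x. x \<in> carrier M \<Longrightarrow> \<phi> x \<in> carrier k"
      "\<And>x y. x \<in> carrier M \<Longrightarrow> y \<in> carrier M \<Longrightarrow> \<phi> (x \<oplus>\<^bsub>M\<^esub> y) = \<phi> x \<oplus>\<^bsub>k\<^esub> \<phi> y"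
      "\<And>r x. r \<in> carrier R \<Longrightarrow> x \<in> carrier M \<Longrightarrow> \<phi> (r \<odot>\<^bsub>M\<^esub> x) = \<rho> r \<otimes>\<^bsub>k\<^esub> \<phi> x"
      "\<phi> b = \<one>\<^bsub>k\<^esub>" and \<phi>Q: "\<And>x. x \<in> Q \<Longrightarrow> \<phi> x = \<zero>\<^bsub>k\<^esub>"
    proof (rule coordinate_functional[where b = b, OF p Q, folded k_def \<rho>_def], goal_cases)
      case (1 u x)
      show ?case by (rule sat[OF 1(2-4)])
    next
      case 2
      show ?case by (rule bM)
    next
      case 3
      show ?case by fact
    next
      case (4 x)
      show ?case by (rule span[OF 4(2)])
    next
      case (5 \<phi>)
      show ?case by (rule 5(1)) (fact 5(2-))+
    qed
    have off: "\<phi> c = \<zero>\<^bsub>k\<^esub>" if "c \<in> B" "c \<noteq> b" for c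
      using BQ[OF that R.one_closed] that BM \<phi>Q by auto
    show ?thesis
      unfolding dual_def by (intro exI[of _ \<phi>] conjI ballI impI) (simp_all add: \<phi> \<phi>Q off subsetD[OF LQ])
  qed
  then have "\<forall>b\<in>B. \<exists>\<phi>. dual b \<phi>" by (intro ballI)
  from bchoice[OF this] obtain \<phi> where \<phi>: "\<forall>b\<in>B. dual b (\<phi> b)" by (elim exE)
  show thesis
    by (rule that[OF Bfin BM f(1), of \<phi>]) (use fx \<phi> in \<open>auto simp: dual_def D_def\<close>)
qed

end

section \<open>Quotient modules\<close>

locale module_quotient = module R M for R (structure) and M (structure) +
  fixes N
  assumes N: "LinearCombinations.submodule R N M"
begin

lemma N_additive: "additive_subgroup N M"
proof (rule additive_subgroupI, rule M.add.subgroupI)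
  show "N \<subseteq> carrier M" using submodD(1)[OF N] by blast
  show "N \<noteq> {}" using submodD(2)[OF N] by blast
qed (use submodD(3,5)[OF N] in auto)

sublocale N: abelian_subgroup N M
  by (rule abelian_subgroupI3[OF N_additive M.abelian_group_axioms])

lemma coset_eq_iff:
  assumes "x \<in> carrier M" "y \<in> carrier M"
  shows "N +>\<^bsub>M\<^esub> x = N +>\<^bsub>M\<^esub> y \<longleftrightarrow> x \<ominus>\<^bsub>M\<^esub> y \<in> N"
proof
  assume "N +>\<^bsub>M\<^esub> x = N +>\<^bsub>M\<^esub> y"
  then have "x \<in> N +>\<^bsub>M\<^esub> y" using N.a_rcos_self[OF assms(1)] by simp
  then obtain n where n: "n \<in> N" "x = n \<oplus>\<^bsub>M\<^esub> y" unfolding a_r_coset_def' by blast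
  then have "x \<ominus>\<^bsub>M\<^esub> y = n"
    using assms submodD(1)[OF N n(1)] by (simp add: a_minus_def M.a_assoc M.r_neg)
  then show "x \<ominus>\<^bsub>M\<^esub> y \<in> N" using n by simp
next
  assume xy: "x \<ominus>\<^bsub>M\<^esub> y \<in> N"
  have "x = (x \<ominus>\<^bsub>M\<^esub> y) \<oplus>\<^bsub>M\<^esub> y" using assms by (simp add: a_minus_def M.a_assoc M.l_neg)
  then have "x \<in> N +>\<^bsub>M\<^esub> y" using xy unfolding a_r_coset_def' by blast
  then show "N +>\<^bsub>M\<^esub> x = N +>\<^bsub>M\<^esub> y" using M.a_repr_independence[OF _ assms(2) N.a_subgroup] by metis
qed

lemma carrier_quotient: "carrier (quotient_module M N) = {N +>\<^bsub>M\<^esub> x | x. x \<in> carrier M}"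
  by (auto simp: quotient_module_def A_RCOSETS_def')

lemma coset_closed [simp]: "x \<in> carrier M \<Longrightarrow> N +>\<^bsub>M\<^esub> x \<in> carrier (quotient_module M N)"
  by (auto simp: carrier_quotient)

lemma coset_add:
  assumes "x \<in> carrier M" "y \<in> carrier M"
  shows "(N +>\<^bsub>M\<^esub> x) \<oplus>\<^bsub>quotient_module M N\<^esub> (N +>\<^bsub>M\<^esub> y) = N +>\<^bsub>M\<^esub> (x \<oplus>\<^bsub>M\<^esub> y)"
  using N.a_rcos_sum[OF assms] by (simp add: quotient_module_def)

lemma coset_zero: "\<zero>\<^bsub>quotient_module M N\<^esub> = N +>\<^bsub>M\<^esub> \<zero>\<^bsub>M\<^esub>"
  using N.a_rcos_const[OF submodD(2)[OF N]] by (simp add: quotient_module_def)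

lemma coset_smult:
  assumes r: "r \<in> carrier R" and x: "x \<in> carrier M"
  shows "r \<odot>\<^bsub>quotient_module M N\<^esub> (N +>\<^bsub>M\<^esub> x) = N +>\<^bsub>M\<^esub> (r \<odot>\<^bsub>M\<^esub> x)"
proof -
  have "N +>\<^bsub>M\<^esub> (r \<odot>\<^bsub>M\<^esub> y) = N +>\<^bsub>M\<^esub> (r \<odot>\<^bsub>M\<^esub> x)" if "y \<in> N +>\<^bsub>M\<^esub> x" for y
  proof -
    obtain n where n: "n \<in> N" "y = n \<oplus>\<^bsub>M\<^esub> x" using \<open>y \<in> N +>\<^bsub>M\<^esub> x\<close> unfolding a_r_coset_def' by blast
    have nM: "n \<in> carrier M" using n submodD(1)[OF N] by blast
    have "r \<odot>\<^bsub>M\<^esub> y \<ominus>\<^bsub>M\<^esub> r \<odot>\<^bsub>M\<^esub> x = r \<odot>\<^bsub>M\<^esub> n"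
      using r x nM by (simp add: n(2) smult_r_distr a_minus_def M.a_assoc M.r_neg)
    also have "\<dots> \<in> N" by (rule submodD(4)[OF N r n(1)])
    finally show ?thesis using r x nM by (subst coset_eq_iff) (simp_all add: n(2))
  qed
  moreover have "x \<in> N +>\<^bsub>M\<^esub> x" by (rule N.a_rcos_self[OF x])
  ultimately have "(\<Union>y\<in>N +>\<^bsub>M\<^esub> x. N +>\<^bsub>M\<^esub> (r \<odot>\<^bsub>M\<^esub> y)) = N +>\<^bsub>M\<^esub> (r \<odot>\<^bsub>M\<^esub> x)"
    by (intro SUP_eq_const) blast+
  then show ?thesis by (simp add: quotient_module_def)
qed

lemma module_quotient_module: "module R (quotient_module M N)" (is "module R ?Q")
proof (rule moduleI[OF R.is_cring])
  have cases: "\<exists>x\<in>carrier M. C = N +>\<^bsub>M\<^esub> x" if "C \<in> carrier ?Q" for C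
    using that unfolding carrier_quotient by blast
  note s = coset_add coset_smult coset_zero
  show "abelian_group ?Q"
  proof (rule abelian_groupI)
    fix C D E assume "C \<in> carrier ?Q" "D \<in> carrier ?Q" "E \<in> carrier ?Q"
    then obtain x y z where e: "C = N +>\<^bsub>M\<^esub> x" "D = N +>\<^bsub>M\<^esub> y" "E = N +>\<^bsub>M\<^esub> z" "x \<in> carrier M" "y \<in> carrier M" "z \<in> carrier M"
      using cases by metis
    then show "C \<oplus>\<^bsub>?Q\<^esub> D \<oplus>\<^bsub>?Q\<^esub> E = C \<oplus>\<^bsub>?Q\<^esub> (D \<oplus>\<^bsub>?Q\<^esub> E)"
      by (simp add: s M.a_assoc)
    show "C \<oplus>\<^bsub>?Q\<^esub> D \<in> carrier ?Q" "C \<oplus>\<^bsub>?Q\<^esub> D = D \<oplus>\<^bsub>?Q\<^esub> C" "\<zero>\<^bsub>?Q\<^esub> \<oplus>\<^bsub>?Q\<^esub> C = C"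
      using e by (simp_all add: s M.a_comm[of x y])
    have "(N +>\<^bsub>M\<^esub> \<ominus>\<^bsub>M\<^esub> x) \<oplus>\<^bsub>?Q\<^esub> C = \<zero>\<^bsub>?Q\<^esub>" using e by (simp add: s M.l_neg)
    then show "\<exists>D\<in>carrier ?Q. D \<oplus>\<^bsub>?Q\<^esub> C = \<zero>\<^bsub>?Q\<^esub>" using e by (meson M.a_inv_closed coset_closed)
  qed (simp add: s)
next
  have cases: "\<exists>x\<in>carrier M. C = N +>\<^bsub>M\<^esub> x" if "C \<in> carrier ?Q" for C
    using that unfolding carrier_quotient by blast
  note s = coset_add coset_smult
  fix a C assume a: "a \<in> carrier R" and C: "C \<in> carrier ?Q"
  then obtain x where e: "C = N +>\<^bsub>M\<^esub> x" "x \<in> carrier M" using cases by metis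
  show "a \<odot>\<^bsub>?Q\<^esub> C \<in> carrier ?Q" using a e by (simp add: s)
  fix D assume "D \<in> carrier ?Q"
  then obtain y where f: "D = N +>\<^bsub>M\<^esub> y" "y \<in> carrier M" using cases by metis
  show "a \<odot>\<^bsub>?Q\<^esub> (C \<oplus>\<^bsub>?Q\<^esub> D) = a \<odot>\<^bsub>?Q\<^esub> C \<oplus>\<^bsub>?Q\<^esub> a \<odot>\<^bsub>?Q\<^esub> D"
    using a e f by (simp add: s smult_r_distr)
next
  have cases: "\<exists>x\<in>carrier M. C = N +>\<^bsub>M\<^esub> x" if "C \<in> carrier ?Q" for C
    using that unfolding carrier_quotient by blast
  note s = coset_add coset_smult
  fix a b C assume a: "a \<in> carrier R" and b: "b \<in> carrier R" and C: "C \<in> carrier ?Q"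
  then obtain x where e: "C = N +>\<^bsub>M\<^esub> x" "x \<in> carrier M" using cases by metis
  show "(a \<oplus>\<^bsub>R\<^esub> b) \<odot>\<^bsub>?Q\<^esub> C = a \<odot>\<^bsub>?Q\<^esub> C \<oplus>\<^bsub>?Q\<^esub> b \<odot>\<^bsub>?Q\<^esub> C"
    "(a \<otimes>\<^bsub>R\<^esub> b) \<odot>\<^bsub>?Q\<^esub> C = a \<odot>\<^bsub>?Q\<^esub> (b \<odot>\<^bsub>?Q\<^esub> C)"
    using a b e by (simp_all add: s smult_l_distr smult_assoc1)
qed (auto simp: carrier_quotient coset_smult)

text \<open>The induced map takes a coset to the only element of its image, which makes it a function of the
  coset without a choice of representatives.\<close>

lemma quotient_universal:
  assumes "abelian_group G" and \<psi>: "\<psi> \<in> carrier M \<rightarrow> carrier G"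
    and add: "\<And>x y. x \<in> carrier M \<Longrightarrow> y \<in> carrier M \<Longrightarrow> \<psi> (x \<oplus>\<^bsub>M\<^esub> y) = \<psi> x \<oplus>\<^bsub>G\<^esub> \<psi> y"
    and zero: "\<And>x. x \<in> N \<Longrightarrow> \<psi> x = \<zero>\<^bsub>G\<^esub>" and x: "x \<in> carrier M"
  shows "the_elem (\<psi> ` (N +>\<^bsub>M\<^esub> x)) = \<psi> x"
proof -
  interpret G: abelian_group G by fact
  have "\<psi> y = \<psi> x" if "y \<in> N +>\<^bsub>M\<^esub> x" for y
  proof -
    obtain n where n: "n \<in> N" "y = n \<oplus>\<^bsub>M\<^esub> x" using \<open>y \<in> N +>\<^bsub>M\<^esub> x\<close> unfolding a_r_coset_def' by blast
    then show ?thesis using zero[OF n(1)] add[of n x] submodD(1)[OF N n(1)] x n(2) funcset_mem[OF \<psi> x] by simp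
  qed
  moreover have "x \<in> N +>\<^bsub>M\<^esub> x" by (rule N.a_rcos_self[OF x])
  ultimately have "\<psi> ` (N +>\<^bsub>M\<^esub> x) = {\<psi> x}" by blast
  then show ?thesis by simp
qed

end

section \<open>Dimension and dual families\<close>

text \<open>The kernel of the functional dual to \<open>b\<close> contains the span of the other vectors but not the
  vector of \<open>b\<close>.\<close>

lemma (in vectorspace) card_dual_family_le_dim:
  assumes fin: "fin_dim" and B: "finite B" and \<tau>: "\<And>b. b \<in> B \<Longrightarrow> \<tau> b \<in> carrier V"
    and add: "\<And>b x y. b \<in> B \<Longrightarrow> x \<in> carrier V \<Longrightarrow> y \<in> carrier V \<Longrightarrow> \<psi> b (x \<oplus>\<^bsub>V\<^esub> y) = \<psi> b x \<oplus>\<^bsub>K\<^esub> \<psi> b y"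
    and sm: "\<And>b c x. b \<in> B \<Longrightarrow> c \<in> carrier K \<Longrightarrow> x \<in> carrier V \<Longrightarrow> \<psi> b (c \<odot>\<^bsub>V\<^esub> x) = c \<otimes>\<^bsub>K\<^esub> \<psi> b x"
    and closed: "\<And>b x. b \<in> B \<Longrightarrow> x \<in> carrier V \<Longrightarrow> \<psi> b x \<in> carrier K"
    and dual: "\<And>b. b \<in> B \<Longrightarrow> \<psi> b (\<tau> b) = \<one>\<^bsub>K\<^esub>"
    and off: "\<And>b c. b \<in> B \<Longrightarrow> c \<in> B \<Longrightarrow> c \<noteq> b \<Longrightarrow> \<psi> b (\<tau> c) = \<zero>\<^bsub>K\<^esub>"
  shows "card B \<le> dim"
proof -
  have neq: "\<tau> c \<noteq> \<tau> b" if "b \<in> B" "c \<in> B" "c \<noteq> b" for b c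
    using off[OF that] dual[OF that(1)] one_not_zero by metis
  have inj: "inj_on \<tau> B" using neq by (meson inj_onI)
  have sub: "\<tau> ` B \<subseteq> carrier V" using \<tau> by blast
  have "lin_indpt (\<tau> ` B)"
  proof
    assume "lin_dep (\<tau> ` B)"
    then obtain b where b: "b \<in> B" and bs: "\<tau> b \<in> span (\<tau> ` B - {\<tau> b})"
      using lindep_span[OF sub] B by auto
    have \<psi>0: "\<psi> b \<zero>\<^bsub>V\<^esub> = \<zero>\<^bsub>K\<^esub>"
      using sm[OF b R.zero_closed \<tau>[OF b]] \<tau>[OF b] closed[OF b \<tau>[OF b]] by simp
    have "LinearCombinations.submodule K {v \<in> carrier V. \<psi> b v = \<zero>\<^bsub>K\<^esub>} V"
      using b \<psi>0 by (intro submodI) (auto simp: add sm)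
    moreover have "\<tau> ` B - {\<tau> b} \<subseteq> {v \<in> carrier V. \<psi> b v = \<zero>\<^bsub>K\<^esub>}"
      using \<tau> off[OF b] by auto
    ultimately have "\<tau> b \<in> {v \<in> carrier V. \<psi> b v = \<zero>\<^bsub>K\<^esub>}"
      using span_is_subset bs by blast
    then show False using dual[OF b] one_not_zero by simp
  qed
  then have "card (\<tau> ` B) \<le> dim" by (rule li_le_dim(2)[OF fin sub])
  then show ?thesis using card_image[OF inj] by simp
qed

section \<open>Fibres of a module\<close>

lemma restrict_scalars_simps [simp]:
  "carrier (restrict_scalars \<phi> M) = carrier M"
  "\<zero>\<^bsub>restrict_scalars \<phi> M\<^esub> = \<zero>\<^bsub>M\<^esub>"
  "x \<oplus>\<^bsub>restrict_scalars \<phi> M\<^esub> y = x \<oplus>\<^bsub>M\<^esub> y"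
  "r \<odot>\<^bsub>restrict_scalars \<phi> M\<^esub> x = \<phi> r \<odot>\<^bsub>M\<^esub> x"
  by (simp_all add: restrict_scalars_def)

lemma ring_as_module_simps [simp]:
  "carrier (ring_as_module A) = carrier A"
  "\<zero>\<^bsub>ring_as_module A\<^esub> = \<zero>\<^bsub>A\<^esub>"
  "x \<oplus>\<^bsub>ring_as_module A\<^esub> y = x \<oplus>\<^bsub>A\<^esub> y"
  "a \<odot>\<^bsub>ring_as_module A\<^esub> x = a \<otimes>\<^bsub>A\<^esub> x"
  by (simp_all add: ring_as_module_def)

lemma module_restrict_scalars:
  assumes "cring R" "\<phi> \<in> ring_hom R A" "module A M"
  shows "module R (restrict_scalars \<phi> M)"
proof -
  interpret R: cring R by fact
  interpret M: module A M by fact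
  note h = ring_hom_closed[OF assms(2)] ring_hom_mult[OF assms(2)] ring_hom_add[OF assms(2)]
    ring_hom_one[OF assms(2)]
  show ?thesis
  proof (rule moduleI[OF R.is_cring])
    show "abelian_group (restrict_scalars \<phi> M)"
    proof (rule abelian_groupI)
      fix x assume "x \<in> carrier (restrict_scalars \<phi> M)"
      then show "\<exists>y\<in>carrier (restrict_scalars \<phi> M).
          y \<oplus>\<^bsub>restrict_scalars \<phi> M\<^esub> x = \<zero>\<^bsub>restrict_scalars \<phi> M\<^esub>"
        by (intro bexI[of _ "\<ominus>\<^bsub>M\<^esub> x"]) (simp_all add: M.l_neg)
    qed (simp_all add: M.M.a_ac)
  qed (simp_all add: h M.smult_l_distr M.smult_r_distr M.smult_assoc1)
qed

lemma (in cring) module_ring_as_module: "module R (ring_as_module R)"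
proof (rule moduleI[OF is_cring])
  show "abelian_group (ring_as_module R)"
  proof (rule abelian_groupI)
    fix x assume "x \<in> carrier (ring_as_module R)"
    then show "\<exists>y\<in>carrier (ring_as_module R). y \<oplus>\<^bsub>ring_as_module R\<^esub> x = \<zero>\<^bsub>ring_as_module R\<^esub>"
      by (intro bexI[of _ "\<ominus> x"]) (simp_all add: l_neg)
  qed (simp_all add: a_ac)
qed (simp_all add: l_distr r_distr m_assoc)

text \<open>The additive group generated by the products is closed under scalars because the set of products
  is, so it is the least submodule containing them.\<close>

lemma (in module) ideal_smult_submodule:
  assumes J: "ideal J R"
  shows "LinearCombinations.submodule R (ideal_smult J M) M"
    and "\<And>a x. a \<in> J \<Longrightarrow> x \<in> carrier M \<Longrightarrow> a \<odot>\<^bsub>M\<^esub> x \<in> ideal_smult J M"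
    and "\<And>Z. LinearCombinations.submodule R Z M \<Longrightarrow>
      (\<And>a x. a \<in> J \<Longrightarrow> x \<in> carrier M \<Longrightarrow> a \<odot>\<^bsub>M\<^esub> x \<in> Z) \<Longrightarrow> ideal_smult J M \<subseteq> Z"
proof -
  interpret J: ideal J R by fact
  let ?G = "{a \<odot>\<^bsub>M\<^esub> x | a x. a \<in> J \<and> x \<in> carrier M}"
  have G: "?G \<subseteq> carrier M" using J.Icarr by auto
  have sub: "subgroup (ideal_smult J M) (add_monoid M)"
    unfolding ideal_smult_def by (rule M.add.generate_is_subgroup[OF G])
  show gen: "a \<odot>\<^bsub>M\<^esub> x \<in> ideal_smult J M" if "a \<in> J" "x \<in> carrier M" for a x
    unfolding ideal_smult_def using that by (intro generate.incl) blast
  show least: "ideal_smult J M \<subseteq> Z" if Z: "LinearCombinations.submodule R Z M"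
    and gZ: "\<And>a x. a \<in> J \<Longrightarrow> x \<in> carrier M \<Longrightarrow> a \<odot>\<^bsub>M\<^esub> x \<in> Z" for Z
  proof -
    have "subgroup Z (add_monoid M)"
      using submodD(2)[OF Z] submodD(1,3,5)[OF Z]
      by (intro M.add.subgroupI) auto
    then show ?thesis
      unfolding ideal_smult_def using gZ by (intro M.add.generate_subgroup_incl) auto
  qed
  show "LinearCombinations.submodule R (ideal_smult J M) M"
  proof (rule submodI)
    show IM: "ideal_smult J M \<subseteq> carrier M" using subgroup.subset[OF sub] by simp
    show "\<zero>\<^bsub>M\<^esub> \<in> ideal_smult J M" using subgroup.one_closed[OF sub] by simp
    show "x \<oplus>\<^bsub>M\<^esub> y \<in> ideal_smult J M" if "x \<in> ideal_smult J M" "y \<in> ideal_smult J M" for x y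
      using subgroup.m_closed[OF sub that] by simp
    fix r x assume r: "r \<in> carrier R" and x: "x \<in> ideal_smult J M"
    have gr: "r \<odot>\<^bsub>M\<^esub> (a \<odot>\<^bsub>M\<^esub> y) \<in> ideal_smult J M" if "a \<in> J" "y \<in> carrier M" for a y
      using gen[of a "r \<odot>\<^bsub>M\<^esub> y"] that r J.Icarr
      by (simp add: smult_assoc1[symmetric] R.m_comm)
    have "x \<in> generate (add_monoid M) ?G" using x unfolding ideal_smult_def .
    then show "r \<odot>\<^bsub>M\<^esub> x \<in> ideal_smult J M"
    proof induction
      case one
      then show ?case using r subgroup.one_closed[OF sub] by simp
    next
      case (incl h)
      then show ?case using gr by blast
    next
      case (inv h)
      then obtain a y where a: "a \<in> J" "y \<in> carrier M" "h = a \<odot>\<^bsub>M\<^esub> y" by blast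
      have "inv\<^bsub>add_monoid M\<^esub> h = a \<odot>\<^bsub>M\<^esub> (\<ominus>\<^bsub>M\<^esub> y)"
        using smult_r_minus[OF J.Icarr[OF a(1)] a(2)] by (simp add: a(3) a_inv_def)
      then show ?case using gr[of a "\<ominus>\<^bsub>M\<^esub> y"] a by simp
    next
      case (eng h1 h2)
      have "h1 \<in> carrier M" "h2 \<in> carrier M"
        using eng(1,2) IM unfolding ideal_smult_def by blast+
      then show ?case
        using subgroup.m_closed[OF sub eng(3,4)] r by (simp add: smult_r_distr)
    qed
  qed
qed

text \<open>The spaces \<open>T\<close> and \<open>T'\<close> below are the same group \<open>M(p)\<close>, with the action of the residue field and
  with the action of \<open>A\<close>; \<open>V\<close> is the vector space \<open>M(p)/J M(p)\<close> whose dimension is studied.\<close>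

locale fibre_space = primeideal p R + M: module A M
  for p and R (structure) and A and M :: "('a, 'm, 'z) module_scheme" +
  fixes \<phi> and J
  assumes \<phi>: "\<phi> \<in> ring_hom R A" and J: "ideal J A"
begin

abbreviation "k \<equiv> residue_field R p"
abbreviation "\<rho> \<equiv> residue_map R p"
abbreviation "T \<equiv> fibre R \<phi> M p"
abbreviation "T' \<equiv> fibre_over R \<phi> M p"
abbreviation "JT \<equiv> ideal_smult J T'"
abbreviation "V \<equiv> quotient_module T JT"

sublocale k: field k
  by (rule residue_field_field)

lemma \<rho>_hom: "ring_hom_cring R k \<rho>"
  using residue_map_hom is_cring k.is_cring by (intro ring_hom_cring.intro ring_hom_cring_axioms.intro)

sublocale \<rho>: ring_hom_cring R k \<rho>
  by (rule \<rho>_hom)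

lemma residue_module_simps [simp]:
  "carrier (residue_module R p) = carrier k"
  "c \<oplus>\<^bsub>residue_module R p\<^esub> d = c \<oplus>\<^bsub>k\<^esub> d"
  "r \<odot>\<^bsub>residue_module R p\<^esub> c = \<rho> r \<otimes>\<^bsub>k\<^esub> c"
  by (simp_all add: residue_module_def)

lemma module_residue: "module R (residue_module R p)"
  unfolding residue_module_def
  by (rule module_restrict_scalars[OF is_cring residue_map_hom k.module_ring_as_module])

lemma module_M: "module R (restrict_scalars \<phi> M)"
  by (rule module_restrict_scalars[OF is_cring \<phi> M.module_axioms])

sublocale t: tensor_product R "restrict_scalars \<phi> M" "residue_module R p"
  by (rule tensor_product.intro[OF module_M module_residue])

lemma id_hom: "(\<lambda>x. x) \<in> module_hom R N N"
  by (simp add: module_hom_def)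

lemma mult_hom: "c \<in> carrier k \<Longrightarrow> (\<lambda>z. c \<otimes>\<^bsub>k\<^esub> z) \<in> module_hom R (residue_module R p) (residue_module R p)"
  by (simp add: module_hom_def k.r_distr k.m_lcomm)

lemma smult_hom:
  "a \<in> carrier A \<Longrightarrow> (\<lambda>x. a \<odot>\<^bsub>M\<^esub> x) \<in> module_hom R (restrict_scalars \<phi> M) (restrict_scalars \<phi> M)"
  using ring_hom_closed[OF \<phi>]
  by (simp add: module_hom_def M.smult_r_distr M.smult_assoc1[symmetric] M.R.m_comm)

lemma module_T: "module k T"
  unfolding fibre_def
proof (rule t.module_tensor[where f = "\<lambda>_ x. x" and g = "\<lambda>c z. c \<otimes>\<^bsub>k\<^esub> z"])
  fix c d x z assume "c \<in> carrier k" "d \<in> carrier k" "x \<in> carrier (restrict_scalars \<phi> M)"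
    "z \<in> carrier (residue_module R p)"
  then show "t.pure x ((c \<oplus>\<^bsub>k\<^esub> d) \<otimes>\<^bsub>k\<^esub> z) = t.pure x (c \<otimes>\<^bsub>k\<^esub> z) \<oplus>\<^bsub>tensor_module R
      (restrict_scalars \<phi> M) (residue_module R p) (\<lambda>c (x, z). (x, c \<otimes>\<^bsub>k\<^esub> z))\<^esub> t.pure x (d \<otimes>\<^bsub>k\<^esub> z)"
    using t.pure_add_right[of x "c \<otimes>\<^bsub>k\<^esub> z" "d \<otimes>\<^bsub>k\<^esub> z"] by (simp add: k.l_distr)
qed (simp_all add: id_hom mult_hom k.is_cring k.m_assoc)

lemma module_T': "module A T'"
  unfolding fibre_over_def
proof (rule t.module_tensor[where f = "\<lambda>a x. a \<odot>\<^bsub>M\<^esub> x" and g = "\<lambda>_ z. z"])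
  fix a b x z assume "a \<in> carrier A" "b \<in> carrier A" "x \<in> carrier (restrict_scalars \<phi> M)"
    "z \<in> carrier (residue_module R p)"
  then show "t.pure ((a \<oplus>\<^bsub>A\<^esub> b) \<odot>\<^bsub>M\<^esub> x) z = t.pure (a \<odot>\<^bsub>M\<^esub> x) z \<oplus>\<^bsub>tensor_module R
      (restrict_scalars \<phi> M) (residue_module R p) (\<lambda>a (x, z). (a \<odot>\<^bsub>M\<^esub> x, z))\<^esub> t.pure (b \<odot>\<^bsub>M\<^esub> x) z"
    using t.pure_add_left[of "a \<odot>\<^bsub>M\<^esub> x" "b \<odot>\<^bsub>M\<^esub> x" z] by (simp add: M.smult_l_distr)
qed (simp_all add: id_hom smult_hom M.R.is_cring M.smult_assoc1)

sublocale T: module k T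
  by (rule module_T)

sublocale T': module A T'
  by (rule module_T')

lemma T'_eq [simp]:
  "carrier T' = carrier T" "\<zero>\<^bsub>T'\<^esub> = \<zero>\<^bsub>T\<^esub>" "U \<oplus>\<^bsub>T'\<^esub> W = U \<oplus>\<^bsub>T\<^esub> W"
  by (simp_all add: fibre_def fibre_over_def tensor_module_def Let_def)

lemma pure_T [simp]: "x \<in> carrier M \<Longrightarrow> c \<in> carrier k \<Longrightarrow> t.pure x c \<in> carrier T"
  unfolding fibre_def by (rule t.pure_closed) simp_all

lemma pure_add:
  "x \<in> carrier M \<Longrightarrow> y \<in> carrier M \<Longrightarrow> c \<in> carrier k \<Longrightarrow>
    t.pure (x \<oplus>\<^bsub>M\<^esub> y) c = t.pure x c \<oplus>\<^bsub>T\<^esub> t.pure y c"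
  using t.pure_add_left[of x y c] unfolding fibre_def by simp

lemma pure_scalar:
  "r \<in> carrier R \<Longrightarrow> x \<in> carrier M \<Longrightarrow> c \<in> carrier k \<Longrightarrow>
    t.pure (\<phi> r \<odot>\<^bsub>M\<^esub> x) c = t.pure x (\<rho> r \<otimes>\<^bsub>k\<^esub> c)"
  using t.pure_balanced[of r x c] by simp

lemma smult_pure:
  assumes "c \<in> carrier k" "x \<in> carrier M" "d \<in> carrier k"
  shows "c \<odot>\<^bsub>T\<^esub> t.pure x d = t.pure x (c \<otimes>\<^bsub>k\<^esub> d)"
  unfolding fibre_def
  by (rule t.smult_tensor(1)[where c = c and act = "\<lambda>c (x, z). (x, c \<otimes>\<^bsub>k\<^esub> z)", OF id_hom mult_hom])
    (use assms in simp_all)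

lemma smult'_pure:
  assumes "a \<in> carrier A" "x \<in> carrier M" "d \<in> carrier k"
  shows "a \<odot>\<^bsub>T'\<^esub> t.pure x d = t.pure (a \<odot>\<^bsub>M\<^esub> x) d"
  unfolding fibre_over_def
  by (rule t.smult_tensor(1)[where c = a and act = "\<lambda>a (x, z). (a \<odot>\<^bsub>M\<^esub> x, z)", OF smult_hom id_hom])
    (use assms in simp_all)

lemma T_induct [consumes 1, case_names zero pure add]:
  assumes "U \<in> carrier T" "P \<zero>\<^bsub>T\<^esub>"
    and "\<And>x c. x \<in> carrier M \<Longrightarrow> c \<in> carrier k \<Longrightarrow> P (t.pure x c)"
    and "\<And>U W. U \<in> carrier T \<Longrightarrow> W \<in> carrier T \<Longrightarrow> P U \<Longrightarrow> P W \<Longrightarrow> P (U \<oplus>\<^bsub>T\<^esub> W)"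
  shows "P U"
  using assms unfolding fibre_def by (rule t.tensor_induct) simp_all

text \<open>Because the two actions commute, \<open>J M(p)\<close>, which is defined through the action of \<open>A\<close>, is also a
  subspace over the residue field.\<close>

lemma smult_commute:
  assumes a: "a \<in> carrier A" and c: "c \<in> carrier k" and U: "U \<in> carrier T"
  shows "c \<odot>\<^bsub>T\<^esub> (a \<odot>\<^bsub>T'\<^esub> U) = a \<odot>\<^bsub>T'\<^esub> (c \<odot>\<^bsub>T\<^esub> U)"
  using U
proof (induction rule: T_induct)
  case zero
  have "a \<odot>\<^bsub>T'\<^esub> \<zero>\<^bsub>T\<^esub> = \<zero>\<^bsub>T\<^esub>" using T'.smult_r_null[OF a] by simp
  then show ?case using c by simp
next
  case (pure x d)
  then show ?case using a c by (simp add: smult_pure smult'_pure)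
next
  case (add U W)
  have cl: "a \<odot>\<^bsub>T'\<^esub> Z \<in> carrier T" if "Z \<in> carrier T" for Z
    using T'.smult_closed[OF a, of Z] that by simp
  have d: "a \<odot>\<^bsub>T'\<^esub> (Y \<oplus>\<^bsub>T\<^esub> Z) = a \<odot>\<^bsub>T'\<^esub> Y \<oplus>\<^bsub>T\<^esub> a \<odot>\<^bsub>T'\<^esub> Z" if "Y \<in> carrier T" "Z \<in> carrier T" for Y Z
    using T'.smult_r_distr[OF a, of Y Z] that by simp
  show ?case using add a c by (simp add: cl d T.smult_r_distr)
qed

lemma JT_submodule: "LinearCombinations.submodule k JT T"
proof -
  note sub = T'.ideal_smult_submodule[OF J]
  show ?thesis
  proof (rule T.submodI)
    show "JT \<subseteq> carrier T" using T'.submodD(1)[OF sub(1)] by auto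
    show "\<zero>\<^bsub>T\<^esub> \<in> JT" using T'.submodD(2)[OF sub(1)] by simp
    show "U \<oplus>\<^bsub>T\<^esub> W \<in> JT" if "U \<in> JT" "W \<in> JT" for U W
      using T'.submodD(3)[OF sub(1) that] by simp
    fix c U assume c: "c \<in> carrier k" and U: "U \<in> JT"
    have "LinearCombinations.submodule A {U \<in> carrier T. c \<odot>\<^bsub>T\<^esub> U \<in> JT} T'"
    proof (rule T'.submodI)
      fix a U assume a: "a \<in> carrier A" and U: "U \<in> {U \<in> carrier T. c \<odot>\<^bsub>T\<^esub> U \<in> JT}"
      have "a \<odot>\<^bsub>T'\<^esub> (c \<odot>\<^bsub>T\<^esub> U) \<in> JT" using T'.submodD(4)[OF sub(1) a] U by simp
      moreover have "a \<odot>\<^bsub>T'\<^esub> U \<in> carrier T" using T'.smult_closed[OF a, of U] U by simp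
      ultimately show "a \<odot>\<^bsub>T'\<^esub> U \<in> {U \<in> carrier T. c \<odot>\<^bsub>T\<^esub> U \<in> JT}"
        using smult_commute[OF a c, of U] U by simp
    qed (use c T'.submodD(2,3)[OF sub(1)] in \<open>auto simp: T.smult_r_distr\<close>)
    moreover have "a \<odot>\<^bsub>T'\<^esub> W \<in> {U \<in> carrier T. c \<odot>\<^bsub>T\<^esub> U \<in> JT}" if "a \<in> J" "W \<in> carrier T'" for a W
    proof -
      have a: "a \<in> carrier A" using ideal.Icarr[OF J that(1)] .
      have "a \<odot>\<^bsub>T'\<^esub> (c \<odot>\<^bsub>T\<^esub> W) \<in> JT" using sub(2)[OF that(1), of "c \<odot>\<^bsub>T\<^esub> W"] that(2) c by simp
      moreover have "a \<odot>\<^bsub>T'\<^esub> W \<in> carrier T" using T'.smult_closed[OF a that(2)] by simp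
      ultimately show ?thesis using smult_commute[OF a c, of W] that(2) by simp
    qed
    ultimately have "JT \<subseteq> {U \<in> carrier T. c \<odot>\<^bsub>T\<^esub> U \<in> JT}" by (rule sub(3))
    then show "c \<odot>\<^bsub>T\<^esub> U \<in> JT" using U by blast
  qed
qed

sublocale q: module_quotient k T JT
  by (rule module_quotient.intro[OF module_T module_quotient_axioms.intro[OF JT_submodule]])

sublocale V: vectorspace k V
  by (rule vectorspace.intro[OF q.module_quotient_module k.field_axioms])

lemma pure_in_JT:
  assumes x: "x \<in> ideal_smult J M" and c: "c \<in> carrier k"
  shows "t.pure x c \<in> JT"
proof -
  have p0: "t.pure \<zero>\<^bsub>M\<^esub> c = \<zero>\<^bsub>T\<^esub>"
    using pure_add[of "\<zero>\<^bsub>M\<^esub>" "\<zero>\<^bsub>M\<^esub>" c] c pure_T[of "\<zero>\<^bsub>M\<^esub>" c] by simp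
  have "LinearCombinations.submodule A {x \<in> carrier M. t.pure x c \<in> JT} M"
  proof (rule M.submodI)
    fix a x assume a: "a \<in> carrier A" and x: "x \<in> {x \<in> carrier M. t.pure x c \<in> JT}"
    then have "a \<odot>\<^bsub>T'\<^esub> t.pure x c \<in> JT"
      using T'.submodD(4)[OF T'.ideal_smult_submodule(1)[OF J]] by simp
    then show "a \<odot>\<^bsub>M\<^esub> x \<in> {x \<in> carrier M. t.pure x c \<in> JT}" using a x c by (simp add: smult'_pure)
  qed (use c p0 T.submodD(2,3)[OF JT_submodule] in \<open>auto simp: pure_add\<close>)
  moreover have "a \<odot>\<^bsub>M\<^esub> x \<in> {x \<in> carrier M. t.pure x c \<in> JT}" if "a \<in> J" "x \<in> carrier M" for a x
  proof -
    have a: "a \<in> carrier A" using ideal.Icarr[OF J that(1)] .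
    have "a \<odot>\<^bsub>T'\<^esub> t.pure x c \<in> JT"
      using T'.ideal_smult_submodule(2)[OF J that(1), of "t.pure x c"] that(2) c by simp
    then show ?thesis using a that c by (simp add: smult'_pure)
  qed
  ultimately have "ideal_smult J M \<subseteq> {x \<in> carrier M. t.pure x c \<in> JT}"
    by (rule M.ideal_smult_submodule(3)[OF J])
  then show ?thesis using x by blast
qed

abbreviation image_in_fibre :: "'m \<Rightarrow> _" where
  "image_in_fibre x \<equiv> JT +>\<^bsub>T\<^esub> t.pure x \<one>\<^bsub>k\<^esub>"

text \<open>A common denominator \<open>f\<close> outside \<open>p\<close> acts invertibly on the fibre, so generators up to \<open>f\<close>
  give generators of the fibre.\<close>

lemma fibre_dim_le:
  assumes B: "finite B" "B \<subseteq> carrier M" and f: "f \<in> carrier R - p"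
    and gen: "\<And>x. x \<in> carrier M \<Longrightarrow>
      \<phi> f \<odot>\<^bsub>M\<^esub> x \<in> comb (restrict_scalars \<phi> M) (carrier R) B (ideal_smult J M)"
  shows "V.fin_dim" and "fibre_dim R \<phi> M J p \<le> card B"
proof -
  let ?S = "image_in_fibre ` B"
  have S: "?S \<subseteq> carrier V" using B by (auto intro!: q.coset_closed)
  have W: "LinearCombinations.submodule k (V.span ?S) V" by (rule V.span_is_submodule[OF S])
  note Wadd = V.submodD(3)[OF W] and Wsm = V.submodD(4)[OF W]
  have comb_W: "y \<in> carrier M \<and> (\<forall>c\<in>carrier k. JT +>\<^bsub>T\<^esub> t.pure y c \<in> V.span ?S)"
    if "y \<in> comb (restrict_scalars \<phi> M) (carrier R) B (ideal_smult J M)" for y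
    using that
  proof induction
    case (base y)
    have "JT +>\<^bsub>T\<^esub> t.pure y c \<in> V.span ?S" if c: "c \<in> carrier k" for c
    proof -
      have "JT +>\<^bsub>T\<^esub> t.pure y c = \<zero>\<^bsub>V\<^esub>"
        using q.N.a_rcos_const[OF pure_in_JT[OF base c]] by (simp add: quotient_module_def)
      then show ?thesis using V.submodD(2)[OF W] by simp
    qed
    then show ?case using M.submodD(1)[OF M.ideal_smult_submodule(1)[OF J] base] by blast
  next
    case (step r b y)
    have bM: "b \<in> carrier M" "\<phi> r \<odot>\<^bsub>M\<^esub> b \<in> carrier M"
      using step B ring_hom_closed[OF \<phi>] by auto
    have "JT +>\<^bsub>T\<^esub> t.pure (\<phi> r \<odot>\<^bsub>M\<^esub> b \<oplus>\<^bsub>M\<^esub> y) c \<in> V.span ?S" if c: "c \<in> carrier k" for c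
    proof -
      have d: "\<rho> r \<otimes>\<^bsub>k\<^esub> c \<in> carrier k" using step(1) c by simp
      have "t.pure (\<phi> r \<odot>\<^bsub>M\<^esub> b \<oplus>\<^bsub>M\<^esub> y) c = t.pure b (\<rho> r \<otimes>\<^bsub>k\<^esub> c) \<oplus>\<^bsub>T\<^esub> t.pure y c"
        using bM step c by (simp add: pure_add pure_scalar)
      also have "t.pure b (\<rho> r \<otimes>\<^bsub>k\<^esub> c) = (\<rho> r \<otimes>\<^bsub>k\<^esub> c) \<odot>\<^bsub>T\<^esub> t.pure b \<one>\<^bsub>k\<^esub>"
        using bM d by (simp add: smult_pure)
      finally have "JT +>\<^bsub>T\<^esub> t.pure (\<phi> r \<odot>\<^bsub>M\<^esub> b \<oplus>\<^bsub>M\<^esub> y) c =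
          (\<rho> r \<otimes>\<^bsub>k\<^esub> c) \<odot>\<^bsub>V\<^esub> image_in_fibre b \<oplus>\<^bsub>V\<^esub> (JT +>\<^bsub>T\<^esub> t.pure y c)"
        using bM d step c by (simp add: q.coset_add q.coset_smult)
      moreover have "image_in_fibre b \<in> V.span ?S"
        using V.in_own_span[OF S] step(2) by blast
      ultimately show ?thesis using Wadd[OF Wsm[OF d]] step c by simp
    qed
    then show ?case using bM step by simp
  qed
  have \<rho>f: "\<rho> f \<in> Units k"
    using f residue_map_eq_zero_iff[of f] k.field_Units by auto
  have pure_W: "JT +>\<^bsub>T\<^esub> t.pure x c \<in> V.span ?S" if "x \<in> carrier M" "c \<in> carrier k" for x c
  proof -
    have "t.pure x c = t.pure x (\<rho> f \<otimes>\<^bsub>k\<^esub> (inv\<^bsub>k\<^esub> \<rho> f \<otimes>\<^bsub>k\<^esub> c))"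
      using \<rho>f that k.Units_closed by (simp add: k.m_assoc[symmetric])
    also have "\<dots> = t.pure (\<phi> f \<odot>\<^bsub>M\<^esub> x) (inv\<^bsub>k\<^esub> \<rho> f \<otimes>\<^bsub>k\<^esub> c)"
      using \<rho>f that f by (simp add: pure_scalar)
    finally show ?thesis using comb_W[OF gen[OF that(1)]] \<rho>f that by simp
  qed
  have "JT +>\<^bsub>T\<^esub> U \<in> V.span ?S" if "U \<in> carrier T" for U
    using that
  proof (induction rule: T_induct)
    case zero
    then show ?case using V.submodD(2)[OF W] by (simp add: q.coset_zero)
  next
    case (pure x c)
    then show ?case by (rule pure_W)
  next
    case (add U U')
    then show ?case using Wadd by (simp add: q.coset_add[symmetric])
  qed
  then have "carrier V \<subseteq> V.span ?S" by (auto simp: q.carrier_quotient)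
  then have gs: "V.gen_set ?S" using V.span_is_subset2[OF S] by blast
  show "V.fin_dim" unfolding V.fin_dim_def using gs S B(1) by blast
  have "V.dim \<le> card ?S" using V.gen_ge_dim[OF _ S gs] B(1) by simp
  also have "\<dots> \<le> card B" by (rule card_image_le[OF B(1)])
  finally show "fibre_dim R \<phi> M J p \<le> card B" by (simp add: fibre_dim_def)
qed

text \<open>A functional on \<open>M\<close> that kills \<open>JM\<close> extends to the tensor product by the universal property
  and factors through the quotient by \<open>J\<close>.\<close>

lemma card_le_fibre_dim:
  assumes fin: "V.fin_dim" and B: "finite B" "B \<subseteq> carrier M"
    and closed: "\<And>b x. b \<in> B \<Longrightarrow> x \<in> carrier M \<Longrightarrow> \<mu> b x \<in> carrier k"
    and add: "\<And>b x y. b \<in> B \<Longrightarrow> x \<in> carrier M \<Longrightarrow> y \<in> carrier M \<Longrightarrow>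
      \<mu> b (x \<oplus>\<^bsub>M\<^esub> y) = \<mu> b x \<oplus>\<^bsub>k\<^esub> \<mu> b y"
    and sm: "\<And>b r x. b \<in> B \<Longrightarrow> r \<in> carrier R \<Longrightarrow> x \<in> carrier M \<Longrightarrow>
      \<mu> b (\<phi> r \<odot>\<^bsub>M\<^esub> x) = \<rho> r \<otimes>\<^bsub>k\<^esub> \<mu> b x"
    and dual: "\<And>b. b \<in> B \<Longrightarrow> \<mu> b b = \<one>\<^bsub>k\<^esub>"
    and off: "\<And>b c. b \<in> B \<Longrightarrow> c \<in> B \<Longrightarrow> c \<noteq> b \<Longrightarrow> \<mu> b c = \<zero>\<^bsub>k\<^esub>"
    and kill: "\<And>b x. b \<in> B \<Longrightarrow> x \<in> ideal_smult J M \<Longrightarrow> \<mu> b x = \<zero>\<^bsub>k\<^esub>"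
  shows "card B \<le> fibre_dim R \<phi> M J p"
proof -
  define ext where "ext b \<psi> \<longleftrightarrow> (\<forall>U\<in>carrier T. \<psi> U \<in> carrier k) \<and>
    (\<forall>x\<in>carrier M. \<forall>c\<in>carrier k. \<psi> (t.pure x c) = \<mu> b x \<otimes>\<^bsub>k\<^esub> c) \<and>
    (\<forall>U\<in>carrier T. \<forall>W\<in>carrier T. \<psi> (U \<oplus>\<^bsub>T\<^esub> W) = \<psi> U \<oplus>\<^bsub>k\<^esub> \<psi> W)" for b \<psi>
  have "\<exists>\<psi>. ext b \<psi>" if b: "b \<in> B" for b
  proof (rule t.tensor_universal[where G = k and g = "\<lambda>x c. \<mu> b x \<otimes>\<^bsub>k\<^esub> c"
        and act = "\<lambda>c (x, z). (x, c \<otimes>\<^bsub>k\<^esub> z)"], goal_cases)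
    case 1
    show ?case by (rule k.is_abelian_group)
  next
    case (2 x z)
    then show ?case using closed[OF b] by simp
  next
    case (3 x y z)
    then show ?case using closed[OF b] add[OF b] by (simp add: k.l_distr)
  next
    case (4 x z w)
    then show ?case using closed[OF b] by (simp add: k.r_distr)
  next
    case (5 r x z)
    then show ?case using closed[OF b] sm[OF b] by (simp add: k.m_ac)
  next
    case (6 \<psi>)
    have "ext b \<psi>"
      unfolding ext_def fibre_def using 6 by (intro conjI ballI) (auto dest: funcset_mem)
    then show ?case by blast
  qed
  then have "\<forall>b\<in>B. \<exists>\<psi>. ext b \<psi>" by (intro ballI)
  from bchoice[OF this] obtain \<psi> where \<psi>: "\<forall>b\<in>B. ext b (\<psi> b)" by (elim exE)
  have \<psi>_closed: "\<psi> b U \<in> carrier k" if "b \<in> B" "U \<in> carrier T" for b U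
    using \<psi> that by (simp add: ext_def)
  have \<psi>_pure: "\<psi> b (t.pure x c) = \<mu> b x \<otimes>\<^bsub>k\<^esub> c" if "b \<in> B" "x \<in> carrier M" "c \<in> carrier k" for b x c
    using \<psi> that by (simp add: ext_def)
  have \<psi>_add: "\<psi> b (U \<oplus>\<^bsub>T\<^esub> W) = \<psi> b U \<oplus>\<^bsub>k\<^esub> \<psi> b W"
    if "b \<in> B" "U \<in> carrier T" "W \<in> carrier T" for b U W
    using \<psi> that by (simp add: ext_def)
  have \<psi>_zero: "\<psi> b \<zero>\<^bsub>T\<^esub> = \<zero>\<^bsub>k\<^esub>" if b: "b \<in> B" for b
    using \<psi>_add[OF b, of "\<zero>\<^bsub>T\<^esub>" "\<zero>\<^bsub>T\<^esub>"] \<psi>_closed[OF b, of "\<zero>\<^bsub>T\<^esub>"] by simp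
  have \<psi>_smult: "\<psi> b (c \<odot>\<^bsub>T\<^esub> U) = c \<otimes>\<^bsub>k\<^esub> \<psi> b U"
    if b: "b \<in> B" and c: "c \<in> carrier k" and U: "U \<in> carrier T" for b c U
    using U
  proof (induction rule: T_induct)
    case zero
    then show ?case using c \<psi>_zero[OF b] by simp
  next
    case (pure x d)
    then show ?case using b c closed[OF b] by (simp add: smult_pure \<psi>_pure k.m_lcomm)
  next
    case (add U W)
    then show ?case using b c by (simp add: T.smult_r_distr \<psi>_add \<psi>_closed k.r_distr)
  qed
  have \<psi>_J: "\<psi> b (a \<odot>\<^bsub>T'\<^esub> U) = \<zero>\<^bsub>k\<^esub>" if b: "b \<in> B" and a: "a \<in> J" and U: "U \<in> carrier T" for b a U
    using U
  proof (induction rule: T_induct)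
    case zero
    then show ?case using T'.smult_r_null[OF ideal.Icarr[OF J a]] \<psi>_zero[OF b] by simp
  next
    case (pure x d)
    have "\<mu> b (a \<odot>\<^bsub>M\<^esub> x) = \<zero>\<^bsub>k\<^esub>"
      using kill[OF b] M.ideal_smult_submodule(2)[OF J a pure(1)] by blast
    then show ?case using b pure ideal.Icarr[OF J a] by (simp add: smult'_pure \<psi>_pure)
  next
    case (add U W)
    have cl: "a \<odot>\<^bsub>T'\<^esub> Z \<in> carrier T" if "Z \<in> carrier T" for Z
      using T'.smult_closed[OF ideal.Icarr[OF J a], of Z] that by simp
    have "a \<odot>\<^bsub>T'\<^esub> (U \<oplus>\<^bsub>T\<^esub> W) = a \<odot>\<^bsub>T'\<^esub> U \<oplus>\<^bsub>T\<^esub> a \<odot>\<^bsub>T'\<^esub> W"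
      using T'.smult_r_distr[OF ideal.Icarr[OF J a], of U W] add by simp
    then show ?case using add b by (simp add: cl \<psi>_add)
  qed
  have \<psi>_JT: "\<psi> b U = \<zero>\<^bsub>k\<^esub>" if b: "b \<in> B" and U: "U \<in> JT" for b U
  proof -
    \<comment> \<open>The functional is not linear over \<open>A\<close>, so its kernel is replaced by the largest
      \<open>A\<close>-submodule inside it.\<close>
    let ?Z = "{U \<in> carrier T. \<forall>a\<in>carrier A. \<psi> b (a \<odot>\<^bsub>T'\<^esub> U) = \<zero>\<^bsub>k\<^esub>}"
    have cl: "a \<odot>\<^bsub>T'\<^esub> Z \<in> carrier T" if "a \<in> carrier A" "Z \<in> carrier T" for a Z
      using T'.smult_closed[OF that(1), of Z] that by simp
    have "LinearCombinations.submodule A ?Z T'"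
    proof (rule T'.submodI)
      show "\<zero>\<^bsub>T'\<^esub> \<in> ?Z" using T'.smult_r_null \<psi>_zero[OF b] by simp
      show "?Z \<subseteq> carrier T'" by auto
    next
      fix U W assume U: "U \<in> ?Z" "W \<in> ?Z"
      have "a \<odot>\<^bsub>T'\<^esub> (U \<oplus>\<^bsub>T\<^esub> W) = a \<odot>\<^bsub>T'\<^esub> U \<oplus>\<^bsub>T\<^esub> a \<odot>\<^bsub>T'\<^esub> W" if "a \<in> carrier A" for a
        using T'.smult_r_distr[OF that, of U W] U by simp
      then show "U \<oplus>\<^bsub>T'\<^esub> W \<in> ?Z" using U b by (simp add: cl \<psi>_add)
    next
      fix a U assume a: "a \<in> carrier A" and U: "U \<in> ?Z"
      have "c \<odot>\<^bsub>T'\<^esub> (a \<odot>\<^bsub>T'\<^esub> U) = (c \<otimes>\<^bsub>A\<^esub> a) \<odot>\<^bsub>T'\<^esub> U" if "c \<in> carrier A" for c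
        using T'.smult_assoc1[OF that a, of U] U by simp
      then show "a \<odot>\<^bsub>T'\<^esub> U \<in> ?Z" using U a by (simp add: cl)
    qed
    moreover have "a \<odot>\<^bsub>T'\<^esub> W \<in> ?Z" if a: "a \<in> J" and W: "W \<in> carrier T'" for a W
    proof -
      have "\<psi> b (c \<odot>\<^bsub>T'\<^esub> (a \<odot>\<^bsub>T'\<^esub> W)) = \<zero>\<^bsub>k\<^esub>" if c: "c \<in> carrier A" for c
        using \<psi>_J[OF b ideal.I_l_closed[OF J a c], of W] W
          T'.smult_assoc1[OF c ideal.Icarr[OF J a] W] by simp
      then show ?thesis using cl[OF ideal.Icarr[OF J a], of W] W by simp
    qed
    ultimately have "JT \<subseteq> ?Z" by (rule T'.ideal_smult_submodule(3)[OF J])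
    then have "U \<in> ?Z" using U by blast
    then have UT: "U \<in> carrier T" and all: "\<forall>a\<in>carrier A. \<psi> b (a \<odot>\<^bsub>T'\<^esub> U) = \<zero>\<^bsub>k\<^esub>"
      by simp_all
    show ?thesis using bspec[OF all M.R.one_closed] T'.smult_one[of U] UT by simp
  qed
  define \<Psi> where "\<Psi> b C = the_elem (\<psi> b ` C)" for b C
  have \<Psi>: "\<Psi> b (JT +>\<^bsub>T\<^esub> U) = \<psi> b U" if b: "b \<in> B" and U: "U \<in> carrier T" for b U
    unfolding \<Psi>_def
    by (rule q.quotient_universal[OF k.is_abelian_group])
      (use \<psi>_closed \<psi>_add \<psi>_JT b U in auto)
  have cases: "\<exists>U\<in>carrier T. C = JT +>\<^bsub>T\<^esub> U" if "C \<in> carrier V" for C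
    using that unfolding q.carrier_quotient by blast
  have "card B \<le> V.dim"
  proof (rule V.card_dual_family_le_dim[OF fin B(1), where \<tau> = image_in_fibre and \<psi> = \<Psi>])
    have one: "t.pure b \<one>\<^bsub>k\<^esub> \<in> carrier T" if "b \<in> B" for b
      using that B by (intro pure_T) auto
    show "image_in_fibre b \<in> carrier V" if "b \<in> B" for b
      using one[OF that] by (rule q.coset_closed)
    show "\<Psi> b (image_in_fibre b) = \<one>\<^bsub>k\<^esub>" if "b \<in> B" for b
      using \<Psi>[OF that one[OF that]] \<psi>_pure[OF that, of b "\<one>\<^bsub>k\<^esub>"] dual[OF that] that B by auto
    show "\<Psi> b (image_in_fibre c) = \<zero>\<^bsub>k\<^esub>" if "b \<in> B" "c \<in> B" "c \<noteq> b" for b c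
      using \<Psi>[OF that(1) one[OF that(2)]] \<psi>_pure[OF that(1), of c "\<one>\<^bsub>k\<^esub>"] off[OF that] that B by auto
  next
    fix b C D assume b: "b \<in> B" and "C \<in> carrier V" "D \<in> carrier V"
    then obtain U W where "C = JT +>\<^bsub>T\<^esub> U" "D = JT +>\<^bsub>T\<^esub> W" "U \<in> carrier T" "W \<in> carrier T"
      using cases by metis
    then show "\<Psi> b (C \<oplus>\<^bsub>V\<^esub> D) = \<Psi> b C \<oplus>\<^bsub>k\<^esub> \<Psi> b D"
      using b by (simp add: q.coset_add \<Psi> \<psi>_add)
  next
    fix b c C assume b: "b \<in> B" and c: "c \<in> carrier k" and "C \<in> carrier V"
    then obtain U where "C = JT +>\<^bsub>T\<^esub> U" "U \<in> carrier T"
      using cases by metis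
    then show "\<Psi> b (c \<odot>\<^bsub>V\<^esub> C) = c \<otimes>\<^bsub>k\<^esub> \<Psi> b C"
      using b c by (simp add: q.coset_smult \<Psi> \<psi>_smult)
  next
    fix b C assume b: "b \<in> B" and "C \<in> carrier V"
    then obtain U where "C = JT +>\<^bsub>T\<^esub> U" "U \<in> carrier T"
      using cases by metis
    then show "\<Psi> b C \<in> carrier k" using b by (simp add: \<Psi> \<psi>_closed)
  qed
  then show ?thesis by (simp add: fibre_dim_def)
qed

end

section \<open>Finiteness modulo powers of an ideal\<close>

lemma (in cring) ideal_power_ideal:
  assumes "ideal I R"
  shows "ideal (I [^]\<^bsub>ideals_set R\<^esub> (n::nat)) R"
proof -
  interpret S: comm_monoid "ideals_set R" by (rule ideals_set_is_comm_monoid)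
  show ?thesis
    using S.nat_pow_closed[of I n] assms by (simp add: ideals_set_def)
qed

lemma (in cring) ideal_power_Suc:
  "I [^]\<^bsub>ideals_set R\<^esub> Suc n = ideal_prod R (I [^]\<^bsub>ideals_set R\<^esub> n) I"
proof -
  interpret S: comm_monoid "ideals_set R" by (rule ideals_set_is_comm_monoid)
  show ?thesis using S.nat_pow_Suc[of I n] by (simp add: ideals_set_def)
qed

lemma submodule_restrict_scalars:
  assumes "cring R" "\<phi> \<in> ring_hom R A" "module A M" and N: "LinearCombinations.submodule A N M"
  shows "LinearCombinations.submodule R N (restrict_scalars \<phi> M)"
proof -
  interpret M: module A M by fact
  interpret N: module R "restrict_scalars \<phi> M" by (rule module_restrict_scalars[OF assms(1-3)])
  show ?thesis
    by (rule N.submodI) (use M.submodD[OF N] ring_hom_closed[OF assms(2)] in auto)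
qed

text \<open>One step of the filtration by powers of \<open>I\<close>: with \<open>J = (g\<^sub>1, \<dots>, g\<^sub>l)\<close>, \<open>M = \<Sum> A m\<^sub>j\<close> and
  \<open>A = \<Sum> R t\<^sub>i + I\<close>, the module \<open>JM\<close> is generated over \<open>R\<close> by the products \<open>g t m\<close> modulo \<open>JIM\<close>.\<close>

lemma ideal_smult_finite_step:
  assumes R: "cring R" and A: "cring A" and \<phi>: "\<phi> \<in> ring_hom R A"
    and I: "ideal I A"
    and fin: "finite_module R (restrict_scalars (\<lambda>r. I +>\<^bsub>A\<^esub> \<phi> r) (ring_as_module (A Quot I)))"
    and M: "finite_module A M"
    and G: "finite G" "G \<subseteq> carrier A" and J: "J = genideal A G"
  obtains S where "finite S" "S \<subseteq> carrier M"
    "ideal_smult J M \<subseteq> comb (restrict_scalars \<phi> M) (carrier R) S (ideal_smult (ideal_prod A J I) M)"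
proof -
  let ?N = "restrict_scalars \<phi> M" and ?B = "restrict_scalars (\<lambda>r. I +>\<^bsub>A\<^esub> \<phi> r) (ring_as_module (A Quot I))"
  interpret A: cring A by fact
  interpret R: cring R by fact
  interpret I: ideal I A by fact
  interpret M: module A M using M by (simp add: finite_module_def)
  interpret N: module R ?N by (rule module_restrict_scalars[OF R \<phi> M.module_axioms])
  interpret B: module R ?B using fin by (simp add: finite_module_def)
  have J_ideal: "ideal J A" unfolding J by (rule A.genideal_ideal[OF G(2)])
  have JI_ideal: "ideal (ideal_prod A J I) A" by (rule A.ideal_prod_is_ideal[OF J_ideal I])
  have GJ: "G \<subseteq> J" unfolding J by (rule A.genideal_self[OF G(2)])
  obtain E where E: "finite E" "E \<subseteq> carrier M" "M.span E = carrier M"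
    using M unfolding finite_module_def by blast
  obtain C where C: "finite C" "C \<subseteq> carrier ?B" "B.span C = carrier ?B"
    using fin unfolding finite_module_def by blast
  have "C \<subseteq> (\<lambda>a. I +>\<^bsub>A\<^esub> a) ` carrier A"
    using C(2) by (auto simp: FactRing_def A_RCOSETS_def')
  then obtain T where T: "finite T" "T \<subseteq> carrier A" "C = (\<lambda>a. I +>\<^bsub>A\<^esub> a) ` T"
    using C(1) by (meson finite_subset_image)
  define S where "S = (\<lambda>(g, t, m). (g \<otimes>\<^bsub>A\<^esub> t) \<odot>\<^bsub>M\<^esub> m) ` (G \<times> T \<times> E)"
  define L where "L = ideal_smult (ideal_prod A J I) M"
  define Z where "Z = comb ?N (carrier R) S L"
  have S: "finite S" "S \<subseteq> carrier M"
    unfolding S_def using G T E by auto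
  have L: "LinearCombinations.submodule R L ?N"
    unfolding L_def
    by (rule submodule_restrict_scalars[OF R \<phi> M.module_axioms M.ideal_smult_submodule(1)[OF JI_ideal]])
  have Z: "LinearCombinations.submodule R Z ?N"
    unfolding Z_def using S by (intro N.comb_submodule[OF R.oneideal _ L]) simp
  have LZ: "x \<in> Z" if "x \<in> L" for x
    unfolding Z_def by (rule comb.base[OF that])
  have SZ: "x \<in> Z" if x: "x \<in> S" for x
  proof -
    have "\<one>\<^bsub>R\<^esub> \<odot>\<^bsub>?N\<^esub> x \<in> Z"
      unfolding Z_def using x S N.smult_closed[OF R.one_closed, of x] by (intro N.comb_gen[OF L]) auto
    then show ?thesis using N.smult_one[of x] x S by auto
  qed
  have Zadd: "x \<oplus>\<^bsub>M\<^esub> y \<in> Z" if "x \<in> Z" "y \<in> Z" for x y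
    using N.submodD(3)[OF Z that] by simp
  have Zsm: "\<phi> r \<odot>\<^bsub>M\<^esub> x \<in> Z" if "r \<in> carrier R" "x \<in> Z" for r x
    using N.submodD(4)[OF Z that] by simp
  have Z0: "\<zero>\<^bsub>M\<^esub> \<in> Z" using N.submodD(2)[OF Z] by simp
  have \<phi>c: "\<phi> r \<in> carrier A" if "r \<in> carrier R" for r using ring_hom_closed[OF \<phi> that] .
  have giZ: "(i \<otimes>\<^bsub>A\<^esub> g) \<odot>\<^bsub>M\<^esub> m \<in> Z" if "i \<in> I" "g \<in> G" "m \<in> carrier M" for i g m
  proof -
    have "g \<otimes>\<^bsub>A\<^esub> i \<in> ideal_prod A J I" using that GJ by (intro ideal_prod.prod) auto
    then have "(g \<otimes>\<^bsub>A\<^esub> i) \<odot>\<^bsub>M\<^esub> m \<in> L"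
      unfolding L_def using that(3) by (rule M.ideal_smult_submodule(2)[OF JI_ideal])
    moreover have "g \<otimes>\<^bsub>A\<^esub> i = i \<otimes>\<^bsub>A\<^esub> g" using that G I.Icarr by (intro A.m_comm) auto
    ultimately show ?thesis by (intro LZ) simp
  qed
  \<comment> \<open>Coefficients in \<open>A\<close> are reduced modulo \<open>I\<close> to the span of \<open>T\<close>.\<close>
  have gen: "(a \<otimes>\<^bsub>A\<^esub> g) \<odot>\<^bsub>M\<^esub> m \<in> Z" if a: "a \<in> carrier A" and g: "g \<in> G" and m: "m \<in> E" for a g m
  proof -
    have gA: "g \<in> carrier A" and mM: "m \<in> carrier M" using g m G E by auto
    define W where "W = {D \<in> carrier ?B. \<forall>a\<in>D. a \<in> carrier A \<and> (a \<otimes>\<^bsub>A\<^esub> g) \<odot>\<^bsub>M\<^esub> m \<in> Z}"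
    have coset: "\<forall>b\<in>I +>\<^bsub>A\<^esub> a. b \<in> carrier A \<and> (b \<otimes>\<^bsub>A\<^esub> g) \<odot>\<^bsub>M\<^esub> m \<in> Z"
      if a: "a \<in> carrier A" and aZ: "(a \<otimes>\<^bsub>A\<^esub> g) \<odot>\<^bsub>M\<^esub> m \<in> Z" for a
    proof
      fix b assume "b \<in> I +>\<^bsub>A\<^esub> a"
      then obtain i where i: "i \<in> I" "b = i \<oplus>\<^bsub>A\<^esub> a" unfolding a_r_coset_def' by blast
      have iA: "i \<in> carrier A" using i I.Icarr by blast
      have "(b \<otimes>\<^bsub>A\<^esub> g) \<odot>\<^bsub>M\<^esub> m = (i \<otimes>\<^bsub>A\<^esub> g) \<odot>\<^bsub>M\<^esub> m \<oplus>\<^bsub>M\<^esub> (a \<otimes>\<^bsub>A\<^esub> g) \<odot>\<^bsub>M\<^esub> m"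
        using i iA a gA mM by (simp add: A.l_distr M.smult_l_distr)
      then show "b \<in> carrier A \<and> (b \<otimes>\<^bsub>A\<^esub> g) \<odot>\<^bsub>M\<^esub> m \<in> Z"
        using Zadd[OF giZ[OF i(1) g mM] aZ] i iA a by simp
    qed
    have cosetW: "I +>\<^bsub>A\<^esub> a \<in> W" if "a \<in> carrier A" "(a \<otimes>\<^bsub>A\<^esub> g) \<odot>\<^bsub>M\<^esub> m \<in> Z" for a
      unfolding W_def using coset[OF that] that(1) by (auto simp: FactRing_def A_RCOSETS_def')
    have Wcases: "\<exists>a. D = I +>\<^bsub>A\<^esub> a \<and> a \<in> carrier A \<and> (a \<otimes>\<^bsub>A\<^esub> g) \<odot>\<^bsub>M\<^esub> m \<in> Z" if D: "D \<in> W" for D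
    proof -
      obtain a where a: "D = I +>\<^bsub>A\<^esub> a" "a \<in> carrier A"
        using D by (auto simp: W_def FactRing_def A_RCOSETS_def')
      then have "a \<in> D" using I.a_rcos_self by blast
      then show ?thesis using D a unfolding W_def by blast
    qed
    have "LinearCombinations.submodule R W ?B"
    proof (rule B.submodI)
      show "W \<subseteq> carrier ?B" by (auto simp: W_def)
      have "I +>\<^bsub>A\<^esub> \<zero>\<^bsub>A\<^esub> \<in> W" by (rule cosetW) (use gA mM Z0 in simp_all)
      moreover have "\<zero>\<^bsub>?B\<^esub> = I +>\<^bsub>A\<^esub> \<zero>\<^bsub>A\<^esub>"
        using I.a_rcos_const[OF I.zero_closed] by (simp add: FactRing_def)
      ultimately show "\<zero>\<^bsub>?B\<^esub> \<in> W" by simp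
    next
      fix D D' assume "D \<in> W" "D' \<in> W"
      then obtain a b where a: "D = I +>\<^bsub>A\<^esub> a" "a \<in> carrier A" "(a \<otimes>\<^bsub>A\<^esub> g) \<odot>\<^bsub>M\<^esub> m \<in> Z"
        and b: "D' = I +>\<^bsub>A\<^esub> b" "b \<in> carrier A" "(b \<otimes>\<^bsub>A\<^esub> g) \<odot>\<^bsub>M\<^esub> m \<in> Z"
        using Wcases by metis
      have "((a \<oplus>\<^bsub>A\<^esub> b) \<otimes>\<^bsub>A\<^esub> g) \<odot>\<^bsub>M\<^esub> m = (a \<otimes>\<^bsub>A\<^esub> g) \<odot>\<^bsub>M\<^esub> m \<oplus>\<^bsub>M\<^esub> (b \<otimes>\<^bsub>A\<^esub> g) \<odot>\<^bsub>M\<^esub> m"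
        using a(2) b(2) gA mM by (simp add: A.l_distr M.smult_l_distr)
      then have "I +>\<^bsub>A\<^esub> (a \<oplus>\<^bsub>A\<^esub> b) \<in> W" using a b by (intro cosetW) (simp_all add: Zadd)
      then show "D \<oplus>\<^bsub>?B\<^esub> D' \<in> W"
        using I.a_rcos_sum[OF a(2) b(2)] by (simp add: a(1) b(1) FactRing_def)
    next
      fix r D assume r: "r \<in> carrier R" and "D \<in> W"
      then obtain a where a: "D = I +>\<^bsub>A\<^esub> a" "a \<in> carrier A" "(a \<otimes>\<^bsub>A\<^esub> g) \<odot>\<^bsub>M\<^esub> m \<in> Z"
        using Wcases by metis
      have "((\<phi> r \<otimes>\<^bsub>A\<^esub> a) \<otimes>\<^bsub>A\<^esub> g) \<odot>\<^bsub>M\<^esub> m = \<phi> r \<odot>\<^bsub>M\<^esub> ((a \<otimes>\<^bsub>A\<^esub> g) \<odot>\<^bsub>M\<^esub> m)"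
        using a(2) \<phi>c[OF r] gA mM by (simp add: A.m_assoc M.smult_assoc1)
      then have "I +>\<^bsub>A\<^esub> (\<phi> r \<otimes>\<^bsub>A\<^esub> a) \<in> W"
        using a(2) \<phi>c[OF r] Zsm[OF r a(3)] by (intro cosetW) simp_all
      then show "r \<odot>\<^bsub>?B\<^esub> D \<in> W"
        using I.rcoset_mult_add[OF \<phi>c[OF r] a(2)] by (simp add: a(1) FactRing_def)
    qed
    moreover have "C \<subseteq> W"
      unfolding T(3)
    proof (rule image_subsetI)
      fix t assume t: "t \<in> T"
      have "(g \<otimes>\<^bsub>A\<^esub> t) \<odot>\<^bsub>M\<^esub> m \<in> S"
        unfolding S_def using g t m by (intro image_eqI[of _ _ "(g, t, m)"]) simp_all
      moreover have "g \<otimes>\<^bsub>A\<^esub> t = t \<otimes>\<^bsub>A\<^esub> g" using t T gA by (intro A.m_comm) auto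
      ultimately show "I +>\<^bsub>A\<^esub> t \<in> W" using t T SZ by (intro cosetW) auto
    qed
    ultimately have "carrier ?B \<subseteq> W" using B.span_is_subset C(3) by blast
    moreover have "I +>\<^bsub>A\<^esub> a \<in> carrier ?B" using a by (auto simp: FactRing_def A_RCOSETS_def')
    ultimately show ?thesis using I.a_rcos_self[OF a] unfolding W_def by blast
  qed
  have genM: "(a \<otimes>\<^bsub>A\<^esub> g) \<odot>\<^bsub>M\<^esub> x \<in> Z" if a: "a \<in> carrier A" and g: "g \<in> G" and x: "x \<in> carrier M" for a g x
  proof -
    have gA: "g \<in> carrier A" using g G by blast
    \<comment> \<open>Asking for all coefficients \<open>a\<close> at once makes the condition on \<open>x\<close> stable under scalars of \<open>A\<close>,
      although \<open>Z\<close> is a submodule over \<open>R\<close> only.\<close>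
    let ?W = "{x \<in> carrier M. \<forall>a\<in>carrier A. (a \<otimes>\<^bsub>A\<^esub> g) \<odot>\<^bsub>M\<^esub> x \<in> Z}"
    have "LinearCombinations.submodule A ?W M"
    proof (rule M.submodI)
      fix b x assume b: "b \<in> carrier A" and x: "x \<in> ?W"
      have "(a \<otimes>\<^bsub>A\<^esub> g) \<odot>\<^bsub>M\<^esub> (b \<odot>\<^bsub>M\<^esub> x) = ((a \<otimes>\<^bsub>A\<^esub> b) \<otimes>\<^bsub>A\<^esub> g) \<odot>\<^bsub>M\<^esub> x" if "a \<in> carrier A" for a
        using that b gA x by (simp add: M.smult_assoc1[symmetric] A.m_ac)
      then show "b \<odot>\<^bsub>M\<^esub> x \<in> ?W" using x b by simp
    qed (use gA Z0 in \<open>auto simp: M.smult_r_distr Zadd\<close>)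
    moreover have "E \<subseteq> ?W" using E gen[OF _ g] by blast
    ultimately have "carrier M \<subseteq> ?W" using M.span_is_subset E(3) by blast
    then show ?thesis using a x by blast
  qed
  have "ideal {a \<in> carrier A. \<forall>x\<in>carrier M. a \<odot>\<^bsub>M\<^esub> x \<in> Z} A" (is "ideal ?K A")
  proof (rule idealI[OF A.ring_axioms])
    show "subgroup ?K (add_monoid A)"
    proof (rule A.add.subgroupI)
      show "?K \<noteq> {}" using Z0 A.zero_closed M.smult_l_null by fastforce
      fix a assume a: "a \<in> ?K"
      have "(\<ominus>\<^bsub>A\<^esub> a) \<odot>\<^bsub>M\<^esub> x = a \<odot>\<^bsub>M\<^esub> (\<ominus>\<^bsub>M\<^esub> x)" if "x \<in> carrier M" for x
        using a that by (simp add: M.smult_l_minus M.smult_r_minus)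
      then show "\<ominus>\<^bsub>A\<^esub> a \<in> ?K" using a by simp
    next
      fix a b assume "a \<in> ?K" "b \<in> ?K"
      then show "a \<oplus>\<^bsub>A\<^esub> b \<in> ?K" by (simp add: M.smult_l_distr Zadd)
    qed auto
    have *: "b \<otimes>\<^bsub>A\<^esub> a \<in> ?K" if "a \<in> ?K" "b \<in> carrier A" for a b
    proof -
      have "(b \<otimes>\<^bsub>A\<^esub> a) \<odot>\<^bsub>M\<^esub> x = a \<odot>\<^bsub>M\<^esub> (b \<odot>\<^bsub>M\<^esub> x)" if "x \<in> carrier M" for x
        using that \<open>a \<in> ?K\<close> \<open>b \<in> carrier A\<close> by (simp add: M.smult_assoc1[symmetric] A.m_comm)
      then show ?thesis using that by simp
    qed
    show "b \<otimes>\<^bsub>A\<^esub> a \<in> ?K" if "a \<in> ?K" "b \<in> carrier A" for a b by (rule *[OF that])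
    show "a \<otimes>\<^bsub>A\<^esub> b \<in> ?K" if "a \<in> ?K" "b \<in> carrier A" for a b
      using *[OF that] A.m_comm[OF _ that(2), of a] that(1) by simp
  qed
  moreover have "G \<subseteq> ?K"
  proof
    fix g assume g: "g \<in> G"
    have gA: "g \<in> carrier A" using g G by blast
    have "g \<odot>\<^bsub>M\<^esub> x \<in> Z" if "x \<in> carrier M" for x
      using genM[OF A.one_closed g that] gA by simp
    then show "g \<in> ?K" using gA by simp
  qed
  ultimately have JK: "J \<subseteq> ?K" unfolding J by (rule A.genideal_minimal)
  have "ideal_smult J M \<subseteq> Z"
  proof
    fix x assume "x \<in> ideal_smult J M"
    then have "x \<in> generate (add_monoid M) {a \<odot>\<^bsub>M\<^esub> x | a x. a \<in> J \<and> x \<in> carrier M}"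
      by (simp add: ideal_smult_def)
    then show "x \<in> Z"
    proof induction
      case one
      then show ?case using Z0 by simp
    next
      case (incl h)
      then show ?case using JK by blast
    next
      case (inv h)
      then have "h \<in> Z" using JK by blast
      then have "\<ominus>\<^bsub>?N\<^esub> h \<in> Z" by (rule N.submodD(5)[OF Z])
      moreover have "\<ominus>\<^bsub>?N\<^esub> h = inv\<^bsub>add_monoid M\<^esub> h"
        by (simp add: a_inv_def m_inv_def)
      ultimately show ?case by simp
    next
      case (eng h1 h2)
      then show ?case using Zadd by simp
    qed
  qed
  then show thesis using that S unfolding Z_def L_def by blast
qed

text \<open>Refining the generators along the filtration by the submodules \<open>I\<^sup>n M\<close>. That \<open>A\<close> is Noetherian
  supplies finitely many generators of each power \<open>I\<^sup>n\<close>.\<close>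

lemma finite_modulo_ideal_power:
  assumes R: "cring R" and A: "cring A" "noetherian_ring A" and \<phi>: "\<phi> \<in> ring_hom R A"
    and I: "ideal I A"
    and fin: "finite_module R (restrict_scalars (\<lambda>r. I +>\<^bsub>A\<^esub> \<phi> r) (ring_as_module (A Quot I)))"
    and M: "finite_module A M"
  shows "\<exists>S. finite S \<and> S \<subseteq> carrier M \<and> carrier M \<subseteq> comb (restrict_scalars \<phi> M) (carrier R) S
    (ideal_smult (I [^]\<^bsub>ideals_set A\<^esub> (n::nat)) M)"
proof (induction n)
  let ?N = "restrict_scalars \<phi> M"
  interpret A: cring A by fact
  interpret M: module A M using M by (simp add: finite_module_def)
  case 0
  have I0: "I [^]\<^bsub>ideals_set A\<^esub> (0::nat) = carrier A"
    by (simp add: nat_pow_def ideals_set_def)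
  have "x \<in> ideal_smult (carrier A) M" if "x \<in> carrier M" for x
    using M.ideal_smult_submodule(2)[OF A.oneideal A.one_closed that] that by simp
  then show ?case unfolding I0 by (intro exI[of _ "{}"]) (auto intro: comb.base)
next
  case (Suc n)
  let ?N = "restrict_scalars \<phi> M" and ?J = "I [^]\<^bsub>ideals_set A\<^esub> n"
  interpret A: cring A by fact
  interpret R: cring R by fact
  interpret M: module A M using M by (simp add: finite_module_def)
  interpret N: module R ?N by (rule module_restrict_scalars[OF R \<phi> M.module_axioms])
  have J: "ideal ?J A" by (rule A.ideal_power_ideal[OF I])
  obtain S where S: "finite S" "S \<subseteq> carrier M" "carrier M \<subseteq> comb ?N (carrier R) S (ideal_smult ?J M)"
    using Suc.IH by blast
  obtain G where G: "G \<subseteq> carrier A" "finite G" "?J = genideal A G"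
    using noetherian_ring.finetely_gen[OF A(2) J] by blast
  obtain S' where S': "finite S'" "S' \<subseteq> carrier M"
    "ideal_smult ?J M \<subseteq> comb ?N (carrier R) S' (ideal_smult (ideal_prod A ?J I) M)"
    using ideal_smult_finite_step[OF R A(1) \<phi> I fin M G(2,1,3)] by blast
  let ?L = "ideal_smult (ideal_prod A ?J I) M"
  have L: "LinearCombinations.submodule R ?L ?N"
    by (rule submodule_restrict_scalars[OF R \<phi> M.module_axioms
        M.ideal_smult_submodule(1)[OF A.ideal_prod_is_ideal[OF J I]]])
  have SS: "S \<union> S' \<subseteq> carrier ?N" using S S' by simp
  have sub: "LinearCombinations.submodule R (comb ?N (carrier R) (S \<union> S') ?L) ?N"
    by (rule N.comb_submodule[OF R.oneideal SS L])
  have "comb ?N (carrier R) S (ideal_smult ?J M) \<subseteq> comb ?N (carrier R) (S \<union> S') ?L"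
  proof (rule N.comb_subset[OF sub])
    show "ideal_smult ?J M \<subseteq> comb ?N (carrier R) (S \<union> S') ?L"
      using S'(3) N.comb_mono[of "carrier R" "carrier R" S' "S \<union> S'" ?L ?L] by blast
    fix r s assume r: "r \<in> carrier R" and s: "s \<in> S"
    have "s \<in> carrier ?N" using s SS by blast
    then show "r \<odot>\<^bsub>?N\<^esub> s \<in> comb ?N (carrier R) (S \<union> S') ?L"
      using r s by (intro N.comb_gen[OF L]) (simp_all del: restrict_scalars_simps)
  qed
  then show ?case
    unfolding A.ideal_power_Suc using S S' by (intro exI[of _ "S \<union> S'"]) auto
qed

section \<open>Semicontinuity\<close>

text \<open>The set \<open>B\<close> of the local basis has exactly as many elements as the dimension at \<open>p\<close>, because the
  dual functionals make it independent there. Away from \<open>f\<close> it still generates, which bounds the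
  dimension from above.\<close>

lemma fibre_dim_locally_le:
  assumes \<phi>: "\<phi> \<in> ring_hom R A" and M: "module A M" and J: "ideal J A"
    and S: "finite S" "S \<subseteq> carrier M"
      "carrier M \<subseteq> comb (restrict_scalars \<phi> M) (carrier R) S (ideal_smult J M)"
    and p: "primeideal p R"
  obtains f where "f \<in> carrier R - p"
    "\<And>q. primeideal q R \<Longrightarrow> f \<notin> q \<Longrightarrow> fibre_dim R \<phi> M J q \<le> fibre_dim R \<phi> M J p"
proof -
  let ?N = "restrict_scalars \<phi> M"
  interpret p: fibre_space p R A M \<phi> J
    using p M \<phi> J by (simp add: fibre_space_def fibre_space_axioms_def)
  have L: "LinearCombinations.submodule R (ideal_smult J M) ?N"
    by (rule submodule_restrict_scalars[OF p.is_cring \<phi> M p.M.ideal_smult_submodule(1)[OF J]])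
  have S': "S \<subseteq> carrier ?N" "\<And>x. x \<in> carrier ?N \<Longrightarrow> x \<in> comb ?N (carrier R) S (ideal_smult J M)"
    using S by auto
  show thesis
  proof (rule module.local_basis[OF p.module_M p L S(1) S'], goal_cases)
    case (1 x)
    then show ?case by simp
  next
    case (2 B f \<mu>)
    have gen: "\<phi> f \<odot>\<^bsub>M\<^esub> x \<in> comb ?N (carrier R) B (ideal_smult J M)" if "x \<in> carrier M" for x
      using 2(4)[of x] that by simp
    have B: "B \<subseteq> carrier M" using 2(2) by simp
    have fin: "p.V.fin_dim" by (rule p.fibre_dim_le(1)[OF 2(1) B 2(3) gen])
    have "card B \<le> fibre_dim R \<phi> M J p"
      by (rule p.card_le_fibre_dim[where \<mu> = \<mu>, OF fin 2(1) B]) (use 2(5-) in simp_all)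
    moreover have "fibre_dim R \<phi> M J q \<le> card B" if q: "primeideal q R" "f \<notin> q" for q
    proof -
      interpret q: fibre_space q R A M \<phi> J
        using q M \<phi> J by (simp add: fibre_space_def fibre_space_axioms_def)
      have "f \<in> carrier R - q" using 2(3) q(2) by blast
      then show ?thesis using gen by (rule q.fibre_dim_le(2)[OF 2(1) B])
    qed
    ultimately have "fibre_dim R \<phi> M J q \<le> fibre_dim R \<phi> M J p"
      if "primeideal q R" "f \<notin> q" for q
      by (rule order_trans[rotated]) (use that in simp_all)
    then show ?case by (rule that[OF 2(3)])
  qed
qed

lemma upper_semicontinuous_fibre_dim:
  assumes R: "cring R" and \<phi>: "\<phi> \<in> ring_hom R A" and M: "module A M" and J: "ideal J A"
    and S: "finite S" "S \<subseteq> carrier M"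
      "carrier M \<subseteq> comb (restrict_scalars \<phi> M) (carrier R) S (ideal_smult J M)"
  shows "upper_semicontinuous (zariski R) (<) (\<lambda>p. int (fibre_dim R \<phi> M J p))"
  unfolding upper_semicontinuous_def
proof (intro allI)
  fix l :: int
  interpret R: cring R by fact
  let ?U = "{p \<in> topspace (zariski R). int (fibre_dim R \<phi> M J p) < l}"
  have "\<exists>D. openin (zariski R) D \<and> p \<in> D \<and> D \<subseteq> ?U" if "p \<in> ?U" for p
  proof -
    have p: "primeideal p R" and pl: "int (fibre_dim R \<phi> M J p) < l"
      using that by (simp_all add: R.topspace_zariski)
    obtain f where f: "f \<in> carrier R - p"
      and le: "\<And>q. primeideal q R \<Longrightarrow> f \<notin> q \<Longrightarrow> fibre_dim R \<phi> M J q \<le> fibre_dim R \<phi> M J p"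
      using fibre_dim_locally_le[OF \<phi> M J S p] by blast
    have fR: "f \<in> carrier R" using f by blast
    let ?D = "{q. primeideal q R \<and> \<not> cgenideal R f \<subseteq> q}"
    have mem: "cgenideal R f \<subseteq> q \<longleftrightarrow> f \<in> q" if "primeideal q R" for q
      using R.cgenideal_self[OF fR] R.cgenideal_minimal[OF primeideal.axioms(1)[OF that]] by blast
    have "openin (zariski R) ?D"
      unfolding R.openin_zariski using R.cgenideal_ideal[OF fR] by blast
    moreover have "p \<in> ?D" using p f mem[OF p] by simp
    moreover have "?D \<subseteq> ?U"
    proof
      fix q assume q: "q \<in> ?D"
      then have qp: "primeideal q R" by simp
      have "fibre_dim R \<phi> M J q \<le> fibre_dim R \<phi> M J p" using q mem[OF qp] by (intro le[OF qp]) simp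
      then show "q \<in> ?U" using pl qp by (simp add: R.topspace_zariski)
    qed
    ultimately show ?thesis by blast
  qed
  then show "openin (zariski R) ?U" by (subst openin_subopen) blast
qed

text \<open>For integer sequences, strict inequality at the first place of difference persists near a point:
  the earlier entries can only drop, and if one of them drops, the inequality holds at that place.\<close>

lemma upper_semicontinuous_less_fun:
  fixes f :: "'a \<Rightarrow> nat \<Rightarrow> int"
  assumes "\<And>k. upper_semicontinuous T (<) (\<lambda>x. f x k)"
  shows "upper_semicontinuous T less_fun f"
  unfolding upper_semicontinuous_def
proof (intro allI)
  fix l :: "nat \<Rightarrow> int"
  let ?U = "{x \<in> topspace T. less_fun (f x) l}"
  have op: "openin T {x \<in> topspace T. f x k < c}" for k c
    using assms unfolding upper_semicontinuous_def by blast
  have "\<exists>D. openin T D \<and> x \<in> D \<and> D \<subseteq> ?U" if x: "x \<in> ?U" for x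
  proof -
    obtain n where n: "f x n < l n" "\<And>j. j < n \<Longrightarrow> f x j = l j"
      using x by (auto elim: less_funE)
    define D where "D = (\<Inter>j\<in>{..n}. {y \<in> topspace T. f y j < (if j = n then l j else l j + 1)})"
    have "openin T D"
      unfolding D_def by (intro openin_INT2 op) auto
    moreover have "x \<in> D" using x n by (auto simp: D_def)
    moreover have "D \<subseteq> ?U"
    proof
      fix y assume y: "y \<in> D"
      have Dy: "f y j < (if j = n then l j else l j + 1)" if "j \<le> n" for j
        using y that unfolding D_def by blast
      have yn: "f y n < l n" using Dy[of n] by simp
      have yj: "f y j \<le> l j" if "j < n" for j
        using Dy[of j] that by simp
      let ?m = "LEAST j. f y j < l j"
      have m: "f y ?m < l ?m" using yn by (rule LeastI)
      have "?m \<le> n" using yn by (rule Least_le)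
      then have "f y j = l j" if "j < ?m" for j
        using not_less_Least[OF that] yj[of j] that by simp
      then have "less_fun (f y) l" using m by (intro less_funI) blast
      moreover have "y \<in> topspace T" using y by (auto simp: D_def)
      ultimately show "y \<in> ?U" by simp
    qed
    ultimately show ?thesis by blast
  qed
  then show "openin T ?U" by (subst openin_subopen) blast
qed

theorem theorem3p4:
  fixes R :: "('r, 'x) ring_scheme" and A :: "('a, 'y) ring_scheme"
    and M :: "('a, 'm, 'z) module_scheme" and \<phi> :: "'r \<Rightarrow> 'a" and I :: "'a set"
  assumes "cring R" and "noetherian_ring R"
    and "cring A" and "noetherian_ring A"
    and "\<phi> \<in> ring_hom R A"
    and "ideal I A"
    and "finite_module R
           (restrict_scalars (\<lambda>r. I +>\<^bsub>A\<^esub> \<phi> r) (ring_as_module (A Quot I)))"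
    and "finite_module A M"
  shows "(\<forall>n::nat. upper_semicontinuous (zariski R) (<)
             (\<lambda>p. int (fibre_dim R \<phi> M (I [^]\<^bsub>ideals_set A\<^esub> n) p))) \<and>
         upper_semicontinuous (zariski R) less_fun
           (\<lambda>p (k::nat). int (fibre_dim R \<phi> M (I [^]\<^bsub>ideals_set A\<^esub> (k + 1)) p))"
proof -
  have M: "module A M" using assms(8) by (simp add: finite_module_def)
  have "upper_semicontinuous (zariski R) (<)
      (\<lambda>p. int (fibre_dim R \<phi> M (I [^]\<^bsub>ideals_set A\<^esub> n) p))" for n :: nat
  proof -
    obtain S where S: "finite S" "S \<subseteq> carrier M"
      "carrier M \<subseteq> comb (restrict_scalars \<phi> M) (carrier R) S (ideal_smult (I [^]\<^bsub>ideals_set A\<^esub> n) M)"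
      using finite_modulo_ideal_power[OF assms(1,3-8)] by blast
    show ?thesis
      by (rule upper_semicontinuous_fibre_dim[OF assms(1,5) M cring.ideal_power_ideal[OF assms(3,6)] S])
  qed
  then show ?thesis by (intro conjI allI upper_semicontinuous_less_fun)
qed

end
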